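(* Let $E$ be a countable set and let $A$ be an operator on $\mathcal H_0=l^2(E)$ satisfying hypothesis (H) (stated in the context). Then the determinantal point process $\mu$ corresponding to the operator $A(I+A)^{-1}$ is a Gibbs measure for the interaction potential $$V(\xi)=-\log\det(A(x,y))_{x,y\in\xi},\qquad \xi\subset E\ \text{finite},$$ i.e. $\mu$ is admitted to the Gibbsian specification $(\gamma_\Lambda)_{\Lambda}$ determined by $V$ (defined in the context). Moreover, $\mu$ is the only Gibbs measure for this potential: every probability measure admitted to $(\gamma_\Lambda)_{\Lambda}$ equals $\mu$.
   Context: $E$ is a countable set; $\mathcal H_0:=l^2(E)$ is the complex Hilbert space with inner product $(f,g)_0=\sum_{x\in E}\overline{f(x)}g(x)$, and $\{e_x:x\in E\}$ is its usual orthonormal basis. Let $A$ be a bounded Hermitian positive definite linear operator on $\mathcal H_0$ (i.e. $(f,Af)_0\ge 0$ for all $f$) with $\ker A=\{0\}$, and $A(x,y):=(e_x,Ae_y)_0$. $\mathcal H_-$ is the completion of $\mathcal H_0$ with respect to the norm $\|f\|_-$ given by $\|f\|_-^2:=(f,Af)_0$. $\mathcal H_-$ is said to be functionally completed if the completion $\mathcal H_-$ of $(\mathcal H_0,\|\cdot\|_-)$ is obtained by adjoining functions on $E$ to $\mathcal H_0$ (so $\mathcal H_-$ is a Hilbert space of functions on $E$) in such a way that for every $y\in E$ the evaluation $f\mapsto f(y)$ is continuous on $\mathcal H_-$. Equivalently: (i) for every $y\in E$, $f\mapsto f(y)$ is continuous on $(\mathcal H_0,\|\cdot\|_-)$; (ii)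 every $\|\cdot\|_-$-Cauchy sequence $\{f_n\}\subset\mathcal H_0$ with $f_n(y)\to0$ for every $y\in E$ satisfies $\|f_n\|_-\to0$. Hypothesis (H): the Hermitian positive definite linear operator $A$ on $\mathcal H_0$ is bounded and satisfies (i) $\ker A=\{0\}$; (ii) $\mathcal H_-$ is functionally completed. Configuration space: $\mathcal X$ is the set of all subsets of $E$, identified with $\{0,1\}^E$ with the product topology and Borel $\sigma$-algebra $\mathcal F$. For $\Delta\subset E$, $\mathcal F_\Delta$ is the $\sigma$-algebra on $\mathcal X$ generated by the occupation variables at the sites $x\in\Delta$. For $\xi\in\mathcal X$ and $\Delta\subset E$, $\xi_\Delta:=\xi\cap\Delta$; juxtaposition such as $\zeta_\Lambda\xi_{\Lambda^c}$ means union. Determinantal point process: for a Hermitian bounded operator $K$ on $l^2(E)$ with $0\le K\le I$, the determinantal point process corresponding to $K$ is the unique Borel probability measure $\mu$ on $\mathcal X$ with $\mu(\{\xi\in\mathcal X:\xi\supset X\})=\det(K(x,y))_{x,y\in X}$ for every finite $X\subset E$, where $K(x,y)=(e_x,Ke_y)_0$. Gibbsian specification for $V$ (with the determinant of an empty matrix equal to $1$): for disjoint finite $\Lambda_1,\Lambda_2\subset E$ and configurations $\xi_{\Lambda_1}\subset\Lambda_1$, $\xi_{\Lambda_2}\subset\Lambda_2$, the mutual energy $W$ is defined by $V(\xi_{\Lambda_1}\cup\xi_{\Lambda_2})=V(\xi_{\Lambda_1})+V(\xi_{\Lambda_2})+W(\xi_{\Lambda_1};\xi_{\Lambda_2})$.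 For finite $\Lambda\subset E$, $\zeta_\Lambda\subset\Lambda$ and $\xi\in\mathcal X$, $$H_\Lambda(\zeta_\Lambda;\xi):=\lim_{\Delta\uparrow E}\big(V(\zeta_\Lambda)+W(\zeta_\Lambda;\xi_{\Delta\setminus\Lambda})\big),$$ the limit being over finite $\Delta\supset\Lambda$ increasing to $E$; under (H) this limit exists as a finite number for all $\zeta_\Lambda$, $\xi$. Put $Z_\Lambda(\xi):=\sum_{\zeta_\Lambda\subset\Lambda}\exp[-H_\Lambda(\zeta_\Lambda;\xi)]$, $\gamma_\Lambda(\zeta_\Lambda;\xi):=Z_\Lambda(\xi)^{-1}\exp[-H_\Lambda(\zeta_\Lambda;\xi)]$, and for $G\in\mathcal F$, $$\gamma_\Lambda(G|\xi):=\sum_{\zeta_\Lambda\subset\Lambda}\gamma_\Lambda(\zeta_\Lambda;\xi)\,1_G(\zeta_\Lambda\xi_{\Lambda^c}).$$ A probability measure $\nu$ on $(\mathcal X,\mathcal F)$ is admitted to the specification $(\gamma_\Lambda)_\Lambda$ ($\Lambda$ ranging over finite subsets of $E$), or is a Gibbs measure for $V$, if it satisfies the DLR equations $\nu(G)=\int\gamma_\Lambda(G|\xi)\,d\nu(\xi)$ for all $G\in\mathcal F$ and all finite $\Lambda\subset E$; equivalently $E^\nu[1_G|\mathcal F_{\Lambda^c}](\xi)=\gamma_\Lambda(G|\xi)$ for $\nu$-a.a. $\xi$. *)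

theory Defs
  imports "HOL-Probability.Probability"
begin

section \<open>The Hilbert space of square-summable functions on a set\<close>

text \<open>A function on \<open>E\<close> is represented by its extension by \<open>0\<close> to the whole type, so that
  equality of functions on \<open>E\<close> is equality in HOL.\<close>

definition functions_on :: "'a set \<Rightarrow> ('a \<Rightarrow> complex) set" where
  "functions_on E = {f. \<forall>x. x \<notin> E \<longrightarrow> f x = 0}"

definition l2 :: "'a set \<Rightarrow> ('a \<Rightarrow> complex) set" where
  "l2 E = {f \<in> functions_on E. (\<lambda>x. (cmod (f x))\<^sup>2) summable_on E}"

definition l2_inner :: "'a set \<Rightarrow> ('a \<Rightarrow> complex) \<Rightarrow> ('a \<Rightarrow> complex) \<Rightarrow> complex" where
  "l2_inner E f g = (\<Sum>\<^sub>\<infinity>x\<in>E. cnj (f x) * g x)"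

definition l2_norm :: "'a set \<Rightarrow> ('a \<Rightarrow> complex) \<Rightarrow> real" where
  "l2_norm E f = sqrt (Re (l2_inner E f f))"

definition unit_fun :: "'a \<Rightarrow> 'a \<Rightarrow> complex" where
  "unit_fun x = (\<lambda>y. if y = x then 1 else 0)"

text \<open>Operators are maps on functions of which only the values on \<open>l2 E\<close> matter.\<close>

type_synonym 'a operator = "('a \<Rightarrow> complex) \<Rightarrow> ('a \<Rightarrow> complex)"

definition bounded_operator :: "'a set \<Rightarrow> 'a operator \<Rightarrow> bool" where
  "bounded_operator E T \<longleftrightarrow>
     (\<forall>f\<in>l2 E. T f \<in> l2 E) \<and>
     (\<forall>f\<in>l2 E. \<forall>g\<in>l2 E. T (\<lambda>x. f x + g x) = (\<lambda>x. T f x + T g x)) \<and>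
     (\<forall>c. \<forall>f\<in>l2 E. T (\<lambda>x. c * f x) = (\<lambda>x. c * T f x)) \<and>
     (\<exists>C. \<forall>f\<in>l2 E. l2_norm E (T f) \<le> C * l2_norm E f)"

definition hermitian_operator :: "'a set \<Rightarrow> 'a operator \<Rightarrow> bool" where
  "hermitian_operator E T \<longleftrightarrow> (\<forall>f\<in>l2 E. \<forall>g\<in>l2 E. l2_inner E (T f) g = l2_inner E f (T g))"

definition positive_operator :: "'a set \<Rightarrow> 'a operator \<Rightarrow> bool" where
  "positive_operator E T \<longleftrightarrow>
     (\<forall>f\<in>l2 E. l2_inner E f (T f) \<in> \<real> \<and> 0 \<le> Re (l2_inner E f (T f)))"

definition kernel_fun :: "'a set \<Rightarrow> 'a operator \<Rightarrow> 'a \<Rightarrow> 'a \<Rightarrow> complex" where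
  "kernel_fun E T x y = l2_inner E (unit_fun x) (T (unit_fun y))"

text \<open>The operator \<open>A (I + A)\<^sup>-\<^sup>1\<close>. If \<open>A\<close> is bounded, Hermitian and positive, \<open>I + A\<close> is a bijection
  of \<open>l2 E\<close>, so that \<^const>\<open>inv_into\<close> gives its true inverse.\<close>

definition dpp_operator :: "'a set \<Rightarrow> 'a operator \<Rightarrow> 'a operator" where
  "dpp_operator E A = (\<lambda>f. A (inv_into (l2 E) (\<lambda>g x. g x + A g x) f))"


section \<open>Functional completion\<close>

definition inner_product_on ::
    "('a \<Rightarrow> complex) set \<Rightarrow> (('a \<Rightarrow> complex) \<Rightarrow> ('a \<Rightarrow> complex) \<Rightarrow> complex) \<Rightarrow> bool" where
  "inner_product_on H ip \<longleftrightarrow>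
     (\<lambda>_. 0) \<in> H \<and>
     (\<forall>f\<in>H. \<forall>g\<in>H. (\<lambda>x. f x + g x) \<in> H) \<and>
     (\<forall>c. \<forall>f\<in>H. (\<lambda>x. c * f x) \<in> H) \<and>
     (\<forall>f\<in>H. \<forall>g\<in>H. \<forall>h\<in>H. ip f (\<lambda>x. g x + h x) = ip f g + ip f h) \<and>
     (\<forall>c. \<forall>f\<in>H. \<forall>g\<in>H. ip f (\<lambda>x. c * g x) = c * ip f g) \<and>
     (\<forall>f\<in>H. \<forall>g\<in>H. ip g f = cnj (ip f g)) \<and>
     (\<forall>f\<in>H. 0 \<le> Re (ip f f)) \<and>
     (\<forall>f\<in>H. ip f f = 0 \<longrightarrow> f = (\<lambda>_. 0))"

text \<open>The distance is set to \<open>0\<close> outside \<open>H\<close> because the locale \<^locale>\<open>Metric_space\<close> asks for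
  symmetry and nonnegativity on the whole type.\<close>

definition ip_dist ::
    "('a \<Rightarrow> complex) set \<Rightarrow> (('a \<Rightarrow> complex) \<Rightarrow> ('a \<Rightarrow> complex) \<Rightarrow> complex) \<Rightarrow>
     ('a \<Rightarrow> complex) \<Rightarrow> ('a \<Rightarrow> complex) \<Rightarrow> real" where
  "ip_dist H ip f g =
     (if f \<in> H \<and> g \<in> H then sqrt (Re (ip (\<lambda>x. f x - g x) (\<lambda>x. f x - g x))) else 0)"

lemma Metric_space_ip_dist:
  assumes "inner_product_on H ip"
  shows "Metric_space H (ip_dist H ip)"
proof -
  have add: "\<And>f g. f \<in> H \<Longrightarrow> g \<in> H \<Longrightarrow> (\<lambda>x. f x + g x) \<in> H"
    and scale: "\<And>c f. f \<in> H \<Longrightarrow> (\<lambda>x. c * f x) \<in> H"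
    and ip_add: "\<And>f g h. f \<in> H \<Longrightarrow> g \<in> H \<Longrightarrow> h \<in> H \<Longrightarrow> ip f (\<lambda>x. g x + h x) = ip f g + ip f h"
    and ip_scale: "\<And>c f g. f \<in> H \<Longrightarrow> g \<in> H \<Longrightarrow> ip f (\<lambda>x. c * g x) = c * ip f g"
    and ip_cnj: "\<And>f g. f \<in> H \<Longrightarrow> g \<in> H \<Longrightarrow> ip g f = cnj (ip f g)"
    and ip_nonneg: "\<And>f. f \<in> H \<Longrightarrow> 0 \<le> Re (ip f f)"
    and ip_zero: "\<And>f. f \<in> H \<Longrightarrow> ip f f = 0 \<Longrightarrow> f = (\<lambda>_. 0)"
    using assms unfolding inner_product_on_def by blast+
  have Im_zero: "Im (ip f f) = 0" if "f \<in> H" for f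
    using arg_cong[OF ip_cnj[OF that that], of Im] by simp
  have diff: "(\<lambda>x. f x - g x) \<in> H" if "f \<in> H" "g \<in> H" for f g
    using add[OF that(1) scale[OF that(2), of "-1"]] by simp
  have ip_add_left: "ip (\<lambda>x. g x + h x) f = ip g f + ip h f"
    if "f \<in> H" "g \<in> H" "h \<in> H" for f g h
    using ip_add[OF that] ip_cnj that add by (metis complex_cnj_add)
  have ip_scale_left: "ip (\<lambda>x. c * g x) f = cnj c * ip g f" if "f \<in> H" "g \<in> H" for c f g
    using ip_scale[OF that, of c] ip_cnj that scale by (metis complex_cnj_mult)
  have Re_sym: "Re (ip g f) = Re (ip f g)" if "f \<in> H" "g \<in> H" for f g
    using ip_cnj[OF that] by simp
  have expand: "Re (ip (\<lambda>x. f x + of_real t * g x) (\<lambda>x. f x + of_real t * g x))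
      = Re (ip f f) + 2 * t * Re (ip f g) + t\<^sup>2 * Re (ip g g)"
    if "f \<in> H" "g \<in> H" for f g t
  proof -
    note tg = scale[OF that(2), of "of_real t"]
    show ?thesis
      using that tg add[OF that(1) tg] Re_sym[OF that]
      by (simp add: ip_add ip_add_left ip_scale ip_scale_left power2_eq_square algebra_simps)
  qed
  have CS: "Re (ip f g) \<le> sqrt (Re (ip f f)) * sqrt (Re (ip g g))" if "f \<in> H" "g \<in> H" for f g
  proof (cases "Re (ip g g) = 0")
    case True
    then have "ip g g = 0" using Im_zero[OF that(2)] by (simp add: complex_eq_iff)
    then have "g = (\<lambda>_. 0)" using ip_zero that by blast
    then have "ip f g = 0" using ip_scale[OF that, of 0] by simp
    then show ?thesis using ip_nonneg that by simp
  next
    case False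
    then have pos: "0 < Re (ip g g)" using ip_nonneg[OF that(2)] by simp
    define t where "t = - Re (ip f g) / Re (ip g g)"
    have "0 \<le> Re (ip f f) + 2 * t * Re (ip f g) + t\<^sup>2 * Re (ip g g)"
      using ip_nonneg[OF add[OF that(1) scale[OF that(2), of "of_real t"]]] expand[OF that, of t]
      by simp
    also have "\<dots> = Re (ip f f) - (Re (ip f g))\<^sup>2 / Re (ip g g)"
      using pos by (simp add: t_def field_simps power2_eq_square)
    finally have "(Re (ip f g))\<^sup>2 \<le> Re (ip f f) * Re (ip g g)"
      using pos by (simp add: field_simps)
    then show ?thesis by (metis real_le_rsqrt real_sqrt_mult)
  qed
  have tri: "sqrt (Re (ip (\<lambda>x. f x + g x) (\<lambda>x. f x + g x))) \<le> sqrt (Re (ip f f)) + sqrt (Re (ip g g))"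
    if "f \<in> H" "g \<in> H" for f g
  proof (rule real_le_lsqrt)
    show "0 \<le> sqrt (Re (ip f f)) + sqrt (Re (ip g g))"
      using ip_nonneg that by simp
    show "Re (ip (\<lambda>x. f x + g x) (\<lambda>x. f x + g x)) \<le> (sqrt (Re (ip f f)) + sqrt (Re (ip g g)))\<^sup>2"
      using expand[OF that, of 1] CS[OF that] ip_nonneg[OF that(1)] ip_nonneg[OF that(2)]
      by (simp add: power2_sum)
  qed
  show ?thesis
  proof
    show "0 \<le> ip_dist H ip f g" for f g
      using ip_nonneg diff by (simp add: ip_dist_def)
    show "ip_dist H ip f g = ip_dist H ip g f" for f g
    proof (cases "f \<in> H \<and> g \<in> H")
      case True
      then have d: "(\<lambda>x. f x - g x) \<in> H" using diff by blast
      have e: "(\<lambda>x. g x - f x) = (\<lambda>x. (-1) * (f x - g x))" by auto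
      show ?thesis
        using True d scale[OF d, of "-1"] unfolding ip_dist_def e
        by (simp only: ip_scale ip_scale_left) simp
    qed (auto simp: ip_dist_def)
    show "ip_dist H ip f g = 0 \<longleftrightarrow> f = g" if "f \<in> H" "g \<in> H" for f g
    proof
      assume "ip_dist H ip f g = 0"
      then have "ip (\<lambda>x. f x - g x) (\<lambda>x. f x - g x) = 0"
        using that Im_zero[OF diff[OF that]] by (simp add: ip_dist_def complex_eq_iff)
      then have "(\<lambda>x. f x - g x) = (\<lambda>_. 0)" using ip_zero[OF diff[OF that]] by blast
      then show "f = g" by (metis eq_iff_diff_eq_0 ext)
    next
      assume "f = g"
      moreover have "ip (\<lambda>_. 0) (\<lambda>_. 0) = 0"
        using ip_scale[OF diff[OF that] diff[OF that], of 0] ip_scale_left[OF diff[OF that] diff[OF that], of 0]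
          ip_scale[OF scale[OF that(1), of 0] that(1), of 0] by simp
      ultimately show "ip_dist H ip f g = 0" by (simp add: ip_dist_def)
    qed
    show "ip_dist H ip f h \<le> ip_dist H ip f g + ip_dist H ip g h"
      if "f \<in> H" "g \<in> H" "h \<in> H" for f g h
      using tri[OF diff[OF that(1,2)] diff[OF that(2,3)]] that by (simp add: ip_dist_def)
  qed
qed

text \<open>The completion of \<open>l2 E\<close> for the norm \<open>\<parallel>f\<parallel>\<^sub>-\<^sup>2 = (f, A f)\<close> is realised as a Hilbert space \<open>H\<close>
  of functions on \<open>E\<close> containing \<open>l2 E\<close>, with continuous point evaluations.\<close>

definition functionally_completed :: "'a set \<Rightarrow> 'a operator \<Rightarrow> bool" where
  "functionally_completed E A \<longleftrightarrow>
     (\<exists>H ip. l2 E \<subseteq> H \<and> H \<subseteq> functions_on E \<and>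
        inner_product_on H ip \<and>
        (\<forall>f\<in>l2 E. \<forall>g\<in>l2 E. ip f g = l2_inner E f (A g)) \<and>
        Metric_space.mcomplete H (ip_dist H ip) \<and>
        Metric_space.mtopology H (ip_dist H ip) closure_of l2 E = H \<and>
        (\<forall>y\<in>E. continuous_map (Metric_space.mtopology H (ip_dist H ip)) euclidean (\<lambda>f. f y)))"

definition hypothesis_H :: "'a set \<Rightarrow> 'a operator \<Rightarrow> bool" where
  "hypothesis_H E A \<longleftrightarrow>
     bounded_operator E A \<and> hermitian_operator E A \<and> positive_operator E A \<and>
     {f \<in> l2 E. A f = (\<lambda>_. 0)} = {\<lambda>_. 0} \<and>
     functionally_completed E A"


section \<open>Determinants over finite index sets\<close>

definition det_on :: "'a set \<Rightarrow> ('a \<Rightarrow> 'a \<Rightarrow> complex) \<Rightarrow> complex" where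
  "det_on X M = (\<Sum>p\<in>{p. p permutes X}. of_int (sign p) * (\<Prod>x\<in>X. M x (p x)))"

lemma det_on_UNIV: "det_on (UNIV :: 'n::finite set) M = det (\<chi> i j. M i j)"
  by (simp add: det_on_def det_def)

lemma det_on_empty: "det_on {} M = 1"
  by (simp add: det_on_def)


section \<open>Configurations and determinantal point processes\<close>

text \<open>Configurations are subsets of \<open>E\<close>; the topology is that of \<open>{0,1}\<^sup>E\<close>, transported along
  indicator functions.\<close>

definition config_topology :: "'a set \<Rightarrow> 'a set topology" where
  "config_topology E =
     pullback_topology (Pow E) (\<lambda>\<xi>. \<lambda>x\<in>E. x \<in> \<xi>)
       (product_topology (\<lambda>_. discrete_topology (UNIV :: bool set)) E)"

definition config_space :: "'a set \<Rightarrow> 'a set measure" where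
  "config_space E = sigma (Pow E) {U. openin (config_topology E) U}"

definition config_measure :: "'a set \<Rightarrow> 'a set measure \<Rightarrow> bool" where
  "config_measure E \<nu> \<longleftrightarrow> prob_space \<nu> \<and> sets \<nu> = sets (config_space E)"

definition determinantal_process :: "'a set \<Rightarrow> 'a operator \<Rightarrow> 'a set measure \<Rightarrow> bool" where
  "determinantal_process E K \<mu> \<longleftrightarrow>
     config_measure E \<mu> \<and>
     (\<forall>X. finite X \<and> X \<subseteq> E \<longrightarrow>
        complex_of_real (measure \<mu> {\<xi> \<in> Pow E. X \<subseteq> \<xi>}) = det_on X (kernel_fun E K))"


section \<open>Gibbs measures\<close>

text \<open>The determinants below are positive reals under \<^term>\<open>hypothesis_H E A\<close>.\<close>

definition det_potential :: "'a set \<Rightarrow> 'a operator \<Rightarrow> 'a set \<Rightarrow> real" where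
  "det_potential E A \<xi> = - ln (Re (det_on \<xi> (kernel_fun E A)))"

definition mutual_energy :: "('a set \<Rightarrow> real) \<Rightarrow> 'a set \<Rightarrow> 'a set \<Rightarrow> real" where
  "mutual_energy V \<xi>1 \<xi>2 = V (\<xi>1 \<union> \<xi>2) - V \<xi>1 - V \<xi>2"

text \<open>The limit is along the net of finite subsets \<open>\<Delta>\<close> of \<open>E\<close>, which eventually contain \<open>\<Lambda>\<close>. It
  exists for the potentials considered here.\<close>

definition hamiltonian ::
    "'a set \<Rightarrow> ('a set \<Rightarrow> real) \<Rightarrow> 'a set \<Rightarrow> 'a set \<Rightarrow> 'a set \<Rightarrow> real" where
  "hamiltonian E V \<Lambda> \<zeta> \<xi> =
     Lim (finite_subsets_at_top E) (\<lambda>\<Delta>. V \<zeta> + mutual_energy V \<zeta> (\<xi> \<inter> (\<Delta> - \<Lambda>)))"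

definition partition_function ::
    "'a set \<Rightarrow> ('a set \<Rightarrow> real) \<Rightarrow> 'a set \<Rightarrow> 'a set \<Rightarrow> real" where
  "partition_function E V \<Lambda> \<xi> = (\<Sum>\<zeta>\<in>Pow \<Lambda>. exp (- hamiltonian E V \<Lambda> \<zeta> \<xi>))"

definition gibbs_weight ::
    "'a set \<Rightarrow> ('a set \<Rightarrow> real) \<Rightarrow> 'a set \<Rightarrow> 'a set \<Rightarrow> 'a set \<Rightarrow> real" where
  "gibbs_weight E V \<Lambda> \<zeta> \<xi> = exp (- hamiltonian E V \<Lambda> \<zeta> \<xi>) / partition_function E V \<Lambda> \<xi>"

definition specification_kernel ::
    "'a set \<Rightarrow> ('a set \<Rightarrow> real) \<Rightarrow> 'a set \<Rightarrow> 'a set set \<Rightarrow> 'a set \<Rightarrow> real" where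
  "specification_kernel E V \<Lambda> G \<xi> =
     (\<Sum>\<zeta>\<in>Pow \<Lambda>. gibbs_weight E V \<Lambda> \<zeta> \<xi> * indicator G (\<zeta> \<union> (\<xi> - \<Lambda>)))"

definition gibbs_measure :: "'a set \<Rightarrow> ('a set \<Rightarrow> real) \<Rightarrow> 'a set measure \<Rightarrow> bool" where
  "gibbs_measure E V \<nu> \<longleftrightarrow>
     config_measure E \<nu> \<and>
     (\<forall>\<Lambda>. finite \<Lambda> \<and> \<Lambda> \<subseteq> E \<longrightarrow>
        (\<forall>G\<in>sets (config_space E).
           integrable \<nu> (specification_kernel E V \<Lambda> G) \<and>
           measure \<nu> G = (\<integral>\<xi>. specification_kernel E V \<Lambda> G \<xi> \<partial>\<nu>)))"

end

theory Submission
  imports Defs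
begin

text \<open>
  In \<open>\<H>\<^sub>-\<close> the matrix of \<open>A\<close> is the Gram matrix \<open>A(x,y) = (e\<^sub>x,e\<^sub>y)\<^sub>-\<close>, so
  \<open>det A(x\<eta>) / det A(\<eta>)\<close> is the squared distance of \<open>e\<^sub>x\<close> from the span of \<open>\<eta>\<close>. As \<open>\<eta>\<close>
  increases to \<open>\<xi>\<close> it decreases to a limit \<open>\<alpha>(x;\<xi>)\<close>, which is positive because evaluation at \<open>x\<close>
  is continuous and vanishes on the span of \<open>\<xi>\<close>. The Boltzmann factors are products of such limits.

  Given a boundary condition \<open>\<eta>\<close> off \<open>\<Delta>\<close>, the finite volume Gibbs distribution in \<open>\<Delta>\<close> is
  determinantal with kernel \<open>I - G\<close>, where \<open>G\<close> is the inverse of \<open>A + P\<^sub>\<Delta>\<close> on \<open>\<Delta> \<union> \<eta>\<close>. The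
  columns of \<open>G\<close> are bounded in \<open>\<H>\<^sub>-\<close>, and a weak limit \<open>u\<close> of the columns at \<open>x\<close> satisfies
  \<open>u(z) + (e\<^sub>z,u)\<^sub>- = \<delta>\<^sub>x\<^sub>z\<close> for all \<open>z\<close>; since \<open>\<H>\<^sub>-\<close> consists of functions, \<open>u\<close> must be
  \<open>(I + A)\<^sup>-\<^sup>1 e\<^sub>x\<close>. Hence these distributions converge to \<open>\<mu>\<close> for all boundary conditions, which
  gives uniqueness.

  For the DLR equations, \<open>\<mu>(\<xi>\<^sub>\<Delta> = x\<eta>) / \<mu>(\<xi>\<^sub>\<Delta> = \<eta>)\<close> is a limit of minima of
  \<open>\<parallel>e\<^sub>x - w\<parallel>\<^sub>-\<^sup>2 + \<parallel>w - w\<^sub>\<Delta>\<parallel>\<^sub>0\<^sup>2\<close> over finitely supported \<open>w\<close> that vanish on \<open>\<Delta> - \<eta>\<close>. It is at most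
  the squared distance to the span of \<open>\<eta>\<close>; testing with the component \<open>q\<close> of \<open>e\<^sub>x\<close> orthogonal to the
  span of \<open>\<xi>\<close>, where \<open>\<eta> = \<xi>\<^sub>\<Delta>\<close>, shows that it is at least \<open>\<alpha>(x;\<xi>)\<close> minus the sum of
  \<open>|(e\<^sub>z,q)\<^sub>-|\<^sup>2\<close> over \<open>z \<notin> \<Delta>\<close>, a Bessel tail. So the conditional probabilities of \<open>\<mu>\<close> in growing
  volumes converge to the Gibbs weights for every configuration, and dominated convergence applies.
\<close>

section \<open>Determinants and positive definite matrices\<close>

lemma det_on_cong:
  assumes "\<And>x y. x \<in> X \<Longrightarrow> y \<in> X \<Longrightarrow> M x y = N x y"
  shows "det_on X M = det_on X N"
  unfolding det_on_def
  by (intro sum.cong arg_cong2[where f = "(*)"] prod.cong refl)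
     (use assms permutes_in_image in fastforce)

lemma det_on_row:
  assumes "finite X" "x \<in> X"
  shows "det_on X M = (\<Sum>p\<in>{p. p permutes X}. of_int (sign p) * (M x (p x) * (\<Prod>z\<in>X - {x}. M z (p z))))"
  unfolding det_on_def by (intro sum.cong refl arg_cong2[where f = "(*)"] prod.remove assms)

lemma det_on_row_add:
  assumes "finite X" "x \<in> X"
  shows "det_on X (\<lambda>z y. if z = x then a y + b y else M z y) =
    det_on X (\<lambda>z y. if z = x then a y else M z y) + det_on X (\<lambda>z y. if z = x then b y else M z y)"
proof -
  have "(\<Prod>z\<in>X - {x}. if z = x then c (p z) else M z (p z)) = (\<Prod>z\<in>X - {x}. M z (p z))"
    for c :: "'a \<Rightarrow> complex" and p
    by (rule prod.cong) auto
  then show ?thesis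
    unfolding det_on_row[OF assms] by (simp add: algebra_simps sum.distrib)
qed

lemma det_on_transpose:
  assumes "finite X"
  shows "det_on X (\<lambda>x y. M y x) = det_on X M"
proof -
  have "det_on X (\<lambda>x y. M y x) = (\<Sum>p\<in>{p. p permutes X}. of_int (sign (inv p)) * (\<Prod>x\<in>X. M (inv p x) x))"
    unfolding det_on_def by (rule sum_permutations_inverse)
  also have "\<dots> = det_on X M"
    unfolding det_on_def
  proof (rule sum.cong[OF refl])
    fix p assume "p \<in> {p. p permutes X}"
    then have p: "p permutes X" by simp
    have "(\<Prod>x\<in>X. M (inv p x) x) = (\<Prod>x\<in>X. M (inv p (p x)) (p x))"
      by (rule prod.permute[OF p, unfolded o_def])
    also have "\<dots> = (\<Prod>x\<in>X. M x (p x))"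
      using permutes_inverses(2)[OF p] by simp
    finally show "of_int (sign (inv p)) * (\<Prod>x\<in>X. M (inv p x) x) = of_int (sign p) * (\<Prod>x\<in>X. M x (p x))"
      using sign_inverse[of p] permutation_permutes[of p] p assms by auto
  qed
  finally show ?thesis .
qed

text \<open>A permutation that moves \<open>x\<close> sends some \<open>y\<close> in
  \<open>X\<close> to \<open>x\<close> and meets the zero entry \<open>M y x\<close>. The survivors
  fix \<open>x\<close>, so they are the permutations of \<open>X\<close>, with unchanged
  sign.\<close>

lemma det_on_column_expand:
  assumes "finite X" "x \<notin> X" and zero: "\<And>y. y \<in> X \<Longrightarrow> M y x = 0"
  shows "det_on (insert x X) M = M x x * det_on X M"
proof -
  have sub: "{p. p permutes X} \<subseteq> {p. p permutes insert x X}"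
    by (auto intro: permutes_subset)
  have nz: "(\<Prod>z\<in>insert x X. M z (p z)) = 0"
    if p: "p permutes insert x X" and np: "\<not> p permutes X" for p
  proof -
    have "p x \<noteq> x" using p np
      by (metis Diff_iff insert_iff permutes_superset)
    obtain y where y: "p y = x" using permutes_surj[OF p] by (metis surj_def)
    with \<open>p x \<noteq> x\<close> have "y \<noteq> x" by auto
    moreover have "y \<in> insert x X" using y permutes_in_image[OF p, of y] by simp
    ultimately have "y \<in> X" by simp
    then have "M y (p y) = 0" using y zero by simp
    then show ?thesis using \<open>y \<in> X\<close> \<open>finite X\<close> by (meson finite_insert insertI2 prod_zero)
  qed
  have "det_on (insert x X) M = (\<Sum>p\<in>{p. p permutes X}. of_int (sign p) * (\<Prod>z\<in>insert x X. M z (p z)))"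
    unfolding det_on_def
    using assms sub nz by (intro sum.mono_neutral_right) (auto simp: finite_permutations)
  also have "\<dots> = (\<Sum>p\<in>{p. p permutes X}. M x x * (of_int (sign p) * (\<Prod>z\<in>X. M z (p z))))"
    using assms by (intro sum.cong refl) (auto simp: permutes_not_in)
  finally show ?thesis unfolding det_on_def by (simp add: sum_distrib_left)
qed

lemma det_on_row_expand:
  assumes "finite X" "x \<notin> X" and zero: "\<And>y. y \<in> X \<Longrightarrow> M x y = 0"
  shows "det_on (insert x X) M = M x x * det_on X M"
  using det_on_column_expand[of X x "\<lambda>x y. M y x"] det_on_transpose[of "insert x X" M]
    det_on_transpose[of X M] assms by simp

lemma det_on_permute_rows:
  assumes "finite X" "q permutes X"
  shows "det_on X (\<lambda>x y. M (q x) y) = of_int (sign q) * det_on X M"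
proof -
  note iq = permutes_inv[OF assms(2)]
  have pq: "permutation q" using assms permutation_permutes by blast
  have "det_on X M = (\<Sum>p\<in>{p. p permutes X}. of_int (sign (p \<circ> inv q)) * (\<Prod>x\<in>X. M x ((p \<circ> inv q) x)))"
    unfolding det_on_def by (rule sum_permutations_compose_right[OF iq])
  also have "\<dots> = (\<Sum>p\<in>{p. p permutes X}. of_int (sign q) * (of_int (sign p) * (\<Prod>x\<in>X. M (q x) (p x))))"
  proof (rule sum.cong[OF refl])
    fix p assume "p \<in> {p. p permutes X}"
    then have p: "p permutes X" by simp
    then have pp: "permutation p" using assms permutation_permutes by blast
    have "(\<Prod>x\<in>X. M x ((p \<circ> inv q) x)) = (\<Prod>x\<in>X. M (q x) ((p \<circ> inv q) (q x)))"
      by (rule prod.permute[OF assms(2), unfolded o_def])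
    also have "\<dots> = (\<Prod>x\<in>X. M (q x) (p x))"
      using permutes_inverses(2)[OF assms(2)] by simp
    finally show "of_int (sign (p \<circ> inv q)) * (\<Prod>x\<in>X. M x ((p \<circ> inv q) x)) =
      of_int (sign q) * (of_int (sign p) * (\<Prod>x\<in>X. M (q x) (p x)))"
      using sign_compose[OF pp permutation_inverse[OF pq]] sign_inverse[OF pq] by simp
  qed
  also have "\<dots> = of_int (sign q) * det_on X (\<lambda>x y. M (q x) y)"
    by (simp add: det_on_def sum_distrib_left)
  finally show ?thesis
    using sign_idempotent[of q] by (simp add: mult.assoc[symmetric] flip: of_int_mult)
qed

lemma det_on_identical_rows:
  assumes "finite X" "i \<in> X" "j \<in> X" "i \<noteq> j" "\<And>y. y \<in> X \<Longrightarrow> M i y = M j y"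
  shows "det_on X M = 0"
proof -
  have t: "Transposition.transpose i j permutes X" using assms by (intro permutes_swap_id)
  have "det_on X (\<lambda>x y. M (Transposition.transpose i j x) y) = det_on X M"
    by (rule det_on_cong) (use assms in \<open>auto simp: Transposition.transpose_def\<close>)
  with det_on_permute_rows[OF assms(1) t, of M] show ?thesis
    using assms(4) by (simp add: sign_swap_id)
qed

text \<open>Distributing the product over the inner sums gives one term for each map from
  \<open>X\<close> to itself. A map that is not injective repeats a row of \<open>N\<close> and
  contributes zero; the others are the permutations.\<close>

lemma det_on_mult:
  assumes "finite X"
  shows "det_on X (\<lambda>x y. \<Sum>z\<in>X. C x z * N z y) = det_on X C * det_on X N"
proof -
  let ?P = "{p. p permutes X}" and ?F = "PiE X (\<lambda>_. X)"
  have "det_on X (\<lambda>x y. \<Sum>z\<in>X. C x z * N z y) =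
      (\<Sum>p\<in>?P. of_int (sign p) * (\<Sum>f\<in>?F. (\<Prod>x\<in>X. C x (f x) * N (f x) (p x))))"
    unfolding det_on_def using assms by (subst prod_sum_PiE) auto
  also have "\<dots> = (\<Sum>f\<in>?F. \<Sum>p\<in>?P. of_int (sign p) * (\<Prod>x\<in>X. C x (f x) * N (f x) (p x)))"
    unfolding sum_distrib_left by (rule sum.swap)
  also have "\<dots> = (\<Sum>f\<in>?F. (\<Prod>x\<in>X. C x (f x)) * det_on X (\<lambda>x y. N (f x) y))"
    unfolding det_on_def sum_distrib_left prod.distrib by (simp add: mult_ac)
  also have "\<dots> = (\<Sum>f\<in>{f\<in>?F. inj_on f X}. (\<Prod>x\<in>X. C x (f x)) * det_on X (\<lambda>x y. N (f x) y))"
  proof (rule sum.mono_neutral_right)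
    show "\<forall>f\<in>?F - {f \<in> ?F. inj_on f X}. (\<Prod>x\<in>X. C x (f x)) * det_on X (\<lambda>x y. N (f x) y) = 0"
    proof
      fix f assume "f \<in> ?F - {f \<in> ?F. inj_on f X}"
      then obtain i j where "i \<in> X" "j \<in> X" "i \<noteq> j" "f i = f j" by (auto simp: inj_on_def)
      then have "det_on X (\<lambda>x y. N (f x) y) = 0"
        using assms by (intro det_on_identical_rows[of X i j]) auto
      then show "(\<Prod>x\<in>X. C x (f x)) * det_on X (\<lambda>x y. N (f x) y) = 0" by simp
    qed
  qed (use assms in \<open>auto intro: finite_PiE\<close>)
  also have "\<dots> = (\<Sum>q\<in>?P. (\<Prod>x\<in>X. C x (q x)) * det_on X (\<lambda>x y. N (q x) y))"
  \<comment> \<open>Elements of \<open>?F\<close> are \<open>undefined\<close> outside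
    \<open>X\<close>, permutations are the identity there; the two maps convert between these
    conventions.\<close>
  proof (rule sum.reindex_bij_witness[where i = "\<lambda>q. restrict q X" and j = "\<lambda>f x. if x \<in> X then f x else x"])
    fix f assume f: "f \<in> {f \<in> ?F. inj_on f X}"
    then show "restrict (\<lambda>x. if x \<in> X then f x else x) X = f"
      by (auto simp: fun_eq_iff PiE_def extensional_def)
    have "f ` X \<subseteq> X" using f by auto
    then have "bij_betw f X X" using f assms by (auto simp: bij_betw_def endo_inj_surj)
    then have "bij_betw (\<lambda>x. if x \<in> X then f x else x) X X" by (simp cong: bij_betw_cong)
    then show "(\<lambda>x. if x \<in> X then f x else x) \<in> ?P" by (auto intro: bij_imp_permutes)
    show "(\<Prod>x\<in>X. C x (if x \<in> X then f x else x)) * det_on X (\<lambda>x. N (if x \<in> X then f x else x)) =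
      (\<Prod>x\<in>X. C x (f x)) * det_on X (\<lambda>x. N (f x))"
      by (intro arg_cong2[where f="(*)"] prod.cong det_on_cong) auto
  next
    fix q assume "q \<in> ?P"
    then have q: "q permutes X" by simp
    then show "(\<lambda>x. if x \<in> X then restrict q X x else x) = q"
      by (auto simp: fun_eq_iff permutes_not_in)
    show "restrict q X \<in> {f \<in> ?F. inj_on f X}"
      using permutes_in_image[OF q] permutes_inj_on[OF q] by (auto simp: inj_on_def)
  qed
  also have "\<dots> = (\<Sum>q\<in>?P. (of_int (sign q) * (\<Prod>x\<in>X. C x (q x))) * det_on X N)"
    using assms by (intro sum.cong refl) (simp add: det_on_permute_rows)
  finally show ?thesis by (simp add: det_on_def sum_distrib_right)
qed

section \<open>Sums of principal minors and diagonal perturbations \<open>M + P_S\<close>, with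
  \<open>P_S\<close> the coordinate projection onto \<open>S\<close>\<close>

definition add_diag :: "('a \<Rightarrow> 'a \<Rightarrow> complex) \<Rightarrow> 'a set \<Rightarrow> 'a \<Rightarrow> 'a \<Rightarrow> complex" where
  "add_diag M S x y = M x y + (if x = y \<and> x \<in> S then 1 else 0)"

lemma add_diag_empty [simp]: "add_diag M {} = M"
  by (simp add: add_diag_def fun_eq_iff)

lemma sum_Pow_insert:
  assumes "finite S" "x \<notin> S"
  shows "(\<Sum>J\<in>Pow (insert x S). f J) = (\<Sum>J\<in>Pow S. f J) + (\<Sum>J\<in>Pow S. f (insert x J))"
proof -
  have "inj_on (insert x) (Pow S)" using assms(2) by (force simp: inj_on_def)
  moreover have "Pow S \<inter> insert x ` Pow S = {}" using assms(2) by auto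
  ultimately show ?thesis
    using assms(1) by (simp add: Pow_insert sum.union_disjoint sum.reindex)
qed

text \<open>Multilinear expansion of \<open>det (M + P_S)\<close>: in the row of \<open>s\<close>,
  the summand from \<open>P_S\<close> deletes the index \<open>s\<close> and the other one keeps it.
  A kept index joins the fixed part, hence \<open>T\<close> is arbitrary in the induction. This
  turns partition sums into single determinants.\<close>

lemma sum_det_on_Pow:
  assumes "finite S" "finite T" "T \<inter> S = {}"
  shows "(\<Sum>J\<in>Pow S. det_on (T \<union> J) M) = det_on (T \<union> S) (add_diag M S)"
  using assms
proof (induction S arbitrary: T rule: finite_induct)
  case empty
  then show ?case by simp
next
  case (insert s S)
  let ?D = "insert s (T \<union> S)" and ?N = "add_diag M S"
  have fin: "finite (T \<union> S)" and s: "s \<notin> T \<union> S" using insert by auto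
  have "det_on (T \<union> insert s S) (add_diag M (insert s S)) =
    det_on ?D (\<lambda>z y. if z = s then ?N s y + (if s = y then 1 else 0) else ?N z y)"
    using s by (simp, intro det_on_cong) (auto simp: add_diag_def)
  also have "\<dots> = det_on ?D (\<lambda>z y. if z = s then ?N s y else ?N z y) +
      det_on ?D (\<lambda>z y. if z = s then (if s = y then 1 else 0) else ?N z y)"
    using fin by (intro det_on_row_add) auto
  also have "det_on ?D (\<lambda>z y. if z = s then ?N s y else ?N z y) = det_on ?D ?N"
    by (intro det_on_cong) auto
  also have "det_on ?D (\<lambda>z y. if z = s then (if s = y then 1 else 0) else ?N z y) =
      det_on (T \<union> S) (\<lambda>z y. if z = s then (if s = y then 1 else 0) else ?N z y)"
    using s by (subst det_on_row_expand[OF fin s]) auto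
  also have "\<dots> = det_on (T \<union> S) ?N" using s by (intro det_on_cong) auto
  also have "det_on (T \<union> S) ?N = (\<Sum>J\<in>Pow S. det_on (T \<union> J) M)"
    using insert by simp
  also have "det_on ?D ?N = (\<Sum>J\<in>Pow S. det_on (insert s T \<union> J) M)"
    using insert.IH[of "insert s T"] insert.prems insert.hyps by (simp add: insert_absorb)
  finally show ?case using insert.hyps by (simp add: sum_Pow_insert)
qed

text \<open>For \<open>N = L + I\<close> and \<open>G = N\<^sup>-\<^sup>1\<close> the left-hand side, divided by \<open>det N\<close>, is a correlation
  function of the L-ensemble of \<open>L\<close>, so that \<open>I - G\<close> is its correlation kernel.\<close>

lemma det_on_minus_diag:
  assumes D: "finite D" "X \<subseteq> D"
    and inv: "\<And>y z. y \<in> D \<Longrightarrow> z \<in> X \<Longrightarrow> (\<Sum>w\<in>D. N y w * G w z) = (if y = z then 1 else 0)"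
  shows "det_on D (\<lambda>y z. N y z - (if y = z \<and> y \<in> X then 1 else 0)) =
    det_on D N * det_on X (\<lambda>y z. (if y = z then 1 else 0) - G y z)"
proof -
  let ?C = "\<lambda>w z. (if w = z then 1 else 0) - (if z \<in> X then G w z else 0)"
  have "det_on D (\<lambda>y z. N y z - (if y = z \<and> y \<in> X then 1 else 0)) = det_on D (\<lambda>y z. \<Sum>w\<in>D. N y w * ?C w z)"
  proof (rule det_on_cong)
    fix y z assume yz: "y \<in> D" "z \<in> D"
    have "(\<Sum>w\<in>D. N y w * ?C w z) =
        (\<Sum>w\<in>D. if w = z then N y w else 0) - (\<Sum>w\<in>D. if z \<in> X then N y w * G w z else 0)"
      unfolding sum_subtractf[symmetric] by (intro sum.cong) (auto simp: algebra_simps)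
    also have "(\<Sum>w\<in>D. if w = z then N y w else 0) = N y z" using D yz by simp
    also have "(\<Sum>w\<in>D. if z \<in> X then N y w * G w z else 0) = (if y = z \<and> y \<in> X then 1 else 0)"
      using inv[OF yz(1)] by (cases "z \<in> X") auto
    finally show "N y z - (if y = z \<and> y \<in> X then 1 else 0) = (\<Sum>w\<in>D. N y w * ?C w z)" ..
  qed
  also have "\<dots> = det_on D N * det_on D ?C" by (rule det_on_mult[OF D(1)])
  also have "det_on D ?C = det_on X (\<lambda>y z. (if y = z then 1 else 0) - G y z)"
  proof -
    \<comment> \<open>Columns of \<open>?C\<close> outside \<open>X\<close> are unit vectors, so the
      indices of \<open>D - X\<close> can be expanded away one at a time.\<close>
    have "det_on (X \<union> R) ?C = det_on X ?C" if "finite R" "R \<inter> X = {}" for R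
      using that
    proof (induction R rule: finite_induct)
      case (insert x R)
      then show ?case
        using D finite_subset by (simp, subst det_on_column_expand) auto
    qed simp
    from this[of "D - X"] have "det_on D ?C = det_on X ?C"
      using D by (simp add: Un_absorb1 Int_commute)
    also have "\<dots> = det_on X (\<lambda>y z. (if y = z then 1 else 0) - G y z)"
      by (rule det_on_cong) auto
    finally show ?thesis .
  qed
  finally show ?thesis .
qed

lemma tendsto_det_on:
  assumes "\<And>x y. x \<in> X \<Longrightarrow> y \<in> X \<Longrightarrow> ((\<lambda>n. M n x y) \<longlongrightarrow> L x y) F"
  shows "((\<lambda>n. det_on X (M n)) \<longlongrightarrow> det_on X L) F"
  unfolding det_on_def
  by (intro tendsto_sum tendsto_mult tendsto_const tendsto_prod assms)
     (auto simp: permutes_in_image)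

section \<open>Positive definite forms and Schur complements\<close>

definition matrix_form :: "('a \<Rightarrow> 'a \<Rightarrow> complex) \<Rightarrow> 'a set \<Rightarrow> ('a \<Rightarrow> complex) \<Rightarrow> complex" where
  "matrix_form M F c = (\<Sum>x\<in>F. cnj (c x) * (\<Sum>y\<in>F. M x y * c y))"

definition pos_def_on :: "'a set \<Rightarrow> ('a \<Rightarrow> 'a \<Rightarrow> complex) \<Rightarrow> bool" where
  "pos_def_on F M \<longleftrightarrow> (\<forall>x\<in>F. \<forall>y\<in>F. M y x = cnj (M x y)) \<and>
     (\<forall>c. (\<exists>x\<in>F. c x \<noteq> 0) \<longrightarrow> 0 < Re (matrix_form M F c))"

lemma matrix_form_mono_neutral:
  assumes "finite G" "F \<subseteq> G" "\<And>x. x \<in> G - F \<Longrightarrow> c x = 0"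
  shows "matrix_form M G c = matrix_form M F c"
proof -
  have "(\<Sum>y\<in>G. M x y * c y) = (\<Sum>y\<in>F. M x y * c y)" for x
    using assms by (intro sum.mono_neutral_right) auto
  then show ?thesis unfolding matrix_form_def
    using assms by (simp, intro sum.mono_neutral_right) auto
qed

lemma matrix_form_cong:
  assumes "\<And>x. x \<in> F \<Longrightarrow> c x = d x"
  shows "matrix_form M F c = matrix_form M F d"
  unfolding matrix_form_def using assms by (simp cong: sum.cong)

lemma pos_def_on_subset:
  assumes "pos_def_on G M" "F \<subseteq> G" "finite G"
  shows "pos_def_on F M"
  unfolding pos_def_on_def
proof (intro conjI ballI allI impI)
  fix c assume c: "\<exists>x\<in>F. c x \<noteq> (0::complex)"
  let ?d = "\<lambda>x. if x \<in> F then c x else 0"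
  have "0 < Re (matrix_form M G ?d)"
    using assms c unfolding pos_def_on_def by (metis (mono_tags, lifting) subsetD)
  also have "matrix_form M G ?d = matrix_form M F ?d"
    using assms by (intro matrix_form_mono_neutral) auto
  also have "\<dots> = matrix_form M F c" by (rule matrix_form_cong) auto
  finally show "0 < Re (matrix_form M F c)" .
qed (use assms(1,2) in \<open>unfold pos_def_on_def, blast\<close>)

lemma matrix_form_kernel:
  assumes "finite F" "x \<in> F" "\<And>y. y \<in> F - {x} \<Longrightarrow> (\<Sum>z\<in>F. M y z * w z) = 0"
  shows "matrix_form M F w = cnj (w x) * (\<Sum>z\<in>F. M x z * w z)"
  unfolding matrix_form_def using assms by (subst sum.remove[of F x]) auto

text \<open>Bordering: a solution on \<open>F\<close> is extended by zero at \<open>x\<close> and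
  corrected by a multiple of a vector \<open>w\<close> with \<open>w x = 1\<close> whose image under
  \<open>M\<close> vanishes on \<open>F\<close>, which leaves the equations on \<open>F\<close>
  intact.\<close>

lemma pos_def_on_solve:
  assumes "finite F" "pos_def_on F M"
  shows "\<exists>v. \<forall>y\<in>F. (\<Sum>z\<in>F. M y z * v z) = b y"
  using assms
proof (induction F arbitrary: b rule: finite_induct)
  case (insert x F)
  have pF: "pos_def_on F M" using insert by (auto intro: pos_def_on_subset)
  obtain v where v: "\<And>y. y \<in> F \<Longrightarrow> (\<Sum>z\<in>F. M y z * v z) = b y"
    using insert.IH[OF pF, of b] by blast
  obtain u where u: "\<And>y. y \<in> F \<Longrightarrow> (\<Sum>z\<in>F. M y z * u z) = - M y x"
    using insert.IH[OF pF, of "\<lambda>y. - M y x"] by blast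
  define w where "w = (\<lambda>z. if z = x then 1 else u z)"
  define v' where "v' = (\<lambda>z. if z = x then 0 else v z)"
  have sw: "(\<Sum>z\<in>insert x F. M y z * w z) = M y x + (\<Sum>z\<in>F. M y z * u z)" for y
    using insert.hyps by (auto simp: w_def intro!: sum.cong)
  have sv: "(\<Sum>z\<in>insert x F. M y z * v' z) = (\<Sum>z\<in>F. M y z * v z)" for y
    using insert.hyps by (auto simp: v'_def intro!: sum.cong)
  have w0: "(\<Sum>z\<in>insert x F. M y z * w z) = 0" if "y \<in> F" for y using that u sw by simp
  \<comment> \<open>\<open>q\<close> is the Schur complement at the index \<open>x\<close>;
    positivity of the form at \<open>w\<close> keeps it from vanishing.\<close>
  define q where "q = (\<Sum>z\<in>insert x F. M x z * w z)"
  have "matrix_form M (insert x F) w = q"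
    using matrix_form_kernel[of "insert x F" x M w] insert.hyps w0 by (simp add: q_def w_def)
  moreover have "0 < Re (matrix_form M (insert x F) w)"
    using insert.prems by (auto simp: pos_def_on_def w_def)
  ultimately have q: "q \<noteq> 0" by auto
  define t where "t = (b x - (\<Sum>z\<in>F. M x z * v z)) / q"
  have lin: "(\<Sum>z\<in>insert x F. M y z * (v' z + t * w z)) =
      (\<Sum>z\<in>insert x F. M y z * v' z) + t * (\<Sum>z\<in>insert x F. M y z * w z)" for y
    by (simp only: distrib_left sum.distrib sum_distrib_left mult.left_commute)
  show ?case
  proof (intro exI ballI)
    fix y assume "y \<in> insert x F"
    then show "(\<Sum>z\<in>insert x F. M y z * (v' z + t * w z)) = b y"
      unfolding lin using q v w0
      by (cases "y = x") (auto simp add: sv q_def[symmetric] t_def)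
  qed
qed simp

text \<open>The quotient of the two determinants is a Schur complement, which is also the minimum of
  the form over vectors with value 1 at \<open>x\<close>. The minimiser \<open>w\<close> is what
  remains of the basis vector at \<open>x\<close> after projecting off those of
  \<open>X\<close>.\<close>

lemma det_on_insert_pos_def:
  assumes "finite X" "x \<notin> X" "pos_def_on (insert x X) M"
  obtains w where "w x = 1" "\<And>y. y \<in> X \<Longrightarrow> (\<Sum>z\<in>insert x X. M y z * w z) = 0"
    "det_on (insert x X) M = matrix_form M (insert x X) w * det_on X M"
    "\<And>c. c x = 1 \<Longrightarrow> Re (matrix_form M (insert x X) w) \<le> Re (matrix_form M (insert x X) c)"
    "Im (matrix_form M (insert x X) w) = 0" "0 < Re (matrix_form M (insert x X) w)"
proof -
  let ?D = "insert x X"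
  have pX: "pos_def_on X M" using assms by (auto intro: pos_def_on_subset)
  obtain u where u: "\<And>y. y \<in> X \<Longrightarrow> (\<Sum>z\<in>X. M y z * u z) = - M y x"
    using pos_def_on_solve[OF assms(1) pX, of "\<lambda>y. - M y x"] by blast
  define w where "w = (\<lambda>z. if z = x then 1 else u z)"
  have w1: "w x = 1" by (simp add: w_def)
  have sw: "(\<Sum>z\<in>?D. M y z * w z) = M y x + (\<Sum>z\<in>X. M y z * u z)" for y
    using assms by (auto simp: w_def intro!: sum.cong)
  have w0: "(\<Sum>z\<in>?D. M y z * w z) = 0" if "y \<in> X" for y using that u sw by simp
  have form: "matrix_form M ?D w = (\<Sum>z\<in>?D. M x z * w z)"
    using matrix_form_kernel[of ?D x M w] assms w0 by (simp add: w_def)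
  \<comment> \<open>Right multiplication by \<open>?C\<close>, whose determinant is 1, replaces
    column \<open>x\<close> of \<open>M\<close> by \<open>M w\<close>, which is zero on
    \<open>X\<close>.\<close>
  let ?C = "\<lambda>z y. if y = x then w z else if z = y then 1 else 0"
  let ?N = "\<lambda>z y. if y = x then (\<Sum>a\<in>?D. M z a * w a) else M z y"
  have "det_on ?D ?N = det_on ?D (\<lambda>z y. \<Sum>a\<in>?D. M z a * ?C a y)"
  proof (rule det_on_cong)
    fix z y assume "z \<in> ?D" "y \<in> ?D"
    then show "?N z y = (\<Sum>a\<in>?D. M z a * ?C a y)"
      using assms(1) by (cases "y = x") (simp_all add: if_distrib[of "\<lambda>t. M z _ * t"] cong: if_cong)
  qed
  also have "\<dots> = det_on ?D M * det_on ?D ?C" using assms by (intro det_on_mult) auto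
  also have "det_on ?D ?C = 1"
  proof -
    have one: "det_on Y (\<lambda>z y. if z = y then 1 else 0) = 1" if "finite Y" for Y :: "'a set"
      using that
    proof induction
      case (insert y Y)
      then have "det_on (insert y Y) (\<lambda>z y. if z = y then 1 else 0) =
          1 * det_on Y (\<lambda>z y. if z = y then 1 else 0)"
        by (subst det_on_row_expand) auto
      with insert show ?case by simp
    qed (simp add: det_on_empty)
    have "det_on ?D ?C = det_on X ?C"
      using assms w1 by (subst det_on_row_expand) auto
    also have "\<dots> = det_on X (\<lambda>z y. if z = y then 1 else 0)"
      using assms by (intro det_on_cong) auto
    finally show ?thesis using one assms by simp
  qed
  finally have "det_on ?D M = det_on ?D ?N" by simp
  also have "\<dots> = matrix_form M ?D w * det_on X ?N"
    unfolding form using assms w0 by (subst det_on_column_expand) auto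
  also have "det_on X ?N = det_on X M" using assms by (intro det_on_cong) auto
  finally have det: "det_on ?D M = matrix_form M ?D w * det_on X M" .
  have herm: "M b a = cnj (M a b)" if "a \<in> ?D" "b \<in> ?D" for a b
    using assms(3) that unfolding pos_def_on_def by blast
  have cross: "(\<Sum>a\<in>?D. cnj (c a) * (\<Sum>b\<in>?D. M a b * w b)) = matrix_form M ?D w" if "c x = 1" for c
    unfolding form using assms w0 that by simp
  have conj_form: "cnj (\<Sum>a\<in>?D. cnj (c a) * (\<Sum>b\<in>?D. M a b * d b))
      = (\<Sum>a\<in>?D. cnj (d a) * (\<Sum>b\<in>?D. M a b * c b))" for c d
  proof -
    have "cnj (\<Sum>a\<in>?D. cnj (c a) * (\<Sum>b\<in>?D. M a b * d b)) =
       (\<Sum>a\<in>?D. \<Sum>b\<in>?D. cnj (d b) * (M b a * c a))"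
      by (simp only: cnj_sum complex_cnj_mult complex_cnj_cnj sum_distrib_left)
         (intro sum.cong refl, simp add: herm[symmetric] mult_ac)
    also have "\<dots> = (\<Sum>a\<in>?D. cnj (d a) * (\<Sum>b\<in>?D. M a b * c b))"
      by (subst sum.swap) (simp add: sum_distrib_left)
    finally show ?thesis .
  qed
  have im: "Im (matrix_form M ?D w) = 0"
    using arg_cong[OF conj_form[of w w], of Im] unfolding matrix_form_def[symmetric] by simp
  have nonneg: "0 \<le> Re (matrix_form M ?D c)" for c
  proof (cases "\<exists>a\<in>?D. c a \<noteq> 0")
    case True
    then show ?thesis using assms(3) unfolding pos_def_on_def by (meson less_imp_le)
  next
    case False
    then have "matrix_form M ?D c = 0" unfolding matrix_form_def by (intro sum.neutral) simp
    then show ?thesis by simp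
  qed
  \<comment> \<open>Pythagoras: \<open>c - w\<close> vanishes at \<open>x\<close>, hence is
    orthogonal to \<open>w\<close>, and the form of \<open>c\<close> exceeds that of
    \<open>w\<close> by the form of \<open>c - w\<close>.\<close>
  have min: "Re (matrix_form M ?D w) \<le> Re (matrix_form M ?D c)" if c: "c x = 1" for c
  proof -
    let ?d = "\<lambda>a. c a - w a"
    have "matrix_form M ?D ?d = matrix_form M ?D c
        - (\<Sum>a\<in>?D. cnj (c a) * (\<Sum>b\<in>?D. M a b * w b))
        - (\<Sum>a\<in>?D. cnj (w a) * (\<Sum>b\<in>?D. M a b * c b)) + matrix_form M ?D w"
      unfolding matrix_form_def
      by (simp only: right_diff_distrib complex_cnj_diff left_diff_distrib sum_subtractf) simp
    then have "matrix_form M ?D ?d = matrix_form M ?D c - cnj (matrix_form M ?D w)"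
      using cross[of c, OF c] conj_form[of c w] by simp
    with nonneg[of ?d] show ?thesis by simp
  qed
  have "0 < Re (matrix_form M ?D w)"
    using assms(3) w1 by (auto simp: pos_def_on_def)
  with w1 w0 det min im show ?thesis by (intro that[of w])
qed

lemma pos_def_on_det:
  assumes "finite X" "pos_def_on X M"
  shows "Im (det_on X M) = 0 \<and> 0 < Re (det_on X M)"
  using assms
proof (induction X rule: finite_induct)
  case (insert x X)
  then have "pos_def_on X M" by (auto intro: pos_def_on_subset)
  with insert have IH: "Im (det_on X M) = 0 \<and> 0 < Re (det_on X M)" by simp
  obtain w where "det_on (insert x X) M = matrix_form M (insert x X) w * det_on X M"
    "Im (matrix_form M (insert x X) w) = 0" "0 < Re (matrix_form M (insert x X) w)"
    using det_on_insert_pos_def insert by metis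
  with IH show ?case by simp
qed (simp add: det_on_empty)

section \<open>Hilbert spaces of functions\<close>

locale function_hilbert_space =
  fixes E :: "'a set" and H :: "('a \<Rightarrow> complex) set"
    and ip :: "('a \<Rightarrow> complex) \<Rightarrow> ('a \<Rightarrow> complex) \<Rightarrow> complex"
  assumes ip: "inner_product_on H ip"
    and complete: "Metric_space.mcomplete H (ip_dist H ip)"
    and eval_continuous: "\<And>y. y \<in> E \<Longrightarrow>
      continuous_map (Metric_space.mtopology H (ip_dist H ip)) euclidean (\<lambda>f. f y)"
    and unit_mem: "\<And>x. x \<in> E \<Longrightarrow> unit_fun x \<in> H"
begin

sublocale M: Metric_space H "ip_dist H ip"
  by (rule Metric_space_ip_dist[OF ip])

definition nsq :: "('a \<Rightarrow> complex) \<Rightarrow> real" where "nsq u = Re (ip u u)"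

lemma zero_mem: "(\<lambda>_. 0) \<in> H"
  and add_mem: "\<And>f g. f \<in> H \<Longrightarrow> g \<in> H \<Longrightarrow> (\<lambda>x. f x + g x) \<in> H"
  and scale_mem: "\<And>c f. f \<in> H \<Longrightarrow> (\<lambda>x. c * f x) \<in> H"
  and ip_add: "\<And>f g h. f \<in> H \<Longrightarrow> g \<in> H \<Longrightarrow> h \<in> H \<Longrightarrow> ip f (\<lambda>x. g x + h x) = ip f g + ip f h"
  and ip_scale: "\<And>c f g. f \<in> H \<Longrightarrow> g \<in> H \<Longrightarrow> ip f (\<lambda>x. c * g x) = c * ip f g"
  and ip_cnj: "\<And>f g. f \<in> H \<Longrightarrow> g \<in> H \<Longrightarrow> ip g f = cnj (ip f g)"
  and ip_nonneg: "\<And>f. f \<in> H \<Longrightarrow> 0 \<le> Re (ip f f)"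
  and ip_zero: "\<And>f. f \<in> H \<Longrightarrow> ip f f = 0 \<Longrightarrow> f = (\<lambda>_. 0)"
  using ip unfolding inner_product_on_def by blast+

lemma diff_mem: "f \<in> H \<Longrightarrow> g \<in> H \<Longrightarrow> (\<lambda>x. f x - g x) \<in> H"
  using add_mem[OF _ scale_mem[of g "-1"], of f] by simp

lemma ip_add_left: "f \<in> H \<Longrightarrow> g \<in> H \<Longrightarrow> h \<in> H \<Longrightarrow> ip (\<lambda>x. g x + h x) f = ip g f + ip h f"
  using ip_add[of f g h] ip_cnj add_mem by (metis complex_cnj_add)

lemma ip_scale_left: "f \<in> H \<Longrightarrow> g \<in> H \<Longrightarrow> ip (\<lambda>x. c * g x) f = cnj c * ip g f"
  using ip_scale[of f g c] ip_cnj scale_mem by (metis complex_cnj_mult)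

lemma ip_diff: "f \<in> H \<Longrightarrow> g \<in> H \<Longrightarrow> h \<in> H \<Longrightarrow> ip f (\<lambda>x. g x - h x) = ip f g - ip f h"
  using ip_add[OF _ _ scale_mem[of h "-1"], of f g] ip_scale[of f h "-1"] by simp

lemma ip_diff_left: "f \<in> H \<Longrightarrow> g \<in> H \<Longrightarrow> h \<in> H \<Longrightarrow> ip (\<lambda>x. g x - h x) f = ip g f - ip h f"
  using ip_add_left[OF _ _ scale_mem[of h "-1"], of f g] ip_scale_left[of f h "-1"] by simp

lemma ip_zero_right: "f \<in> H \<Longrightarrow> ip f (\<lambda>_. 0) = 0"
  using ip_scale[of f f 0] by simp

lemma ip_self: "f \<in> H \<Longrightarrow> ip f f = of_real (nsq f)"
  using ip_cnj[of f f] by (simp add: nsq_def complex_eq_iff)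

lemma nsq_nonneg: "f \<in> H \<Longrightarrow> 0 \<le> nsq f"
  using ip_nonneg by (simp add: nsq_def)

lemma nsq_pos: "f \<in> H \<Longrightarrow> f z \<noteq> 0 \<Longrightarrow> 0 < nsq f"
  using ip_zero[of f] ip_self[of f] nsq_nonneg[of f] by (cases "nsq f = 0") auto

lemma nsq_diff:
  assumes "f \<in> H" "g \<in> H"
  shows "nsq (\<lambda>x. f x - g x) = nsq f + nsq g - 2 * Re (ip f g)"
  using assms ip_cnj[OF assms] by (simp add: nsq_def ip_diff ip_diff_left diff_mem)

lemma nsq_add:
  assumes "f \<in> H" "g \<in> H"
  shows "nsq (\<lambda>x. f x + g x) = nsq f + nsq g + 2 * Re (ip f g)"
  using assms ip_cnj[OF assms] by (simp add: nsq_def ip_add ip_add_left add_mem)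

lemma nsq_scale: "f \<in> H \<Longrightarrow> nsq (\<lambda>x. c * f x) = (cmod c)\<^sup>2 * nsq f"
  using ip_self[of f]
  by (simp add: nsq_def ip_scale ip_scale_left scale_mem mult.assoc[symmetric] complex_norm_square[symmetric])

text \<open>The parallelogram law, arranged for comparing a midpoint with an infimum over a convex
  set.\<close>

lemma nsq_midpoint:
  assumes "f \<in> H" "g \<in> H"
  shows "4 * nsq (\<lambda>x. (1/2) * (f x + g x)) = 2 * nsq f + 2 * nsq g - nsq (\<lambda>x. f x - g x)"
  using nsq_scale[OF add_mem[OF assms], of "1/2"] nsq_diff[OF assms] nsq_add[OF assms]
  by (simp add: power2_eq_square)

lemma ip_dist_nsq: "f \<in> H \<Longrightarrow> g \<in> H \<Longrightarrow> ip_dist H ip f g = sqrt (nsq (\<lambda>x. f x - g x))"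
  by (simp add: ip_dist_def nsq_def)

lemma Cauchy_Schwarz:
  assumes "f \<in> H" "g \<in> H"
  shows "(cmod (ip f g))\<^sup>2 \<le> nsq f * nsq g"
proof (cases "nsq f = 0")
  case True
  then have "f = (\<lambda>_. 0)" using ip_self ip_zero assms by simp
  then have "ip f g = 0" using ip_zero_right[OF assms(2)] ip_cnj assms by (metis complex_cnj_zero)
  then show ?thesis using True by simp
next
  case False
  then have pos: "0 < nsq f" using nsq_nonneg[OF assms(1)] by simp
  define a where "a = ip f g"
  \<comment> \<open>\<open>t * f\<close> is the orthogonal projection of \<open>g\<close> onto
    \<open>f\<close>; the inequality is nonnegativity of the squared norm of the residual.\<close>
  define t where "t = a / of_real (nsq f)"
  have tf: "(\<lambda>x. t * f x) \<in> H" using scale_mem assms by blast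
  have "ip g f = cnj a" using ip_cnj[OF assms] a_def by simp
  then have "ip g (\<lambda>x. t * f x) = of_real ((cmod a)\<^sup>2 / nsq f)"
    using ip_scale[OF assms(2,1), of t]
    by (simp add: t_def complex_norm_square[symmetric] del: of_real_power)
  then have "Re (ip g (\<lambda>x. t * f x)) = (cmod a)\<^sup>2 / nsq f" by simp
  moreover have "nsq (\<lambda>x. t * f x) = (cmod a)\<^sup>2 / nsq f"
    unfolding nsq_scale[OF assms(1)]
    using pos by (simp add: t_def norm_divide power2_eq_square)
  ultimately have "nsq (\<lambda>x. g x - t * f x) = nsq g - (cmod a)\<^sup>2 / nsq f"
    using nsq_diff[OF assms(2) tf] by simp
  with nsq_nonneg[OF diff_mem[OF assms(2) tf]] pos show ?thesis
    by (simp add: a_def field_simps)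
qed

section \<open>Limits in the norm of \<open>H\<close>\<close>

abbreviation converges :: "(nat \<Rightarrow> 'a \<Rightarrow> complex) \<Rightarrow> ('a \<Rightarrow> complex) \<Rightarrow> bool" where
  "converges f u \<equiv> limitin M.mtopology f u sequentially"

lemma converges_eval: "converges f u \<Longrightarrow> y \<in> E \<Longrightarrow> (\<lambda>n. f n y) \<longlonglongrightarrow> u y"
  using continuous_map_limit[OF eval_continuous, of y f u sequentially]
  by (simp add: o_def)

lemma converges_mem: "converges f u \<Longrightarrow> u \<in> H"
  by (simp add: M.limit_metric_sequentially)

lemma converges_ip:
  assumes "converges f u" "\<And>n. f n \<in> H" "v \<in> H"
  shows "(\<lambda>n. ip v (f n)) \<longlonglongrightarrow> ip v u"
proof -
  have u: "u \<in> H" using assms converges_mem by blast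
  have "(\<lambda>n. ip_dist H ip (f n) u) \<longlonglongrightarrow> 0"
    using assms(1) M.limitin_metric_dist_null by blast
  then have lim: "(\<lambda>n. sqrt (nsq v) * ip_dist H ip (f n) u) \<longlonglongrightarrow> 0"
    by (rule tendsto_mult_right_zero)
  have le: "norm (ip v (f n) - ip v u) \<le> sqrt (nsq v) * ip_dist H ip (f n) u" for n
  proof -
    have "(cmod (ip v (f n) - ip v u))\<^sup>2 \<le> nsq v * nsq (\<lambda>x. f n x - u x)"
      using Cauchy_Schwarz[OF assms(3) diff_mem[OF assms(2) u]] assms u by (simp add: ip_diff)
    then have "cmod (ip v (f n) - ip v u) \<le> sqrt (nsq v * nsq (\<lambda>x. f n x - u x))"
      by (rule real_le_rsqrt)
    then show ?thesis using assms u by (simp add: ip_dist_nsq real_sqrt_mult)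
  qed
  have "(\<lambda>n. ip v (f n) - ip v u) \<longlonglongrightarrow> 0"
    by (rule Lim_null_comparison[OF _ lim]) (use le in simp)
  then show ?thesis by (rule LIM_zero_cancel)
qed

text \<open>The sequence is tested against its own limit: Cauchy-Schwarz bounds
  \<open>(cmod (ip u (f n)))\<^sup>2\<close> by \<open>nsq u * R\<close>, and the left side tends to
  the square of \<open>nsq u\<close>.\<close>

lemma converges_nsq_le:
  assumes "converges f u" "\<And>n. f n \<in> H" "\<And>n. nsq (f n) \<le> R"
  shows "nsq u \<le> R"
proof (cases "nsq u = 0")
  case True
  then show ?thesis using nsq_nonneg[OF assms(2)] assms(3) by (metis order_trans)
next
  case False
  have u: "u \<in> H" using assms converges_mem by blast
  have pos: "0 < nsq u" using False nsq_nonneg[OF u] by simp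
  have "(\<lambda>n. (cmod (ip u (f n)))\<^sup>2) \<longlonglongrightarrow> (cmod (ip u u))\<^sup>2"
    using converges_ip[OF assms(1,2) u] by (intro tendsto_intros)
  moreover have "(cmod (ip u (f n)))\<^sup>2 \<le> nsq u * R" for n
    using Cauchy_Schwarz[OF u assms(2)[of n]] mult_left_mono[OF assms(3) nsq_nonneg[OF u]]
    by (rule order_trans)
  ultimately have "(cmod (ip u u))\<^sup>2 \<le> nsq u * R" by (intro LIMSEQ_le_const2) auto
  then show ?thesis using pos by (simp add: ip_self[OF u] power2_eq_square)
qed

text \<open>A substitute for weak compactness: by the parallelogram law, almost minimal elements of the
  sets form a Cauchy sequence.\<close>

lemma nested_convex_nonempty:
  fixes C :: "nat \<Rightarrow> ('a \<Rightarrow> complex) set"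
  assumes sub: "\<And>n. C n \<subseteq> H" and ne: "\<And>n. C n \<noteq> {}"
    and dec: "\<And>m n. m \<le> n \<Longrightarrow> C n \<subseteq> C m"
    and bdd: "\<And>n u. u \<in> C n \<Longrightarrow> nsq u \<le> R"
    and mid: "\<And>n u v. u \<in> C n \<Longrightarrow> v \<in> C n \<Longrightarrow> (\<lambda>x. (1/2) * (u x + v x)) \<in> C n"
    and closed: "\<And>n f u. (\<And>k. f k \<in> C n) \<Longrightarrow> converges f u \<Longrightarrow> u \<in> C n"
  shows "\<exists>u. \<forall>n. u \<in> C n"
proof -
  define d where "d n = Inf (nsq ` C n)" for n
  have bb: "bdd_below (nsq ` C n)" for n
    using sub nsq_nonneg by (intro bdd_belowI[of _ 0]) auto
  have d_le: "d n \<le> nsq u" if "u \<in> C n" for n u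
    unfolding d_def using bb that by (intro cInf_lower) auto
  have "mono d"
    unfolding d_def using dec ne bb by (intro monoI cInf_superset_mono) auto
  moreover have "d n \<le> R" for n
    using d_le bdd ne by (metis all_not_in_conv order_trans)
  ultimately obtain L where L: "d \<longlonglongrightarrow> L" "\<And>n. d n \<le> L"
    using incseq_convergent[of d R] unfolding mono_def incseq_def by blast
  define r where "r n = 1 / real (Suc n)" for n
  have r: "r \<longlonglongrightarrow> 0" "\<And>n. 0 < r n" "\<And>m n. m \<le> n \<Longrightarrow> r n \<le> r m"
    unfolding r_def using LIMSEQ_inverse_real_of_nat
    by (auto simp: inverse_eq_divide field_simps)
  have "\<exists>u\<in>C n. nsq u < d n + r n" for n
    using cInf_lessD[of "nsq ` C n" "d n + r n"] ne[of n] r(2)[of n] by (auto simp: d_def)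
  then obtain u where u: "\<And>n. u n \<in> C n" "\<And>n. nsq (u n) < d n + r n" by metis
  have uH: "u n \<in> H" for n using u sub by blast
  define b where "b n = 4 * (L - d n + r n)" for n
  have "b \<longlonglongrightarrow> 4 * (L - L + 0)"
    unfolding b_def by (intro tendsto_intros L r)
  then have b0: "b \<longlonglongrightarrow> 0" by simp
  \<comment> \<open>The midpoint of \<open>u n\<close> and \<open>u m\<close> lies in
    \<open>C n\<close>, so its squared norm is at least \<open>d n\<close>. The parallelogram law
    then bounds the distance by the gap between \<open>d n\<close> and \<open>L\<close> plus the
    slack \<open>r n\<close>.\<close>
  have close: "nsq (\<lambda>x. u n x - u m x) \<le> b n" if "n \<le> m" for n m
  proof -
    have "u m \<in> C n" using u dec that by blast
    then have "d n \<le> nsq (\<lambda>x. (1/2) * (u n x + u m x))" using u mid d_le by blast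
    then have "nsq (\<lambda>x. u n x - u m x) \<le> 2 * nsq (u n) + 2 * nsq (u m) - 4 * d n"
      using nsq_midpoint[OF uH uH, of n m] by linarith
    also have "\<dots> \<le> 2 * (d n + r n) + 2 * (d m + r m) - 4 * d n"
      by (intro diff_mono add_mono mult_left_mono less_imp_le[OF u(2)]) auto
    also have "\<dots> \<le> b n"
      using L(2)[of m] L(2)[of n] r(3)[OF that]
      unfolding b_def by (simp add: algebra_simps)
    finally show ?thesis .
  qed
  have "M.MCauchy u"
    unfolding M.MCauchy_def
  proof (intro conjI allI impI)
    show "range u \<subseteq> H" using uH by auto
    fix e :: real assume "e > 0"
    then have "eventually (\<lambda>n. b n < e\<^sup>2) sequentially"
      using order_tendstoD(2)[OF b0, of "e\<^sup>2"] by simp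
    then obtain N where N: "\<And>n. n \<ge> N \<Longrightarrow> b n < e\<^sup>2" by (auto simp: eventually_sequentially)
    have *: "ip_dist H ip (u n) (u m) < e" if "N \<le> n" "n \<le> m" for n m
      using close[OF that(2)] N[OF that(1)] \<open>e > 0\<close> uH
      by (simp add: ip_dist_nsq) (metis order_le_less_trans abs_of_pos real_sqrt_abs real_sqrt_less_iff)
    then show "\<exists>N. \<forall>n n'. N \<le> n \<longrightarrow> N \<le> n' \<longrightarrow> ip_dist H ip (u n) (u n') < e"
      by (metis M.commute nle_le)
  qed
  then obtain w where w: "converges u w" using complete M.mcomplete_def by blast
  have "w \<in> C n" for n
  proof (rule closed[of "\<lambda>k. u (k + n)"])
    show "u (k + n) \<in> C n" for k using u dec[of n "k + n"] by auto
    show "converges (\<lambda>k. u (k + n)) w"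
      using w by (metis limitin_sequentially_offset)
  qed
  then show ?thesis by blast
qed

subsection \<open>Finite linear combinations\<close>

text \<open>The linear combination of the \<open>unit_fun z\<close> for \<open>z\<close> in
  \<open>F\<close> with coefficients \<open>c z\<close>, written pointwise so that coefficients are
  values.\<close>

definition comb :: "'a set \<Rightarrow> ('a \<Rightarrow> complex) \<Rightarrow> 'a \<Rightarrow> complex" where
  "comb F c = (\<lambda>z. if z \<in> F then c z else 0)"

definition kern :: "'a \<Rightarrow> 'a \<Rightarrow> complex" where
  "kern x y = ip (unit_fun x) (unit_fun y)"

lemma comb_insert: "x \<notin> F \<Longrightarrow> comb (insert x F) c = (\<lambda>z. comb F c z + c x * unit_fun x z)"
  by (auto simp: comb_def unit_fun_def fun_eq_iff)

lemma comb_mem: "finite F \<Longrightarrow> F \<subseteq> E \<Longrightarrow> comb F c \<in> H"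
proof (induction F rule: finite_induct)
  case empty
  then show ?case using zero_mem by (simp add: comb_def)
qed (simp add: comb_insert add_mem scale_mem unit_mem)

lemma ip_comb: "finite F \<Longrightarrow> F \<subseteq> E \<Longrightarrow> u \<in> H \<Longrightarrow> ip u (comb F c) = (\<Sum>z\<in>F. ip u (unit_fun z) * c z)"
proof (induction F rule: finite_induct)
  case empty
  then show ?case using ip_zero_right by (simp add: comb_def)
next
  case (insert x F)
  then show ?case
    by (simp add: comb_insert ip_add ip_scale scale_mem unit_mem comb_mem mult.commute)
qed

lemma ip_comb_left: "finite F \<Longrightarrow> F \<subseteq> E \<Longrightarrow> u \<in> H \<Longrightarrow> ip (comb F c) u = (\<Sum>z\<in>F. cnj (c z) * ip (unit_fun z) u)"
  using ip_comb[of F u c] ip_cnj[of u "comb F c"] comb_mem[of F c]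
  by (simp add: mult.commute, intro sum.cong) (auto simp: ip_cnj[of u "unit_fun _"] unit_mem subset_iff)

lemma ip_unit_comb: "finite F \<Longrightarrow> F \<subseteq> E \<Longrightarrow> x \<in> E \<Longrightarrow> ip (unit_fun x) (comb F c) = (\<Sum>z\<in>F. kern x z * c z)"
  by (simp add: ip_comb unit_mem kern_def)

lemma nsq_comb: "finite F \<Longrightarrow> F \<subseteq> E \<Longrightarrow> matrix_form kern F c = of_real (nsq (comb F c))"
  using ip_self[OF comb_mem, of F c]
  by (simp add: ip_comb_left[OF _ _ comb_mem] matrix_form_def subset_iff ip_unit_comb)

lemma kern_hermitian: "x \<in> E \<Longrightarrow> y \<in> E \<Longrightarrow> kern y x = cnj (kern x y)"
  unfolding kern_def by (intro ip_cnj unit_mem)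

lemma sum_add_diag:
  assumes "finite F" "x \<in> F"
  shows "(\<Sum>y\<in>F. add_diag M S x y * c y) = (\<Sum>y\<in>F. M x y * c y) + (if x \<in> S then c x else 0)"
proof -
  have "(\<Sum>y\<in>F. add_diag M S x y * c y) = (\<Sum>y\<in>F. M x y * c y + (if x = y then (if x \<in> S then c x else 0) else 0))"
    by (intro sum.cong) (auto simp: add_diag_def algebra_simps)
  then show ?thesis using assms by (simp add: sum.distrib)
qed

lemma form_add_diag:
  assumes "finite F" "F \<subseteq> E"
  shows "matrix_form (add_diag kern S) F c = of_real (nsq (comb F c) + (\<Sum>x\<in>F \<inter> S. (cmod (c x))\<^sup>2))"
proof -
  have sq: "cnj z * z = of_real ((cmod z)\<^sup>2)" for z
    by (simp only: complex_norm_square mult.commute)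
  have "matrix_form (add_diag kern S) F c = (\<Sum>x\<in>F. cnj (c x) * (\<Sum>y\<in>F. kern x y * c y)
      + (if x \<in> S then of_real ((cmod (c x))\<^sup>2) else 0))"
    unfolding matrix_form_def using assms(1)
    by (intro sum.cong refl) (auto simp: sum_add_diag distrib_left sq simp del: of_real_power)
  also have "\<dots> = matrix_form kern F c + (\<Sum>x\<in>F \<inter> S. of_real ((cmod (c x))\<^sup>2))"
    unfolding sum.distrib matrix_form_def sum.inter_restrict[OF assms(1)] by simp
  finally show ?thesis using nsq_comb[OF assms] by simp
qed

text \<open>A nonzero coefficient is a nonzero value of \<open>comb F c\<close>, so definiteness of
  \<open>ip\<close> makes the Gram matrix definite; the diagonal part only adds nonnegative
  terms.\<close>

lemma pos_def_add_diag:
  assumes "finite F" "F \<subseteq> E"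
  shows "pos_def_on F (add_diag kern S)"
  unfolding pos_def_on_def
proof (intro conjI ballI allI impI)
  show "add_diag kern S y x = cnj (add_diag kern S x y)" if "x \<in> F" "y \<in> F" for x y
    using that assms kern_hermitian[of x y] by (auto simp: add_diag_def)
  fix c assume "\<exists>x\<in>F. c x \<noteq> (0::complex)"
  then obtain x where "comb F c x \<noteq> 0" unfolding comb_def by metis
  then have "0 < nsq (comb F c)" using nsq_pos comb_mem assms by blast
  moreover have "0 \<le> (\<Sum>x\<in>F \<inter> S. (cmod (c x))\<^sup>2)" by (intro sum_nonneg) simp
  ultimately show "0 < Re (matrix_form (add_diag kern S) F c)"
    using form_add_diag[OF assms] by simp
qed

end

text \<open>\<open>K\<close> is the kernel of \<open>A (I + A)\<^sup>-\<^sup>1\<close>: the last assumption says that \<open>(I + A) u = e\<^sub>x\<close> in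
  \<open>\<H>\<^sub>-\<close> forces \<open>u = (I + A)\<^sup>-\<^sup>1 e\<^sub>x = e\<^sub>x - A (I + A)\<^sup>-\<^sup>1 e\<^sub>x\<close>.\<close>

locale functional_hilbert = function_hilbert_space E H ip
  for E :: "'a set" and H ip +
  fixes K :: "'a \<Rightarrow> 'a \<Rightarrow> complex"
  assumes countable_E: "countable E"
    and bessel: "\<exists>C. \<forall>u\<in>H. \<forall>F. finite F \<longrightarrow> F \<subseteq> E \<longrightarrow>
      (\<Sum>x\<in>F. (cmod (ip (unit_fun x) u))\<^sup>2) \<le> C * Re (ip u u)"
    and resolvent: "\<And>u x y. u \<in> H \<Longrightarrow> x \<in> E \<Longrightarrow> y \<in> E \<Longrightarrow>
      (\<And>z. z \<in> E \<Longrightarrow> u z + ip (unit_fun z) u = unit_fun x z) \<Longrightarrow> u y = unit_fun x y - K y x"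
begin

text \<open>If the values did not converge, infinitely many \<open>u n y\<close> would miss the
  expected value in one fixed direction. The solutions on \<open>D n\<close> with this defect form
  nested, bounded, closed convex sets; a common element solves the equation on all of
  \<open>E\<close>, contradicting \<open>resolvent\<close>.\<close>

lemma tendsto_resolvent:
  assumes D: "\<And>n. D n \<subseteq> E" "mono D" "(\<Union>n. D n) = E"
    and u: "\<And>n. u n \<in> H" "\<And>n. nsq (u n) \<le> R"
      "\<And>n z. z \<in> D n \<Longrightarrow> u n z + ip (unit_fun z) (u n) = unit_fun x z"
    and xy: "x \<in> E" "y \<in> E"
  shows "(\<lambda>n. u n y) \<longlonglongrightarrow> unit_fun x y - K y x"
proof (rule ccontr)
  \<comment> \<open>The four directions in \<open>?W\<close> replace the complement of a disc, which
    is not convex, by half-planes, which are.\<close>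
  let ?k = "unit_fun x y - K y x" and ?W = "{1, -1, \<i>, -\<i>} :: complex set"
  assume "\<not> (\<lambda>n. u n y) \<longlonglongrightarrow> ?k"
  then obtain e where e: "e > 0" "\<not> (\<forall>\<^sub>F n in sequentially. dist (u n y) ?k < e)"
    by (auto simp: tendsto_iff)
  then have "\<exists>\<^sub>F n in sequentially. e \<le> cmod (u n y - ?k)"
    by (simp add: frequently_def dist_norm not_le)
  moreover have "\<exists>w\<in>?W. e / 2 \<le> Re (w * z)" if "e \<le> cmod z" for z
    using cmod_le[of z] that by (auto simp: abs_if split: if_splits)
  ultimately have "\<exists>\<^sub>F n in sequentially. \<exists>w\<in>?W. e / 2 \<le> Re (w * (u n y - ?k))"
    by (rule frequently_elim1)
  then have "\<exists>w\<in>?W. \<exists>\<^sub>F n in sequentially. e / 2 \<le> Re (w * (u n y - ?k))"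
    by (rule frequently_bex_finite[rotated]) simp
  then obtain w where w: "\<exists>\<^sub>F n in sequentially. e / 2 \<le> Re (w * (u n y - ?k))" ..
  define C where "C n = {v \<in> H. nsq v \<le> R \<and> (\<forall>z\<in>D n. v z + ip (unit_fun z) v = unit_fun x z)
     \<and> e / 2 \<le> Re (w * (v y - ?k))}" for n
  have "\<exists>v. \<forall>n. v \<in> C n"
  proof (rule nested_convex_nonempty)
    show "C n \<noteq> {}" for n
    proof -
      obtain m where "n \<le> m" "e / 2 \<le> Re (w * (u m y - ?k))"
        using w by (auto simp: frequently_sequentially)
      then have "u m \<in> C n"
        using u D(2) unfolding C_def mono_def by blast
      then show ?thesis by blast
    qed
    show "C n \<subseteq> C m" if "m \<le> n" for m n
      using D(2) that unfolding C_def mono_def by blast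
    show "(\<lambda>x. (1/2) * (f x + g x)) \<in> C n" if "f \<in> C n" "g \<in> C n" for n f g
    proof -
      have fg: "f \<in> H" "g \<in> H" using that by (auto simp: C_def)
      have "4 * nsq (\<lambda>x. (1/2) * (f x + g x)) \<le> 2 * nsq f + 2 * nsq g"
        using nsq_midpoint[OF fg] nsq_nonneg[OF diff_mem[OF fg]] by linarith
      moreover have "nsq f \<le> R" "nsq g \<le> R" using that by (auto simp: C_def)
      ultimately have "nsq (\<lambda>x. (1/2) * (f x + g x)) \<le> R" by linarith
      moreover have "(1/2) * (f z + g z) + ip (unit_fun z) (\<lambda>x. (1/2) * (f x + g x)) = unit_fun x z"
        if z: "z \<in> D n" for z
      proof -
        have "unit_fun z \<in> H" using z D unit_mem by blast
        then have "(1/2) * (f z + g z) + ip (unit_fun z) (\<lambda>x. (1/2) * (f x + g x))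
           = (1/2) * ((f z + ip (unit_fun z) f) + (g z + ip (unit_fun z) g))"
          unfolding ip_scale[OF \<open>unit_fun z \<in> H\<close> add_mem[OF fg]] ip_add[OF \<open>unit_fun z \<in> H\<close> fg]
          by (simp only: distrib_left add_ac)
        also have "\<dots> = unit_fun x z"
          using that \<open>f \<in> C n\<close> \<open>g \<in> C n\<close> by (simp add: C_def)
        finally show ?thesis .
      qed
      moreover have "e / 2 \<le> Re (w * ((1/2) * (f y + g y) - ?k))"
      proof -
        have "w * ((1/2) * (f y + g y) - ?k) = (1/2) * (w * (f y - ?k) + w * (g y - ?k))"
          by (simp add: algebra_simps)
        moreover have "Re ((1/2) * z) = Re z / 2" for z by simp
        ultimately have "Re (w * ((1/2) * (f y + g y) - ?k)) = (Re (w * (f y - ?k)) + Re (w * (g y - ?k))) / 2"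
          by (simp only: plus_complex.sel)
        moreover have "e / 2 \<le> Re (w * (f y - ?k))" "e / 2 \<le> Re (w * (g y - ?k))"
          using that unfolding C_def by auto
        ultimately show ?thesis by argo
      qed
      moreover have "(\<lambda>x. (1/2) * (f x + g x)) \<in> H" by (rule scale_mem[OF add_mem[OF fg]])
      ultimately show ?thesis unfolding C_def by blast
    qed
    fix n f v assume f: "\<And>k. f k \<in> C n" and lim: "converges f v"
    have fH: "f k \<in> H" for k using f by (simp add: C_def)
    show "v \<in> C n"
      unfolding C_def
    proof (intro CollectI conjI ballI)
      show "v \<in> H" using lim converges_mem by blast
      show "nsq v \<le> R" using converges_nsq_le[OF lim fH] f by (simp add: C_def)
      show "v z + ip (unit_fun z) v = unit_fun x z" if "z \<in> D n" for z
      proof (rule LIMSEQ_unique)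
        show "(\<lambda>k. f k z + ip (unit_fun z) (f k)) \<longlonglongrightarrow> v z + ip (unit_fun z) v"
          using that D by (intro tendsto_add converges_eval[OF lim] converges_ip[OF lim fH] unit_mem) auto
        show "(\<lambda>k. f k z + ip (unit_fun z) (f k)) \<longlonglongrightarrow> unit_fun x z"
          using f that by (simp add: C_def)
      qed
      have "(\<lambda>k. Re (w * (f k y - ?k))) \<longlonglongrightarrow> Re (w * (v y - ?k))"
        by (intro tendsto_intros converges_eval[OF lim] xy)
      then show "e / 2 \<le> Re (w * (v y - ?k))"
        by (rule LIMSEQ_le_const) (use f in \<open>auto simp: C_def\<close>)
    qed
  qed (auto simp: C_def)
  then obtain v where v: "\<And>n. v \<in> C n" by blast
  have "v y = ?k"
  proof (rule resolvent)
    fix z assume "z \<in> E"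
    then obtain n where "z \<in> D n" using D by blast
    then show "v z + ip (unit_fun z) v = unit_fun x z" using v[of n] by (simp add: C_def)
  qed (use v xy in \<open>auto simp: C_def\<close>)
  then show False using v[of 0] e by (simp add: C_def)
qed

end

context functional_hilbert begin

subsection \<open>Ratios of determinants\<close>

text \<open>For \<open>x\<close> outside \<open>Y\<close> this is the squared distance of
  \<open>unit_fun x\<close> from the span of \<open>Y\<close> in the norm whose square is
  \<open>nsq\<close> plus the squared \<open>l2\<close> norm over \<open>S\<close> (see
  \<open>ratio_min\<close>).\<close>

definition ratio :: "'a set \<Rightarrow> 'a \<Rightarrow> 'a set \<Rightarrow> real" where
  "ratio S x Y = Re (det_on (insert x Y) (add_diag kern S)) / Re (det_on Y (add_diag kern S))"

abbreviation alpha :: "'a \<Rightarrow> 'a set \<Rightarrow> real" where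
  "alpha \<equiv> ratio {}"

lemma det_pos:
  assumes "finite Y" "Y \<subseteq> E"
  shows "Im (det_on Y (add_diag kern S)) = 0" "0 < Re (det_on Y (add_diag kern S))"
  using pos_def_on_det[OF assms(1) pos_def_add_diag[OF assms]] by auto

lemma det_kern_pos:
  assumes "finite Y" "Y \<subseteq> E"
  shows "Im (det_on Y kern) = 0" "0 < Re (det_on Y kern)"
  using det_pos[OF assms, of "{}"] by auto

lemma det_insert_ratio:
  assumes "finite Y" "Y \<subseteq> E"
  shows "Re (det_on (insert x Y) (add_diag kern S)) = ratio S x Y * Re (det_on Y (add_diag kern S))"
  using det_pos(2)[OF assms, of S] by (simp add: ratio_def)

text \<open>The Schur complement of \<open>det_on_insert_pos_def\<close>, read in \<open>H\<close>
  through \<open>form_add_diag\<close>.\<close>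

lemma ratio_min:
  assumes "finite Y" "insert x Y \<subseteq> E" "x \<notin> Y"
  shows "\<exists>w. w x = 1 \<and>
    (\<forall>y\<in>Y. ip (unit_fun y) (comb (insert x Y) w) + (if y \<in> S then w y else 0) = 0) \<and>
    ratio S x Y = nsq (comb (insert x Y) w) + (\<Sum>z\<in>insert x Y \<inter> S. (cmod (w z))\<^sup>2) \<and>
    (\<forall>c. c x = 1 \<longrightarrow> ratio S x Y \<le> nsq (comb (insert x Y) c) + (\<Sum>z\<in>insert x Y \<inter> S. (cmod (c z))\<^sup>2)) \<and>
    0 < ratio S x Y"
proof -
  let ?D = "insert x Y"
  let ?N = "add_diag kern S"
  have D: "finite ?D" using assms by simp
  note form = form_add_diag[OF D assms(2), of S]
  obtain w where w: "w x = 1" "\<And>y. y \<in> Y \<Longrightarrow> (\<Sum>z\<in>?D. ?N y z * w z) = 0"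
    "det_on ?D ?N = matrix_form ?N ?D w * det_on Y ?N"
    "\<And>c. c x = 1 \<Longrightarrow> Re (matrix_form ?N ?D w) \<le> Re (matrix_form ?N ?D c)"
    "Im (matrix_form ?N ?D w) = 0" "0 < Re (matrix_form ?N ?D w)"
    by (rule det_on_insert_pos_def[OF assms(1,3) pos_def_add_diag[OF D assms(2), of S]]) (rule that)
  have "Re (det_on ?D ?N) = Re (matrix_form ?N ?D w) * Re (det_on Y ?N)"
    using w(3,5) by simp
  then have r: "ratio S x Y = Re (matrix_form ?N ?D w)"
    using det_pos(2)[of Y S] assms by (simp add: ratio_def)
  show ?thesis
  proof (intro exI[of _ w] conjI ballI allI impI)
    show "w x = 1" by (rule w)
    show "ip (unit_fun y) (comb ?D w) + (if y \<in> S then w y else 0) = 0" if "y \<in> Y" for y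
      using w(2)[OF that] that assms D by (simp add: sum_add_diag ip_unit_comb subset_iff del: sum.insert)
    show "ratio S x Y = nsq (comb ?D w) + (\<Sum>z\<in>?D \<inter> S. (cmod (w z))\<^sup>2)"
      unfolding r form by simp
    show "ratio S x Y \<le> nsq (comb ?D c) + (\<Sum>z\<in>?D \<inter> S. (cmod (c z))\<^sup>2)" if "c x = 1" for c
      using w(4)[of c, OF that] unfolding r form by simp
    show "0 < ratio S x Y" using w(6) r by simp
  qed
qed

lemma ratio_le:
  assumes "finite Y" "insert x Y \<subseteq> E" "x \<notin> Y" "c x = 1"
  shows "ratio S x Y \<le> nsq (comb (insert x Y) c) + (\<Sum>z\<in>insert x Y \<inter> S. (cmod (c z))\<^sup>2)"
proof -
  obtain w where "\<forall>c. c x = 1 \<longrightarrow>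
      ratio S x Y \<le> nsq (comb (insert x Y) c) + (\<Sum>z\<in>insert x Y \<inter> S. (cmod (c z))\<^sup>2)"
    using ratio_min[OF assms(1-3), of S] by blast
  from spec[OF this, of c] assms(4) show ?thesis by blast
qed

text \<open>Without a diagonal term the minimiser is orthogonal to \<open>Y\<close>, so pairing it
  with itself keeps only the term at \<open>x\<close>, whose coefficient is 1.\<close>

lemma alpha_min:
  assumes "finite Y" "insert x Y \<subseteq> E" "x \<notin> Y"
  shows "\<exists>w. w x = 1 \<and> (\<forall>y\<in>Y. ip (unit_fun y) (comb (insert x Y) w) = 0) \<and>
    alpha x Y = nsq (comb (insert x Y) w) \<and> ip (unit_fun x) (comb (insert x Y) w) = alpha x Y"
proof -
  obtain w where w: "w x = 1" "\<And>y. y \<in> Y \<Longrightarrow> ip (unit_fun y) (comb (insert x Y) w) = 0"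
    "alpha x Y = nsq (comb (insert x Y) w)"
    using ratio_min[OF assms, of "{}"] by auto
  have D: "finite (insert x Y)" using assms by simp
  have "ip (comb (insert x Y) w) (comb (insert x Y) w) =
      (\<Sum>z\<in>insert x Y. cnj (w z) * ip (unit_fun z) (comb (insert x Y) w))"
    by (rule ip_comb_left[OF D assms(2) comb_mem[OF D assms(2)]])
  also have "\<dots> = ip (unit_fun x) (comb (insert x Y) w)"
    using assms w by simp
  finally have "ip (unit_fun x) (comb (insert x Y) w) = alpha x Y"
    using ip_self[OF comb_mem[OF D assms(2)]] w(3) by simp
  with w show ?thesis by blast
qed

lemma alpha_pos: "finite Y \<Longrightarrow> insert x Y \<subseteq> E \<Longrightarrow> x \<notin> Y \<Longrightarrow> 0 < alpha x Y"
  using ratio_min[of Y x "{}"] by blast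

text \<open>The minimiser for \<open>X\<close>, extended by zero, is a trial vector for
  \<open>Y\<close>. It vanishes on \<open>S\<close>, so the diagonal term costs nothing.\<close>

lemma ratio_upper:
  assumes fin: "finite Y" "insert x Y \<subseteq> E" "x \<notin> Y" and X: "X \<subseteq> Y" "insert x X \<inter> S = {}"
  shows "ratio S x Y \<le> alpha x X"
proof -
  have X': "finite X" "insert x X \<subseteq> E" "x \<notin> X" using assms finite_subset by auto
  obtain w where w: "w x = 1" "alpha x X = nsq (comb (insert x X) w)"
    using alpha_min[OF X'] by blast
  let ?c = "\<lambda>z. if z \<in> insert x X then w z else 0"
  have "ratio S x Y \<le> nsq (comb (insert x Y) ?c) + (\<Sum>z\<in>insert x Y \<inter> S. (cmod (?c z))\<^sup>2)"
    using w by (intro ratio_le[OF fin]) simp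
  also have "comb (insert x Y) ?c = comb (insert x X) w" using X by (auto simp: comb_def fun_eq_iff)
  also have "(\<Sum>z\<in>insert x Y \<inter> S. (cmod (?c z))\<^sup>2) = 0" using X by (intro sum.neutral) auto
  finally show ?thesis using w by simp
qed

lemma alpha_antimono: "finite Y \<Longrightarrow> insert x Y \<subseteq> E \<Longrightarrow> x \<notin> Y \<Longrightarrow> X \<subseteq> Y \<Longrightarrow> alpha x Y \<le> alpha x X"
  using ratio_upper[of Y x X "{}"] by simp

text \<open>Dropping the nonnegative diagonal term can only lower the minimum.\<close>

lemma alpha_le_ratio:
  assumes "finite Y" "insert x Y \<subseteq> E" "x \<notin> Y"
  shows "alpha x Y \<le> ratio S x Y"
proof -
  obtain w where w: "w x = 1" "ratio S x Y = nsq (comb (insert x Y) w) + (\<Sum>z\<in>insert x Y \<inter> S. (cmod (w z))\<^sup>2)"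
    using ratio_min[OF assms, of S] by blast
  moreover have "alpha x Y \<le> nsq (comb (insert x Y) w) + (\<Sum>z\<in>insert x Y \<inter> {}. (cmod (w z))\<^sup>2)"
    by (rule ratio_le[OF assms, of w, OF w(1)])
  moreover have "0 \<le> (\<Sum>z\<in>insert x Y \<inter> S. (cmod (w z))\<^sup>2)" by (intro sum_nonneg) simp
  ultimately show ?thesis by simp
qed

text \<open>Duality: nonnegativity of \<open>nsq\<close> at \<open>comb ?D w - q\<close> gives a
  lower bound linear in \<open>w\<close>. As \<open>q\<close> is orthogonal to \<open>Y - S\<close>,
  the pairing sees only \<open>x\<close>, which contributes \<open>a\<close>, and the sites of
  \<open>S\<close>.\<close>

lemma ratio_lower:
  assumes fin: "finite Y" "insert x Y \<subseteq> E" "x \<notin> Y" and x: "x \<notin> S" and S: "S \<subseteq> Y"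
    and q: "q \<in> H" "\<And>y. y \<in> Y - S \<Longrightarrow> ip (unit_fun y) q = 0" "ip (unit_fun x) q = of_real a" "nsq q \<le> a"
  shows "a - (\<Sum>z\<in>S. (cmod (ip (unit_fun z) q))\<^sup>2) \<le> ratio S x Y"
proof -
  \<comment> \<open>The cross terms are absorbed by \<open>2 |w(z)| |(e\<^sub>z,q)| \<le> |w(z)|\<^sup>2 + |(e\<^sub>z,q)|\<^sup>2\<close>.\<close>
  let ?D = "insert x Y"
  have D: "finite ?D" "finite S" using fin S finite_subset by auto
  obtain w where w: "w x = 1" "ratio S x Y = nsq (comb ?D w) + (\<Sum>z\<in>?D \<inter> S. (cmod (w z))\<^sup>2)"
    using ratio_min[OF fin, of S] by blast
  have cm: "comb ?D w \<in> H" using comb_mem D fin by blast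
  have "ip (comb ?D w) q = (\<Sum>z\<in>?D. cnj (w z) * ip (unit_fun z) q)"
    using ip_comb_left D fin q by blast
  also have "\<dots> = of_real a + (\<Sum>z\<in>Y. cnj (w z) * ip (unit_fun z) q)" using fin w q by simp
  also have "(\<Sum>z\<in>Y. cnj (w z) * ip (unit_fun z) q) = (\<Sum>z\<in>S. cnj (w z) * ip (unit_fun z) q)"
    using S fin q(2) by (intro sum.mono_neutral_right) auto
  finally have 1: "Re (ip (comb ?D w) q) = a + (\<Sum>z\<in>S. Re (cnj (w z) * ip (unit_fun z) q))" by simp
  have "?D \<inter> S = S" using S by auto
  have 2: "0 \<le> (cmod (w z))\<^sup>2 + 2 * Re (cnj (w z) * b) + (cmod b)\<^sup>2" for z b
  proof -
    have "0 \<le> (cmod (w z + b))\<^sup>2" by simp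
    also have "\<dots> = (cmod (w z))\<^sup>2 + 2 * Re (cnj (w z) * b) + (cmod b)\<^sup>2"
      unfolding cmod_power2 by (simp add: power2_eq_square algebra_simps)
    finally show ?thesis .
  qed
  have "0 \<le> nsq (\<lambda>z. comb ?D w z - q z)" by (rule nsq_nonneg[OF diff_mem[OF cm q(1)]])
  then have "nsq (comb ?D w) \<ge> 2 * Re (ip (comb ?D w) q) - nsq q"
    using nsq_diff[OF cm q(1)] by simp
  then have "nsq (comb ?D w) \<ge> a + 2 * (\<Sum>z\<in>S. Re (cnj (w z) * ip (unit_fun z) q))"
    using 1 q(4) by simp
  then have "ratio S x Y + (\<Sum>z\<in>S. (cmod (ip (unit_fun z) q))\<^sup>2) \<ge> a +
    (\<Sum>z\<in>S. (cmod (w z))\<^sup>2 + 2 * Re (cnj (w z) * ip (unit_fun z) q) + (cmod (ip (unit_fun z) q))\<^sup>2)"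
    unfolding w(2) \<open>?D \<inter> S = S\<close> by (simp add: sum.distrib sum_distrib_left)
  moreover have "0 \<le> (\<Sum>z\<in>S. (cmod (w z))\<^sup>2 + 2 * Re (cnj (w z) * ip (unit_fun z) q) + (cmod (ip (unit_fun z) q))\<^sup>2)"
    using 2 by (intro sum_nonneg) blast
  ultimately show ?thesis by linarith
qed

subsection \<open>Infinite boundary conditions\<close>

text \<open>The \<open>\<alpha>(x;\<xi>)\<close> of the overview. The infimum depends on no
  exhaustion; by monotonicity it is also the limit (\<open>tendsto_alpha\<close>).\<close>

definition alpha_inf :: "'a \<Rightarrow> 'a set \<Rightarrow> real" where
  "alpha_inf x \<xi> = Inf (alpha x ` {X. finite X \<and> X \<subseteq> \<xi>})"

text \<open>An exhaustion by a sequence, since dominated convergence works with sequences rather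
  than with the net of finite sets.\<close>

definition exh :: "nat \<Rightarrow> 'a set" where
  "exh n = {x \<in> E. to_nat_on E x < n}"

lemma exh_subset: "exh n \<subseteq> E" by (auto simp: exh_def)

lemma finite_exh: "finite (exh n)"
  by (rule inj_on_finite[of "to_nat_on E" _ "{..<n}"])
     (auto simp: exh_def inj_on_def countable_E)

lemma exh_mono: "m \<le> n \<Longrightarrow> exh m \<subseteq> exh n" by (auto simp: exh_def)

lemma UN_exh: "(\<Union>n. exh n) = E" by (auto simp: exh_def)

lemma mem_exh: "y \<in> E \<Longrightarrow> \<exists>n. y \<in> exh n" by (auto simp: exh_def)

lemma exh_covers: "finite F \<Longrightarrow> F \<subseteq> E \<Longrightarrow> \<exists>n. F \<subseteq> exh n"
proof (induction F rule: finite_induct)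
  case (insert x F)
  then obtain n where "F \<subseteq> exh n" by auto
  moreover have "x \<in> exh (Suc (to_nat_on E x))" using insert by (auto simp: exh_def)
  ultimately have "insert x F \<subseteq> exh (max n (Suc (to_nat_on E x)))"
    using exh_mono[of n "max n (Suc (to_nat_on E x))"]
      exh_mono[of "Suc (to_nat_on E x)" "max n (Suc (to_nat_on E x))"] by auto
  then show ?case by blast
qed simp

lemma eventually_exh: "finite F \<Longrightarrow> F \<subseteq> E \<Longrightarrow> eventually (\<lambda>n. F \<subseteq> exh n) sequentially"
  using exh_covers exh_mono by (metis (mono_tags, lifting) eventually_sequentially order_trans)

text \<open>Transfers limits along the net of finite subsets, as in \<open>hamiltonian\<close>, to
  the sequence \<open>exh\<close>.\<close>

lemma filterlim_exh: "filterlim exh (finite_subsets_at_top E) sequentially"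
  unfolding filterlim_finite_subsets_at_top
  using eventually_exh by (auto simp: finite_exh exh_subset elim: eventually_mono)

lemma bdd_below_alpha:
  assumes "\<xi> \<subseteq> E" "x \<in> E" "x \<notin> \<xi>"
  shows "bdd_below (alpha x ` {X. finite X \<and> X \<subseteq> \<xi>})"
proof (rule bdd_belowI[of _ 0])
  fix r assume "r \<in> alpha x ` {X. finite X \<and> X \<subseteq> \<xi>}"
  then obtain X where X: "finite X" "X \<subseteq> \<xi>" "r = alpha x X" by blast
  then have "0 < alpha x X" using assms by (intro alpha_pos) auto
  then show "0 \<le> r" using X by simp
qed

lemma alpha_inf_le:
  assumes "\<xi> \<subseteq> E" "x \<in> E" "x \<notin> \<xi>" "finite X" "X \<subseteq> \<xi>"
  shows "alpha_inf x \<xi> \<le> alpha x X"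
  unfolding alpha_inf_def using bdd_below_alpha assms by (intro cInf_lower) auto

text \<open>The infimum is a lower bound for every \<Delta>; one finite \<open>X\<close> that nearly
  attains it controls all larger \<Delta>, by \<open>alpha_antimono\<close>.\<close>

lemma tendsto_alpha:
  assumes "\<xi> \<subseteq> E" "x \<in> E" "x \<notin> \<xi>"
  shows "((\<lambda>\<Delta>. alpha x (\<xi> \<inter> \<Delta>)) \<longlongrightarrow> alpha_inf x \<xi>) (finite_subsets_at_top E)"
proof (rule order_tendstoI)
  fix a assume "a < alpha_inf x \<xi>"
  then have "finite \<Delta> \<and> \<Delta> \<subseteq> E \<Longrightarrow> a < alpha x (\<xi> \<inter> \<Delta>)" for \<Delta>
    using alpha_inf_le[OF assms, of "\<xi> \<inter> \<Delta>"] by auto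
  then show "\<forall>\<^sub>F \<Delta> in finite_subsets_at_top E. a < alpha x (\<xi> \<inter> \<Delta>)"
    unfolding eventually_finite_subsets_at_top by (intro exI[of _ "{}"]) auto
next
  fix a assume "alpha_inf x \<xi> < a"
  then obtain X where X: "finite X" "X \<subseteq> \<xi>" "alpha x X < a"
    using cInf_lessD[of "alpha x ` {X. finite X \<and> X \<subseteq> \<xi>}" a] by (auto simp: alpha_inf_def)
  have "alpha x (\<xi> \<inter> \<Delta>) < a" if "finite \<Delta>" "X \<subseteq> \<Delta>" for \<Delta>
  proof -
    have "insert x (\<xi> \<inter> \<Delta>) \<subseteq> E" using assms by auto
    then have "alpha x (\<xi> \<inter> \<Delta>) \<le> alpha x X" using that X assms by (intro alpha_antimono) auto
    with X(3) show ?thesis by simp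
  qed
  then show "\<forall>\<^sub>F \<Delta> in finite_subsets_at_top E. alpha x (\<xi> \<inter> \<Delta>) < a"
    unfolding eventually_finite_subsets_at_top using X assms by (intro exI[of _ X]) auto
qed

text \<open>\<open>q\<close> is the component of \<open>e\<^sub>x\<close> orthogonal to the closed span of \<open>\<xi>\<close>. The functions in that span
  vanish at \<open>x\<close>, hence \<open>q(x) = 1\<close> and \<open>q \<noteq> 0\<close>.\<close>

lemma limit_vector:
  assumes \<xi>: "\<xi> \<subseteq> E" "x \<in> E" "x \<notin> \<xi>"
  obtains q where "q \<in> H" "\<And>y. y \<in> \<xi> \<Longrightarrow> ip (unit_fun y) q = 0"
    "ip (unit_fun x) q = of_real (alpha_inf x \<xi>)" "nsq q \<le> alpha_inf x \<xi>" "0 < alpha_inf x \<xi>"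
proof -
  define a where "a = alpha_inf x \<xi>"
  define r where "r n = alpha x (\<xi> \<inter> exh n)" for n
  have r: "r \<longlonglongrightarrow> a"
    unfolding r_def a_def using tendsto_alpha[OF \<xi>] filterlim_exh by (rule filterlim_compose)
  have fin: "finite (\<xi> \<inter> exh n)" "insert x (\<xi> \<inter> exh n) \<subseteq> E" "x \<notin> \<xi> \<inter> exh n" for n
    using \<xi> finite_exh by auto
  have r_dec: "r n \<le> r m" if "m \<le> n" for m n
    unfolding r_def using fin exh_mono[OF that] by (intro alpha_antimono) auto
  have a_le: "a \<le> r n" for n
    unfolding a_def r_def using \<xi> finite_exh by (intro alpha_inf_le) auto
  \<comment> \<open>The last condition shrinks to equality as \<open>r n\<close> tends to
    \<open>a\<close>, so that a common element pairs with \<open>unit_fun x\<close> to exactly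
    \<open>a\<close>.\<close>
  define C where "C n = {v \<in> H. nsq v \<le> r n \<and> v x = 1 \<and> (\<forall>z\<in>\<xi> \<inter> exh n. ip (unit_fun z) v = 0)
     \<and> cmod (ip (unit_fun x) v - of_real a) \<le> r n - a}" for n
  have "\<exists>v. \<forall>n. v \<in> C n"
  proof (rule nested_convex_nonempty[where R = "r 0"])
    show "C n \<subseteq> H" for n by (auto simp: C_def)
    show "C n \<noteq> {}" for n
    proof -
      let ?X = "\<xi> \<inter> exh n"
      obtain w where w: "w x = 1" "\<And>y. y \<in> ?X \<Longrightarrow> ip (unit_fun y) (comb (insert x ?X) w) = 0"
        "r n = nsq (comb (insert x ?X) w)" "ip (unit_fun x) (comb (insert x ?X) w) = r n"
        using alpha_min[OF fin[of n]] unfolding r_def by blast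
      have "cmod (of_real (r n) - of_real a) = r n - a"
        using a_le[of n] by (metis abs_of_nonneg diff_ge_0_iff_ge norm_of_real of_real_diff)
      then have "comb (insert x ?X) w \<in> C n"
        unfolding C_def using w comb_mem[of "insert x ?X" w] fin[of n]
        by (auto simp: comb_def)
      then show ?thesis by blast
    qed
    show "C n \<subseteq> C m" if "m \<le> n" for m n
      using r_dec[OF that] exh_mono[OF that] unfolding C_def by fastforce
    show "nsq u \<le> r 0" if "u \<in> C n" for n u
      using that r_dec[of 0 n] by (auto simp: C_def)
    show "(\<lambda>x. (1/2) * (f x + g x)) \<in> C n" if "f \<in> C n" "g \<in> C n" for n f g
    proof -
      have fg: "f \<in> H" "g \<in> H" using that by (auto simp: C_def)
      have mid: "ip v (\<lambda>x. (1/2) * (f x + g x)) = (1/2) * (ip v f + ip v g)" if "v \<in> H" for v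
        unfolding ip_scale[OF that add_mem[OF fg]] ip_add[OF that fg] ..
      have "4 * nsq (\<lambda>x. (1/2) * (f x + g x)) \<le> 2 * nsq f + 2 * nsq g"
        using nsq_midpoint[OF fg] nsq_nonneg[OF diff_mem[OF fg]] by linarith
      moreover have "nsq f \<le> r n" "nsq g \<le> r n" using that by (auto simp: C_def)
      ultimately have "nsq (\<lambda>x. (1/2) * (f x + g x)) \<le> r n" by linarith
      moreover have "ip (unit_fun z) (\<lambda>x. (1/2) * (f x + g x)) = 0" if "z \<in> \<xi> \<inter> exh n" for z
        using mid[of "unit_fun z"] that \<open>f \<in> C n\<close> \<open>g \<in> C n\<close> \<xi> unit_mem[of z] by (auto simp: C_def)
      moreover have "(1/2) * (f x + g x) = 1" using that by (simp add: C_def)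
      moreover have "cmod (ip (unit_fun x) (\<lambda>x. (1/2) * (f x + g x)) - of_real a) \<le> r n - a"
      proof -
        let ?f = "ip (unit_fun x) f - of_real a" and ?g = "ip (unit_fun x) g - of_real a"
        have "ip (unit_fun x) (\<lambda>x. (1/2) * (f x + g x)) - of_real a = (?f + ?g) / 2"
          unfolding mid[OF unit_mem[OF \<xi>(2)]] by (simp add: field_simps)
        then have "cmod (ip (unit_fun x) (\<lambda>x. (1/2) * (f x + g x)) - of_real a) = cmod (?f + ?g) / 2"
          by (simp only: norm_divide norm_numeral)
        moreover have "cmod ?f \<le> r n - a" "cmod ?g \<le> r n - a" using that by (auto simp: C_def)
        ultimately show ?thesis
          using norm_triangle_ineq[of ?f ?g] by linarith
      qed
      moreover have "(\<lambda>x. (1/2) * (f x + g x)) \<in> H" by (rule scale_mem[OF add_mem[OF fg]])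
      ultimately show ?thesis unfolding C_def by blast
    qed
    fix n f v assume f: "\<And>k. f k \<in> C n" and lim: "converges f v"
    have fH: "f k \<in> H" for k using f by (simp add: C_def)
    show "v \<in> C n"
      unfolding C_def
    proof (intro CollectI conjI ballI)
      show "v \<in> H" using lim converges_mem by blast
      show "nsq v \<le> r n" using converges_nsq_le[OF lim fH] f by (simp add: C_def)
      show "v x = 1"
        using LIMSEQ_unique[OF converges_eval[OF lim \<xi>(2)], of 1] f by (simp add: C_def)
      show "ip (unit_fun z) v = 0" if "z \<in> \<xi> \<inter> exh n" for z
        using LIMSEQ_unique[OF converges_ip[OF lim fH unit_mem[of z]], of 0] f that \<xi> by (auto simp: C_def)
      have "(\<lambda>k. cmod (ip (unit_fun x) (f k) - of_real a)) \<longlonglongrightarrow> cmod (ip (unit_fun x) v - of_real a)"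
        by (intro tendsto_intros converges_ip[OF lim fH] unit_mem \<xi>)
      then show "cmod (ip (unit_fun x) v - of_real a) \<le> r n - a"
        by (rule LIMSEQ_le_const2) (use f in \<open>auto simp: C_def\<close>)
    qed
  qed
  then obtain q where q: "\<And>n. q \<in> C n" by blast
  show ?thesis
  proof (rule that[of q])
    show qH: "q \<in> H" using q by (simp add: C_def)
    show "ip (unit_fun y) q = 0" if y: "y \<in> \<xi>" for y
    proof -
      obtain n where "y \<in> exh n" using mem_exh y \<xi> by blast
      then show ?thesis using q[of n] y by (simp add: C_def)
    qed
    have "cmod (ip (unit_fun x) q - of_real a) \<le> a - a"
      by (rule LIMSEQ_le_const[OF tendsto_diff[OF r tendsto_const]]) (use q in \<open>auto simp: C_def\<close>)
    then show "ip (unit_fun x) q = of_real (alpha_inf x \<xi>)" by (simp add: a_def)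
    show le: "nsq q \<le> alpha_inf x \<xi>"
      unfolding a_def[symmetric] by (rule LIMSEQ_le_const[OF r]) (use q in \<open>auto simp: C_def\<close>)
    have "q x = 1" using q[of 0] by (simp add: C_def)
    then show "0 < alpha_inf x \<xi>" using nsq_pos[OF qH, of x] le by simp
  qed
qed

text \<open>Finite Bessel sums are bounded, so some \<open>F\<close> comes within \<open>e\<close>
  of their supremum; sites off \<open>F\<close> cannot add more than \<open>e\<close>.\<close>

lemma bessel_tail:
  assumes "q \<in> H" "0 < e"
  obtains F where "finite F" "F \<subseteq> E"
    "\<And>S. finite S \<Longrightarrow> S \<subseteq> E - F \<Longrightarrow> (\<Sum>z\<in>S. (cmod (ip (unit_fun z) q))\<^sup>2) \<le> e"
proof -
  let ?f = "\<lambda>F. \<Sum>z\<in>F. (cmod (ip (unit_fun z) q))\<^sup>2" and ?A = "{F. finite F \<and> F \<subseteq> E}"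
  obtain C where C: "\<And>F. finite F \<Longrightarrow> F \<subseteq> E \<Longrightarrow> ?f F \<le> C * nsq q"
    using bessel assms(1) unfolding nsq_def by blast
  then have bdd: "bdd_above (?f ` ?A)" by (intro bdd_aboveI2[of _ _ "C * nsq q"]) auto
  obtain F where F: "finite F" "F \<subseteq> E" "Sup (?f ` ?A) - e < ?f F"
    using less_cSupD[of "?f ` ?A" "Sup (?f ` ?A) - e"] assms(2) by auto
  show ?thesis
  proof (rule that[OF F(1,2)])
    fix S assume S: "finite S" "S \<subseteq> E - F"
    then have "?f F + ?f S = ?f (F \<union> S)" using F by (intro sum.union_disjoint[symmetric]) auto
    also have "\<dots> \<le> Sup (?f ` ?A)" using S F bdd by (intro cSup_upper) auto
    finally show "?f S \<le> e" using F(3) by linarith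
  qed
qed

subsection \<open>Finite volume distributions\<close>

text \<open>The Boltzmann factor \<open>exp (- V X)\<close> of the determinantal potential.\<close>

definition weight :: "'a set \<Rightarrow> real" where
  "weight X = Re (det_on X kern)"

text \<open>The probability that \<open>X\<close> is occupied and \<open>T\<close> vacant, under the
  finite volume Gibbs distribution in \<open>D\<close> with boundary condition \<eta>.\<close>

definition finite_prob :: "'a set \<Rightarrow> 'a set \<Rightarrow> 'a set \<Rightarrow> 'a set \<Rightarrow> real" where
  "finite_prob D \<eta> X T =
     (\<Sum>\<zeta>\<in>{\<zeta>\<in>Pow D. X \<subseteq> \<zeta> \<and> T \<inter> \<zeta> = {}}. weight (\<zeta> \<union> \<eta>)) / (\<Sum>\<zeta>\<in>Pow D. weight (\<zeta> \<union> \<eta>))"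

lemma weight_pos: "finite X \<Longrightarrow> X \<subseteq> E \<Longrightarrow> 0 < weight X"
  using det_kern_pos by (simp add: weight_def)

text \<open>The admissible configurations are \<open>X\<close> together with an arbitrary subset of
  the free sites \<open>D - X - T\<close>, so \<open>sum_det_on_Pow\<close> applies.\<close>

lemma sum_weight_cylinder:
  assumes "finite D" "finite \<eta>" "D \<inter> \<eta> = {}" "X \<subseteq> D" "T \<subseteq> D - X"
  shows "(\<Sum>\<zeta>\<in>{\<zeta>\<in>Pow D. X \<subseteq> \<zeta> \<and> T \<inter> \<zeta> = {}}. weight (\<zeta> \<union> \<eta>)) =
    Re (det_on (X \<union> \<eta> \<union> (D - X - T)) (add_diag kern (D - X - T)))"
proof -
  have fX: "finite X" using assms finite_subset by blast
  have "(\<Sum>\<zeta>\<in>{\<zeta>\<in>Pow D. X \<subseteq> \<zeta> \<and> T \<inter> \<zeta> = {}}. weight (\<zeta> \<union> \<eta>)) =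
      (\<Sum>J\<in>Pow (D - X - T). weight (X \<union> \<eta> \<union> J))"
    by (rule sum.reindex_bij_witness[where i = "\<lambda>J. X \<union> J" and j = "\<lambda>\<zeta>. \<zeta> - X"])
       (use assms in \<open>auto intro!: arg_cong[of _ _ weight]\<close>)
  also have "\<dots> = Re (\<Sum>J\<in>Pow (D - X - T). det_on (X \<union> \<eta> \<union> J) kern)"
    by (simp add: weight_def)
  also have "(\<Sum>J\<in>Pow (D - X - T). det_on (X \<union> \<eta> \<union> J) kern) =
      det_on (X \<union> \<eta> \<union> (D - X - T)) (add_diag kern (D - X - T))"
    using assms fX by (intro sum_det_on_Pow) auto
  finally show ?thesis .
qed

text \<open>\<open>u x\<close> is the column at \<open>x\<close> of the inverse of
  \<open>A + P_D\<close> on the sites of \<open>D\<close> and \<eta>. The bound 1 on its squared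
  norm depends neither on \<open>D\<close> nor on \<eta>, which is what the limit argument
  needs.\<close>

lemma finite_prob_det:
  assumes D: "finite D" "D \<subseteq> E" and \<eta>: "finite \<eta>" "\<eta> \<subseteq> E - D" and X: "X \<subseteq> D"
  shows "\<exists>u. (\<forall>x\<in>X. u x \<in> H \<and> nsq (u x) \<le> 1 \<and> (\<forall>z\<in>D. u x z + ip (unit_fun z) (u x) = unit_fun x z)) \<and>
    of_real (finite_prob D \<eta> X {}) = det_on X (\<lambda>y z. unit_fun z y - u z y)"
proof -
  let ?F = "D \<union> \<eta>" and ?N = "add_diag kern D"
  have F: "finite ?F" "?F \<subseteq> E" using D \<eta> by auto
  have fX: "finite X" using X D finite_subset by blast
  have "\<exists>v. \<forall>y\<in>?F. (\<Sum>z\<in>?F. ?N y z * v z) = unit_fun x y" for x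
    by (rule pos_def_on_solve[OF F(1) pos_def_add_diag[OF F]])
  then obtain v where v: "\<And>x y. y \<in> ?F \<Longrightarrow> (\<Sum>z\<in>?F. ?N y z * v x z) = unit_fun x y" by metis
  define u where "u x = comb ?F (v x)" for x
  have uH: "u x \<in> H" for x unfolding u_def by (rule comb_mem[OF F])
  have eq: "u x z + ip (unit_fun z) (u x) = unit_fun x z" if "z \<in> D" for x z
  proof -
    have "ip (unit_fun z) (u x) = (\<Sum>w\<in>?F. kern z w * v x w)"
      unfolding u_def using that D F by (intro ip_unit_comb) auto
    moreover have "u x z = v x z" using that by (simp add: u_def comb_def)
    ultimately show ?thesis
      using v[of z x] that F by (simp add: sum_add_diag add.commute)
  qed
  \<comment> \<open>Pairing the equation for \<open>v x\<close> with \<open>v x\<close> itself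
    leaves only its value at \<open>x\<close>: with \<open>t = Re (v x x)\<close>, the squared norm
    is at most \<open>t - t\<^sup>2\<close>, hence at most 1.\<close>
  have bound: "nsq (u x) \<le> 1" if x: "x \<in> X" for x
  proof -
    have "matrix_form ?N ?F (v x) = cnj (v x x)"
      using matrix_form_kernel[of ?F x ?N "v x"] F x X v by (auto simp: unit_fun_def)
    then have "nsq (u x) + (\<Sum>z\<in>?F \<inter> D. (cmod (v x z))\<^sup>2) = Re (v x x)"
      unfolding form_add_diag[OF F] u_def by (metis Re_complex_of_real complex_cnj_cnj complex_cnj_complex_of_real)
    moreover have "(cmod (v x x))\<^sup>2 \<le> (\<Sum>z\<in>?F \<inter> D. (cmod (v x z))\<^sup>2)"
      using x X F by (intro member_le_sum) auto
    ultimately have "nsq (u x) + (Re (v x x))\<^sup>2 \<le> Re (v x x)"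
      unfolding cmod_power2 by (smt (verit) zero_le_power2)
    moreover have "Re (v x x) - (Re (v x x))\<^sup>2 \<le> 1"
    proof -
      have "0 \<le> (Re (v x x) - 1)\<^sup>2" by simp
      also have "\<dots> = (Re (v x x))\<^sup>2 - 2 * Re (v x x) + 1" by (simp add: power2_diff)
      finally show ?thesis using zero_le_power2[of "Re (v x x)"] by linarith
    qed
    ultimately show ?thesis by linarith
  qed
  \<comment> \<open>Removing the diagonal entries at \<open>X\<close> forces \<open>X\<close> to be
    occupied: this determinant is the numerator of \<open>finite_prob\<close>.\<close>
  have "det_on ?F (add_diag kern (D - X)) =
      det_on ?F (\<lambda>y z. ?N y z - (if y = z \<and> y \<in> X then 1 else 0))"
    using X by (intro det_on_cong) (auto simp: add_diag_def)
  also have "\<dots> = det_on ?F ?N * det_on X (\<lambda>y z. (if y = z then 1 else 0) - u z y)"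
  proof (rule det_on_minus_diag[OF F(1)])
    show "X \<subseteq> ?F" using X by auto
    fix y z assume "y \<in> ?F" "z \<in> X"
    then show "(\<Sum>w\<in>?F. ?N y w * u z w) = (if y = z then 1 else 0)"
      using v[of y z] by (simp add: u_def comb_def unit_fun_def)
  qed
  also have "det_on X (\<lambda>y z. (if y = z then 1 else 0) - u z y) = det_on X (\<lambda>y z. unit_fun z y - u z y)"
    by (intro det_on_cong) (simp add: unit_fun_def)
  finally have det: "det_on ?F (add_diag kern (D - X)) = det_on ?F ?N * det_on X (\<lambda>y z. unit_fun z y - u z y)" .
  have "finite_prob D \<eta> X {} = Re (det_on ?F (add_diag kern (D - X))) / Re (det_on ?F ?N)"
  proof -
    have disj: "D \<inter> \<eta> = {}" using \<eta> by auto
    have "X \<union> \<eta> \<union> (D - X - {}) = ?F" "{} \<union> \<eta> \<union> (D - {} - {}) = ?F" using X by auto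
    moreover have "(\<Sum>\<zeta>\<in>{\<zeta>\<in>Pow D. {} \<subseteq> \<zeta> \<and> {} \<inter> \<zeta> = {}}. weight (\<zeta> \<union> \<eta>)) = (\<Sum>\<zeta>\<in>Pow D. weight (\<zeta> \<union> \<eta>))"
      by (rule sum.cong) auto
    ultimately show ?thesis
      using sum_weight_cylinder[OF D(1) \<eta>(1) disj X, of "{}"]
        sum_weight_cylinder[OF D(1) \<eta>(1) disj empty_subsetI, of "{}"]
      unfolding finite_prob_def by simp
  qed
  moreover have re: "of_real (Re (det_on ?F (add_diag kern S))) = det_on ?F (add_diag kern S)" for S
    using det_pos(1)[OF F, of S] by (simp add: complex_eq_iff)
  ultimately have "of_real (finite_prob D \<eta> X {}) = det_on ?F (add_diag kern (D - X)) / det_on ?F ?N"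
    by (simp only: of_real_divide)
  moreover have "det_on ?F ?N \<noteq> 0" using det_pos(2)[OF F, of D] by auto
  ultimately have "of_real (finite_prob D \<eta> X {}) = det_on X (\<lambda>y z. unit_fun z y - u z y)"
    by (simp add: det)
  then show ?thesis using uH bound eq by blast
qed

text \<open>The boundary conditions may vary arbitrarily with \<open>n\<close>: by
  \<open>tendsto_resolvent\<close> the entries of the kernels converge to those of \<open>K\<close>
  in every case, and determinants of fixed size are continuous. Uniqueness rests on this.\<close>

lemma finite_prob_tendsto:
  assumes X: "finite X" "X \<subseteq> E" and \<eta>: "\<And>n. finite (\<eta> n)" "\<And>n. \<eta> n \<subseteq> E - exh n"
  shows "(\<lambda>n. complex_of_real (finite_prob (exh n) (\<eta> n) X {})) \<longlonglongrightarrow> det_on X K"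
proof -
  obtain N where N: "X \<subseteq> exh N" using exh_covers X by blast
  \<comment> \<open>The shift by \<open>N\<close> makes every volume contain \<open>X\<close>; it is
    undone by \<open>LIMSEQ_offset\<close>.\<close>
  define D where "D n = exh (n + N)" for n
  have XD: "X \<subseteq> D n" for n using N exh_mono[of N "n + N"] by (auto simp: D_def)
  have "\<exists>u. (\<forall>x\<in>X. u x \<in> H \<and> nsq (u x) \<le> 1 \<and> (\<forall>z\<in>D n. u x z + ip (unit_fun z) (u x) = unit_fun x z)) \<and>
    of_real (finite_prob (D n) (\<eta> (n + N)) X {}) = det_on X (\<lambda>y z. unit_fun z y - u z y)" for n
    unfolding D_def using finite_exh exh_subset \<eta> XD[of n, unfolded D_def] by (rule finite_prob_det)
  then have "\<exists>u. \<forall>n. (\<forall>x\<in>X. u n x \<in> H \<and> nsq (u n x) \<le> 1 \<and>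
      (\<forall>z\<in>D n. u n x z + ip (unit_fun z) (u n x) = unit_fun x z)) \<and>
    of_real (finite_prob (D n) (\<eta> (n + N)) X {}) = det_on X (\<lambda>y z. unit_fun z y - u n z y)"
    by (intro choice allI)
  then obtain u where u: "\<And>n x. x \<in> X \<Longrightarrow> u n x \<in> H" "\<And>n x. x \<in> X \<Longrightarrow> nsq (u n x) \<le> 1"
    "\<And>n x z. x \<in> X \<Longrightarrow> z \<in> D n \<Longrightarrow> u n x z + ip (unit_fun z) (u n x) = unit_fun x z"
    "\<And>n. of_real (finite_prob (D n) (\<eta> (n + N)) X {}) = det_on X (\<lambda>y z. unit_fun z y - u n z y)"
    by blast
  have DE: "\<And>n. D n \<subseteq> E" unfolding D_def by (rule exh_subset)
  have mD: "mono D" unfolding D_def mono_def by (simp add: exh_mono)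
  have "exh n \<subseteq> D n" for n unfolding D_def by (rule exh_mono) simp
  then have "(\<Union>n. exh n) \<subseteq> (\<Union>n. D n)" by (intro UN_mono) auto
  then have UD: "(\<Union>n. D n) = E" using DE unfolding UN_exh by (intro subset_antisym UN_least)
  have "(\<lambda>n. u n z y) \<longlonglongrightarrow> unit_fun z y - K y z" if "y \<in> X" "z \<in> X" for y z
    using tendsto_resolvent[OF DE mD UD, of "\<lambda>n. u n z" 1 z y] u that X by blast
  then have "(\<lambda>n. det_on X (\<lambda>y z. unit_fun z y - u n z y)) \<longlonglongrightarrow> det_on X (\<lambda>y z. unit_fun z y - (unit_fun z y - K y z))"
    by (intro tendsto_det_on tendsto_intros) auto
  then have "(\<lambda>n. complex_of_real (finite_prob (exh (n + N)) (\<eta> (n + N)) X {})) \<longlonglongrightarrow> det_on X K"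
    using u(4) by (simp add: D_def)
  then show ?thesis by (rule LIMSEQ_offset)
qed

end

section \<open>The space of configurations\<close>

text \<open>The events whose probabilities are the correlation functions; they form a generating
  pi-system.\<close>

definition inclusion_events :: "'a set \<Rightarrow> 'a set set set" where
  "inclusion_events E = (\<lambda>X. {\<xi>\<in>Pow E. X \<subseteq> \<xi>}) ` {X. finite X \<and> X \<subseteq> E}"

lemma Int_stable_inclusion_events: "Int_stable (inclusion_events E)"
proof (rule Int_stableI)
  fix a b assume "a \<in> inclusion_events E" "b \<in> inclusion_events E"
  then obtain X Y where "finite X" "X \<subseteq> E" "a = {\<xi>\<in>Pow E. X \<subseteq> \<xi>}" "finite Y" "Y \<subseteq> E" "b = {\<xi>\<in>Pow E. Y \<subseteq> \<xi>}"
    unfolding inclusion_events_def by blast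
  then show "a \<inter> b \<in> inclusion_events E"
    unfolding inclusion_events_def by (intro image_eqI[of _ _ "X \<union> Y"]) auto
qed

lemma inclusion_events_subset: "inclusion_events E \<subseteq> Pow (Pow E)"
  by (auto simp: inclusion_events_def)

lemma cylinder_in_sigma:
  assumes "finite \<Delta>" "\<Delta> \<subseteq> E"
  shows "{\<xi>\<in>Pow E. \<xi> \<inter> \<Delta> = \<eta>} \<in> sigma_sets (Pow E) (inclusion_events E)"
proof (cases "\<eta> \<subseteq> \<Delta>")
  case True
  interpret sigma_algebra "Pow E" "sigma_sets (Pow E) (inclusion_events E)"
    by (rule sigma_algebra_sigma_sets[OF inclusion_events_subset])
  have inc: "{\<xi>\<in>Pow E. X \<subseteq> \<xi>} \<in> sigma_sets (Pow E) (inclusion_events E)" if "finite X" "X \<subseteq> E" for X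
    using that by (intro sigma_sets.Basic) (auto simp: inclusion_events_def)
  have "{\<xi>\<in>Pow E. \<xi> \<inter> \<Delta> = \<eta>} = {\<xi>\<in>Pow E. \<eta> \<subseteq> \<xi>} - (\<Union>y\<in>\<Delta> - \<eta>. {\<xi>\<in>Pow E. {y} \<subseteq> \<xi>})"
    using True by auto
  also have "\<dots> \<in> sigma_sets (Pow E) (inclusion_events E)"
    using assms True finite_subset by (intro Diff finite_UN inc) auto
  finally show ?thesis .
next
  case False
  then have "{\<xi>\<in>Pow E. \<xi> \<inter> \<Delta> = \<eta>} = {}" by auto
  then show ?thesis by (simp only: sigma_sets.Empty)
qed

text \<open>Inclusion events are open. Conversely, for countable \<open>E\<close> there are only
  countably many finite cylinders, and every open set is a union of them.\<close>

lemma sets_config_space: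
  assumes "countable E"
  shows "sets (config_space E) = sigma_sets (Pow E) (inclusion_events E)"
proof -
  let ?f = "\<lambda>\<xi>. \<lambda>x\<in>E. x \<in> \<xi>"
  let ?T = "product_topology (\<lambda>_. discrete_topology (UNIV :: bool set)) E"
  let ?S = "sigma_sets (Pow E) (inclusion_events E)"
  interpret sigma_algebra "Pow E" ?S
    by (rule sigma_algebra_sigma_sets[OF inclusion_events_subset])
  have op: "openin (config_topology E) U \<longleftrightarrow> (\<exists>V. openin ?T V \<and> U = ?f -` V \<inter> Pow E)" for U
    by (simp add: config_topology_def openin_pullback_topology)
  have sub: "{U. openin (config_topology E) U} \<subseteq> Pow (Pow E)" using op by auto
  have sets: "sets (config_space E) = sigma_sets (Pow E) {U. openin (config_topology E) U}"
    unfolding config_space_def by (rule sets_measure_of[OF sub])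
  have 1: "inclusion_events E \<subseteq> {U. openin (config_topology E) U}"
  proof
    fix a assume "a \<in> inclusion_events E"
    then obtain X where X: "finite X" "X \<subseteq> E" "a = {\<xi>\<in>Pow E. X \<subseteq> \<xi>}"
      unfolding inclusion_events_def by blast
    let ?V = "PiE E (\<lambda>x. if x \<in> X then {True} else UNIV)"
    have "openin ?T ?V"
    proof (rule product_topology_basis)
      have "{i. (if i \<in> X then {True} else UNIV) \<noteq> topspace (discrete_topology (UNIV :: bool set))} \<subseteq> X"
        by auto
      then show "finite {i. (if i \<in> X then {True} else UNIV) \<noteq> topspace (discrete_topology (UNIV :: bool set))}"
        using X(1) finite_subset by blast
    qed auto
    moreover have "a = ?f -` ?V \<inter> Pow E"
      using X by (auto simp: PiE_iff split: if_splits)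
    ultimately show "a \<in> {U. openin (config_topology E) U}" unfolding mem_Collect_eq op by blast
  qed
  have 2: "{U. openin (config_topology E) U} \<subseteq> ?S"
  proof
    fix U assume "U \<in> {U. openin (config_topology E) U}"
    then have "\<exists>V. openin ?T V \<and> U = ?f -` V \<inter> Pow E" unfolding mem_Collect_eq op .
    then obtain V where V: "openin ?T V" "U = ?f -` V \<inter> Pow E" by blast
    let ?C = "\<lambda>p. {\<xi>\<in>Pow E. \<xi> \<inter> fst p = snd p}"
    \<comment> \<open>Pairs of a finite window and a pattern in it whose cylinder lies inside
      \<open>U\<close>.\<close>
    define I where "I = {p. p \<in> {\<Delta>. finite \<Delta> \<and> \<Delta> \<subseteq> E} \<times> {\<eta>. finite \<eta> \<and> \<eta> \<subseteq> E} \<and> ?C p \<subseteq> U}"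
    have "I \<subseteq> {\<Delta>. finite \<Delta> \<and> \<Delta> \<subseteq> E} \<times> {\<eta>. finite \<eta> \<and> \<eta> \<subseteq> E}" unfolding I_def by blast
    moreover have "countable ({\<Delta>. finite \<Delta> \<and> \<Delta> \<subseteq> E} \<times> {\<eta>. finite \<eta> \<and> \<eta> \<subseteq> E})"
      by (rule countable_SIGMA[OF countable_Collect_finite_subset[OF assms] countable_Collect_finite_subset[OF assms]])
    ultimately have "countable I" by (rule countable_subset)
    moreover have "U = (\<Union>p\<in>I. ?C p)"
    proof
      show "(\<Union>p\<in>I. ?C p) \<subseteq> U" by (auto simp: I_def)
      show "U \<subseteq> (\<Union>p\<in>I. ?C p)"
      proof
        fix \<xi> assume \<xi>: "\<xi> \<in> U"
        then have "?f \<xi> \<in> V" using V by blast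
        then obtain X where X: "?f \<xi> \<in> PiE E X" "finite {i. X i \<noteq> topspace (discrete_topology (UNIV :: bool set))}"
          "PiE E X \<subseteq> V"
          using product_topology_open_contains_basis[OF V(1)] by metis
        define \<Delta> where "\<Delta> = {i. X i \<noteq> UNIV} \<inter> E"
        have fin: "finite \<Delta>" using X(2) by (simp add: \<Delta>_def)
        have "?C (\<Delta>, \<xi> \<inter> \<Delta>) \<subseteq> U"
        proof
          fix \<xi>' assume "\<xi>' \<in> ?C (\<Delta>, \<xi> \<inter> \<Delta>)"
          then have \<xi>': "\<xi>' \<subseteq> E" "\<xi>' \<inter> \<Delta> = \<xi> \<inter> \<Delta>" by auto
          have "(x \<in> \<xi>') \<in> X x" if "x \<in> E" for x
          proof (cases "x \<in> \<Delta>")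
            case True
            then have "(x \<in> \<xi>') = (x \<in> \<xi>)" using \<xi>' by blast
            then show ?thesis using X(1) that by (auto simp: PiE_iff)
          next
            case False
            then show ?thesis using that by (simp add: \<Delta>_def)
          qed
          then have "?f \<xi>' \<in> V" using X(3) by (auto simp: PiE_iff)
          then show "\<xi>' \<in> U" using V \<xi>' by blast
        qed
        then have "(\<Delta>, \<xi> \<inter> \<Delta>) \<in> I" using fin by (auto simp: I_def \<Delta>_def)
        moreover have "\<xi> \<in> ?C (\<Delta>, \<xi> \<inter> \<Delta>)" using \<xi> V by auto
        ultimately show "\<xi> \<in> (\<Union>p\<in>I. ?C p)" by blast
      qed
    qed
    moreover have "?C p \<in> ?S" if "p \<in> I" for p
      using that cylinder_in_sigma[of "fst p" E "snd p"] by (auto simp: I_def)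
    ultimately show "U \<in> ?S" using countable_UN'[of I ?C] by auto
  qed
  show ?thesis unfolding sets
    using sigma_sets_mono'[OF 1, of "Pow E"] sigma_sets_mono[OF 2] by blast
qed

lemma space_config_space: "space (config_space E) = Pow E"
proof -
  have "{U. openin (config_topology E) U} \<subseteq> Pow (Pow E)"
    by (auto simp: config_topology_def openin_pullback_topology)
  then show ?thesis unfolding config_space_def by (rule space_measure_of)
qed

lemma space_config_measure: "config_measure E \<nu> \<Longrightarrow> space \<nu> = Pow E"
  using sets_eq_imp_space_eq[of \<nu> "config_space E"] by (simp add: config_measure_def space_config_space)

lemma measurable_inclusion_event:
  assumes "countable E" "finite X" "X \<subseteq> E"
  shows "{\<xi>\<in>Pow E. X \<subseteq> \<xi>} \<in> sets (config_space E)"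
  unfolding sets_config_space[OF assms(1)]
  using assms by (intro sigma_sets.Basic) (auto simp: inclusion_events_def)

lemma measurable_cylinder:
  assumes "countable E" "finite \<Delta>" "\<Delta> \<subseteq> E"
  shows "{\<xi>\<in>Pow E. \<xi> \<inter> \<Delta> = \<eta>} \<in> sets (config_space E)"
  unfolding sets_config_space[OF assms(1)] using assms by (intro cylinder_in_sigma)

section \<open>Local observables, equality of measures, and extension of the DLR equations from a
  generator\<close>

lemma integral_local_fun:
  fixes F :: "'a set \<Rightarrow> real"
  assumes "countable E" "config_measure E \<nu>" "finite \<Delta>" "\<Delta> \<subseteq> E"
  shows "integrable \<nu> (\<lambda>\<xi>. F (\<xi> \<inter> \<Delta>))"
    and "(\<integral>\<xi>. F (\<xi> \<inter> \<Delta>) \<partial>\<nu>) = (\<Sum>\<sigma>\<in>Pow \<Delta>. F \<sigma> * measure \<nu> {\<xi>\<in>Pow E. \<xi> \<inter> \<Delta> = \<sigma>})"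
proof -
  interpret prob_space \<nu> using assms by (simp add: config_measure_def)
  let ?C = "\<lambda>\<sigma>. {\<xi>\<in>Pow E. \<xi> \<inter> \<Delta> = \<sigma>}"
  have C: "?C \<sigma> \<in> sets \<nu>" for \<sigma>
    using measurable_cylinder[OF assms(1,3,4)] assms(2) by (simp add: config_measure_def)
  have eq: "F (\<xi> \<inter> \<Delta>) = (\<Sum>\<sigma>\<in>Pow \<Delta>. F \<sigma> * indicator (?C \<sigma>) \<xi>)" if "\<xi> \<in> space \<nu>" for \<xi>
  proof -
    have "(\<Sum>\<sigma>\<in>Pow \<Delta>. F \<sigma> * indicator (?C \<sigma>) \<xi>) = (\<Sum>\<sigma>\<in>Pow \<Delta>. if \<xi> \<inter> \<Delta> = \<sigma> then F \<sigma> else 0)"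
      using that space_config_measure[OF assms(2)] by (intro sum.cong) (auto simp: indicator_def)
    then show ?thesis using assms(3) by simp
  qed
  have int: "integrable \<nu> (\<lambda>\<xi>. \<Sum>\<sigma>\<in>Pow \<Delta>. F \<sigma> * indicator (?C \<sigma>) \<xi>)"
    using C by (intro Bochner_Integration.integrable_sum integrable_mult_right integrable_real_indicator)
      (auto simp: emeasure_eq_measure)
  show "integrable \<nu> (\<lambda>\<xi>. F (\<xi> \<inter> \<Delta>))"
    using int by (subst Bochner_Integration.integrable_cong[OF refl eq]) auto
  have "(\<integral>\<xi>. F (\<xi> \<inter> \<Delta>) \<partial>\<nu>) = (\<integral>\<xi>. (\<Sum>\<sigma>\<in>Pow \<Delta>. F \<sigma> * indicator (?C \<sigma>) \<xi>) \<partial>\<nu>)"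
    by (rule Bochner_Integration.integral_cong[OF refl eq])
  also have "\<dots> = (\<Sum>\<sigma>\<in>Pow \<Delta>. \<integral>\<xi>. F \<sigma> * indicator (?C \<sigma>) \<xi> \<partial>\<nu>)"
    using C by (intro Bochner_Integration.integral_sum integrable_mult_right integrable_real_indicator)
      (auto simp: emeasure_eq_measure)
  also have "\<dots> = (\<Sum>\<sigma>\<in>Pow \<Delta>. F \<sigma> * measure \<nu> (?C \<sigma>))"
    using C by (intro sum.cong refl) (simp add: sets.Int_space_eq2)
  finally show "(\<integral>\<xi>. F (\<xi> \<inter> \<Delta>) \<partial>\<nu>) = (\<Sum>\<sigma>\<in>Pow \<Delta>. F \<sigma> * measure \<nu> (?C \<sigma>))" .
qed

lemma config_measure_eqI:
  assumes E: "countable E" and \<mu>: "config_measure E \<mu>" and \<nu>: "config_measure E \<nu>"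
    and eq: "\<And>X. finite X \<Longrightarrow> X \<subseteq> E \<Longrightarrow> measure \<mu> {\<xi>\<in>Pow E. X \<subseteq> \<xi>} = measure \<nu> {\<xi>\<in>Pow E. X \<subseteq> \<xi>}"
  shows "\<mu> = \<nu>"
proof (rule measure_eqI_generator_eq[OF Int_stable_inclusion_events inclusion_events_subset])
  interpret M: prob_space \<mu> using \<mu> by (simp add: config_measure_def)
  interpret N: prob_space \<nu> using \<nu> by (simp add: config_measure_def)
  show "sets \<mu> = sigma_sets (Pow E) (inclusion_events E)" "sets \<nu> = sigma_sets (Pow E) (inclusion_events E)"
    using \<mu> \<nu> sets_config_space[OF E] by (auto simp: config_measure_def)
  show "emeasure \<mu> X = emeasure \<nu> X" if "X \<in> inclusion_events E" for X
    using that eq unfolding inclusion_events_def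
    by (auto simp: M.emeasure_eq_measure N.emeasure_eq_measure)
  \<comment> \<open>The whole space is the inclusion event of the empty set, so a constant sequence
    exhausts it.\<close>
  show "range (\<lambda>_::nat. Pow E) \<subseteq> inclusion_events E"
    by (auto simp: inclusion_events_def intro!: image_eqI[of _ _ "{}"])
qed (auto simp: prob_space.emeasure_space_1 \<mu>[unfolded config_measure_def] finite_measure.emeasure_finite prob_space.finite_measure)

text \<open>Sites of \<open>X\<close> inside \<Lambda> are decided by \<zeta> alone, so the preimage
  of an inclusion event is the inclusion event of \<open>X - \<Lambda>\<close> or empty.\<close>

lemma measurable_replace:
  assumes "countable E" "finite \<Lambda>" "\<Lambda> \<subseteq> E" "\<zeta> \<subseteq> \<Lambda>"
  shows "(\<lambda>\<xi>. \<zeta> \<union> (\<xi> - \<Lambda>)) \<in> config_space E \<rightarrow>\<^sub>M config_space E"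
proof -
  have "(\<lambda>\<xi>. \<zeta> \<union> (\<xi> - \<Lambda>)) \<in> measurable (config_space E) (sigma (Pow E) (inclusion_events E))"
  proof (rule measurable_sigma_sets)
    show "sets (sigma (Pow E) (inclusion_events E)) = sigma_sets (Pow E) (inclusion_events E)"
      by (rule sets_measure_of[OF inclusion_events_subset])
    fix a assume "a \<in> inclusion_events E"
    then obtain X where X: "finite X" "X \<subseteq> E" "a = {\<xi>\<in>Pow E. X \<subseteq> \<xi>}"
      unfolding inclusion_events_def by blast
    have "(\<lambda>\<xi>. \<zeta> \<union> (\<xi> - \<Lambda>)) -` a \<inter> space (config_space E) =
        (if X \<inter> \<Lambda> \<subseteq> \<zeta> then {\<xi>\<in>Pow E. X - \<Lambda> \<subseteq> \<xi>} else {})"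
      using assms X by (auto simp: space_config_space)
    then show "(\<lambda>\<xi>. \<zeta> \<union> (\<xi> - \<Lambda>)) -` a \<inter> space (config_space E) \<in> sets (config_space E)"
      using measurable_inclusion_event[OF assms(1), of "X - \<Lambda>"] X by auto
  qed (use assms inclusion_events_subset[of E] in \<open>auto simp: space_config_space\<close>)
  then show ?thesis
    using measurable_cong_sets[OF refl, of "sigma (Pow E) (inclusion_events E)" "config_space E"]
      sets_config_space[OF assms(1)] sets_measure_of[OF inclusion_events_subset] by metis
qed

text \<open>Both sides are probability measures in \<open>G\<close>, so Dynkin's theorem applies:
  normalisation of the Gibbs weights handles complements, dominated convergence handles disjoint
  unions.\<close>

lemma dlr_from_inclusion_events:
  assumes E: "countable E" and \<nu>: "config_measure E \<nu>" and \<Lambda>: "finite \<Lambda>" "\<Lambda> \<subseteq> E"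
    and meas: "\<And>\<zeta>. \<zeta> \<subseteq> \<Lambda> \<Longrightarrow> gibbs_weight E V \<Lambda> \<zeta> \<in> borel_measurable \<nu>"
    and nonneg: "\<And>\<zeta> \<xi>. \<zeta> \<subseteq> \<Lambda> \<Longrightarrow> \<xi> \<subseteq> E \<Longrightarrow> 0 \<le> gibbs_weight E V \<Lambda> \<zeta> \<xi>"
    and sum1: "\<And>\<xi>. \<xi> \<subseteq> E \<Longrightarrow> (\<Sum>\<zeta>\<in>Pow \<Lambda>. gibbs_weight E V \<Lambda> \<zeta> \<xi>) = 1"
    and dlr: "\<And>X. finite X \<Longrightarrow> X \<subseteq> E \<Longrightarrow>
      measure \<nu> {\<xi>\<in>Pow E. X \<subseteq> \<xi>} = (\<integral>\<xi>. specification_kernel E V \<Lambda> {\<xi>\<in>Pow E. X \<subseteq> \<xi>} \<xi> \<partial>\<nu>)"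
    and G: "G \<in> sets (config_space E)"
  shows "integrable \<nu> (specification_kernel E V \<Lambda> G) \<and>
    measure \<nu> G = (\<integral>\<xi>. specification_kernel E V \<Lambda> G \<xi> \<partial>\<nu>)"
proof -
  let ?k = "specification_kernel E V \<Lambda>"
  interpret prob_space \<nu> using \<nu> by (simp add: config_measure_def)
  have sp: "space \<nu> = Pow E" by (rule space_config_measure[OF \<nu>])
  have se: "sets \<nu> = sets (config_space E)" using \<nu> by (simp add: config_measure_def)
  have bounds: "0 \<le> ?k G \<xi>" "?k G \<xi> \<le> 1" if "\<xi> \<subseteq> E" for G \<xi>
  proof -
    show "0 \<le> ?k G \<xi>" unfolding specification_kernel_def
      using nonneg that by (intro sum_nonneg mult_nonneg_nonneg) auto
    have "?k G \<xi> \<le> (\<Sum>\<zeta>\<in>Pow \<Lambda>. gibbs_weight E V \<Lambda> \<zeta> \<xi>)"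
      unfolding specification_kernel_def
      using nonneg that by (intro sum_mono mult_left_le) (auto simp: indicator_def)
    then show "?k G \<xi> \<le> 1" using sum1 that by simp
  qed
  have meas_k: "?k G \<in> borel_measurable \<nu>" if G: "G \<in> sets (config_space E)" for G
  proof -
    have "(\<lambda>\<xi>. gibbs_weight E V \<Lambda> \<zeta> \<xi> * indicator G (\<zeta> \<union> (\<xi> - \<Lambda>))) \<in> borel_measurable \<nu>"
      if \<zeta>: "\<zeta> \<subseteq> \<Lambda>" for \<zeta>
    proof (intro borel_measurable_times meas[OF \<zeta>])
      have "(\<lambda>\<xi>. \<zeta> \<union> (\<xi> - \<Lambda>)) \<in> \<nu> \<rightarrow>\<^sub>M config_space E"
        using measurable_replace[OF E \<Lambda> \<zeta>] measurable_cong_sets[OF se refl] by blast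
      then show "(\<lambda>\<xi>. indicator G (\<zeta> \<union> (\<xi> - \<Lambda>))) \<in> borel_measurable \<nu>"
        using G by (rule measurable_compose[OF _ borel_measurable_indicator])
    qed
    then show ?thesis
      unfolding specification_kernel_def[abs_def] by (intro borel_measurable_sum) auto
  qed
  have int: "integrable \<nu> (?k G)" if "G \<in> sets (config_space E)" for G
    using bounds sp by (intro integrable_const_bound[of _ 1] AE_I2 meas_k that) auto
  have "G \<in> sigma_sets (Pow E) (inclusion_events E)" using G sets_config_space[OF E] by simp
  with Int_stable_inclusion_events inclusion_events_subset
  have "measure \<nu> G = (\<integral>\<xi>. ?k G \<xi> \<partial>\<nu>)"
  proof (induction rule: sigma_sets_induct_disjoint)
    case (basic A)
    then show ?case using dlr unfolding inclusion_events_def by auto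
  next
    case empty
    then show ?case by (simp add: specification_kernel_def)
  next
    case (compl A)
    then have A: "A \<in> sets (config_space E)" using sets_config_space[OF E] by simp
    have "?k (Pow E - A) \<xi> = 1 - ?k A \<xi>" if "\<xi> \<in> space \<nu>" for \<xi>
    proof -
      have "indicator (Pow E - A) (\<zeta> \<union> (\<xi> - \<Lambda>)) = (1 :: real) - indicator A (\<zeta> \<union> (\<xi> - \<Lambda>))"
        if "\<zeta> \<in> Pow \<Lambda>" for \<zeta>
        using that \<open>\<xi> \<in> space \<nu>\<close> sp \<Lambda> by (auto simp: indicator_def)
      then have "?k (Pow E - A) \<xi> = (\<Sum>\<zeta>\<in>Pow \<Lambda>. gibbs_weight E V \<Lambda> \<zeta> \<xi>) - ?k A \<xi>"
        unfolding specification_kernel_def by (simp add: right_diff_distrib sum_subtractf)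
      then show ?thesis using sum1 that sp by simp
    qed
    then have "(\<integral>\<xi>. ?k (Pow E - A) \<xi> \<partial>\<nu>) = (\<integral>\<xi>. 1 - ?k A \<xi> \<partial>\<nu>)"
      by (intro Bochner_Integration.integral_cong) auto
    also have "\<dots> = 1 - measure \<nu> A"
      using int[OF A] compl.IH by (simp add: prob_space)
    also have "\<dots> = measure \<nu> (Pow E - A)"
      using prob_compl[of A] A se sp by simp
    finally show ?case by simp
  next
    case (union A)
    then have A: "range A \<subseteq> sets (config_space E)" using sets_config_space[OF E] by auto
    have UA: "(\<Union>i. A i) \<in> sets (config_space E)" using A by auto
    have ksums: "(\<lambda>n. \<Sum>i<n. ?k (A i) \<xi>) \<longlonglongrightarrow> ?k (\<Union>i. A i) \<xi>" for \<xi>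
    proof -
      have "(\<lambda>i. indicator (A i) \<omega>) sums (indicator (\<Union>i. A i) \<omega> :: real)" for \<omega>
        by (rule indicator_sums) (use union in \<open>auto simp: disjoint_family_on_def\<close>)
      then have "(\<lambda>i. ?k (A i) \<xi>) sums ?k (\<Union>i. A i) \<xi>"
        unfolding specification_kernel_def by (intro sums_sum sums_mult)
      then show ?thesis by (simp add: sums_def)
    qed
    have lim: "(\<lambda>n. \<integral>\<xi>. (\<Sum>i<n. ?k (A i) \<xi>) \<partial>\<nu>) \<longlonglongrightarrow> (\<integral>\<xi>. ?k (\<Union>i. A i) \<xi> \<partial>\<nu>)"
    proof (rule integral_dominated_convergence[where w = "\<lambda>_. 1"])
      show "?k (\<Union>i. A i) \<in> borel_measurable \<nu>" by (rule meas_k[OF UA])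
      show "(\<lambda>\<xi>. \<Sum>i<n. ?k (A i) \<xi>) \<in> borel_measurable \<nu>" for n
        using A by (intro borel_measurable_sum meas_k) auto
      \<comment> \<open>The partial sums increase to the kernel of the union, which is at most
        1.\<close>
      show "AE \<xi> in \<nu>. norm (\<Sum>i<n. ?k (A i) \<xi>) \<le> 1" for n
      proof (rule AE_I2)
        fix \<xi> assume \<xi>: "\<xi> \<in> space \<nu>"
        then have pos: "0 \<le> ?k (A i) \<xi>" for i using bounds sp by auto
        have "mono (\<lambda>n. \<Sum>i<n. ?k (A i) \<xi>)"
          using pos by (intro incseq_SucI) simp
        then have "(\<Sum>i<n. ?k (A i) \<xi>) \<le> ?k (\<Union>i. A i) \<xi>"
          by (rule incseq_le[OF _ ksums])
        also have "\<dots> \<le> 1" using bounds \<xi> sp by auto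
        finally show "norm (\<Sum>i<n. ?k (A i) \<xi>) \<le> 1" using pos by (simp add: sum_nonneg)
      qed
    qed (use ksums in auto)
    have "(\<integral>\<xi>. (\<Sum>i<n. ?k (A i) \<xi>) \<partial>\<nu>) = (\<Sum>i<n. measure \<nu> (A i))" for n
      using A union.IH int by (subst Bochner_Integration.integral_sum) auto
    then have "(\<lambda>n. \<Sum>i<n. measure \<nu> (A i)) \<longlonglongrightarrow> (\<integral>\<xi>. ?k (\<Union>i. A i) \<xi> \<partial>\<nu>)"
      using lim by simp
    moreover have "(\<lambda>n. \<Sum>i<n. measure \<nu> (A i)) \<longlonglongrightarrow> measure \<nu> (\<Union>i. A i)"
      using finite_measure_UNION[of A] A union se by (auto simp: sums_def)
    ultimately show ?case by (rule LIMSEQ_unique[symmetric])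
  qed
  then show ?thesis using int[OF G] by blast
qed

lemma sum_Pow_disjoint_union:
  assumes "finite A" "finite B" "A \<inter> B = {}"
  shows "(\<Sum>\<zeta>\<in>Pow A. \<Sum>\<sigma>\<in>Pow B. f (\<zeta> \<union> \<sigma>)) = (\<Sum>\<tau>\<in>Pow (A \<union> B). f \<tau>)"
  unfolding sum.cartesian_product
proof (rule sum.reindex_bij_witness[where i = "\<lambda>\<tau>. (\<tau> \<inter> A, \<tau> \<inter> B)" and j = "\<lambda>(\<zeta>, \<sigma>). \<zeta> \<union> \<sigma>"])
  fix p assume "p \<in> Pow A \<times> Pow B"
  then show "((case p of (\<zeta>, \<sigma>) \<Rightarrow> \<zeta> \<union> \<sigma>) \<inter> A, (case p of (\<zeta>, \<sigma>) \<Rightarrow> \<zeta> \<union> \<sigma>) \<inter> B) = p"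
    using assms(3) by auto
qed (use assms in auto)

section \<open>Ratios of finite volume probabilities with empty boundary condition\<close>

context functional_hilbert begin

lemma weight_insert:
  assumes "finite Y" "Y \<subseteq> E"
  shows "weight (insert x Y) = alpha x Y * weight Y"
  using det_insert_ratio[OF assms, of x "{}"] by (simp add: weight_def)

text \<open>Both events prescribe the configuration in \<Delta> and leave
  \<open>D - \<Delta>\<close> free. Their numerators are determinants whose index sets differ by
  \<open>x\<close>, so the quotient is a \<open>ratio\<close>.\<close>

lemma finite_prob_step:
  assumes D: "finite D" "D \<subseteq> E" and \<Delta>: "\<Delta> \<subseteq> D" "\<eta> \<subseteq> \<Delta>" "x \<in> \<Delta>" "x \<notin> \<eta>"
  shows "finite_prob D {} (insert x \<eta>) (\<Delta> - insert x \<eta>) =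
    ratio (D - \<Delta>) x (\<eta> \<union> (D - \<Delta>)) * finite_prob D {} \<eta> (\<Delta> - \<eta>)"
proof -
  have *: "D - \<eta> - (\<Delta> - \<eta>) = D - \<Delta>" "D - insert x \<eta> - (\<Delta> - insert x \<eta>) = D - \<Delta>" using \<Delta> by auto
  have "finite \<eta>" using \<Delta> D finite_subset by (metis order_trans)
  then have fin: "finite (\<eta> \<union> (D - \<Delta>))" "\<eta> \<union> (D - \<Delta>) \<subseteq> E" using D \<Delta> by auto
  have sub: "\<eta> \<subseteq> D" "\<Delta> - \<eta> \<subseteq> D - \<eta>" "insert x \<eta> \<subseteq> D" "\<Delta> - insert x \<eta> \<subseteq> D - insert x \<eta>"
    using \<Delta> by auto
  have "(\<Sum>\<zeta>\<in>{\<zeta>\<in>Pow D. \<eta> \<subseteq> \<zeta> \<and> (\<Delta> - \<eta>) \<inter> \<zeta> = {}}. weight (\<zeta> \<union> {})) =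
      Re (det_on (\<eta> \<union> (D - \<Delta>)) (add_diag kern (D - \<Delta>)))"
    using sum_weight_cylinder[OF D(1) finite.emptyI Int_empty_right sub(1,2)] unfolding * by simp
  moreover have "(\<Sum>\<zeta>\<in>{\<zeta>\<in>Pow D. insert x \<eta> \<subseteq> \<zeta> \<and> (\<Delta> - insert x \<eta>) \<inter> \<zeta> = {}}. weight (\<zeta> \<union> {})) =
      Re (det_on (insert x (\<eta> \<union> (D - \<Delta>))) (add_diag kern (D - \<Delta>)))"
    using sum_weight_cylinder[OF D(1) finite.emptyI Int_empty_right sub(3,4)] unfolding * by simp
  ultimately show ?thesis
    unfolding finite_prob_def using det_insert_ratio[OF fin, of x "D - \<Delta>"] by simp
qed

lemma finite_prob_nonneg:
  assumes "finite D" "D \<subseteq> E"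
  shows "0 \<le> finite_prob D {} X T"
proof -
  have "0 \<le> weight (\<zeta> \<union> {})" if "\<zeta> \<subseteq> D" for \<zeta>
    using that assms finite_subset[of \<zeta> D] less_imp_le[OF weight_pos[of \<zeta>]] by simp
  then show ?thesis unfolding finite_prob_def by (intro divide_nonneg_nonneg sum_nonneg) auto
qed

lemma finite_prob_insert:
  assumes "finite D"
  shows "finite_prob D \<eta> X (insert t T) = finite_prob D \<eta> X T - finite_prob D \<eta> (insert t X) T"
proof -
  let ?S = "\<lambda>X T. {\<zeta>\<in>Pow D. X \<subseteq> \<zeta> \<and> T \<inter> \<zeta> = {}}"
  have "?S X T = ?S X (insert t T) \<union> ?S (insert t X) T" by auto
  moreover have "?S X (insert t T) \<inter> ?S (insert t X) T = {}" by auto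
  ultimately have "(\<Sum>\<zeta>\<in>?S X T. weight (\<zeta> \<union> \<eta>)) =
     (\<Sum>\<zeta>\<in>?S X (insert t T). weight (\<zeta> \<union> \<eta>)) + (\<Sum>\<zeta>\<in>?S (insert t X) T. weight (\<zeta> \<union> \<eta>))"
    using assms by (subst sum.union_disjoint[symmetric]) auto
  then show ?thesis unfolding finite_prob_def by (simp add: diff_divide_distrib[symmetric])
qed

end

section \<open>Conditional probabilities of the determinantal process\<close>

locale determinantal_config = functional_hilbert +
  fixes \<mu> :: "'a set measure"
  assumes config: "config_measure E \<mu>"
    and correlation: "\<And>X. finite X \<Longrightarrow> X \<subseteq> E \<Longrightarrow>
      complex_of_real (measure \<mu> {\<xi>\<in>Pow E. X \<subseteq> \<xi>}) = det_on X K"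
begin

sublocale P: prob_space \<mu>
  using config by (simp add: config_measure_def)

definition cyl :: "'a set \<Rightarrow> 'a set \<Rightarrow> real" where
  "cyl \<Delta> \<eta> = measure \<mu> {\<xi>\<in>Pow E. \<xi> \<inter> \<Delta> = \<eta>}"

lemma sets_\<mu>: "sets \<mu> = sets (config_space E)"
  using config by (simp add: config_measure_def)

text \<open>Inclusion-exclusion, one vacant site at a time: the start is convergence to the
  correlation functions, and \<open>finite_prob_insert\<close> matches the difference rule for
  \<mu>.\<close>

lemma finite_prob_tendsto_measure:
  assumes "finite T" "T \<subseteq> E" "finite X" "X \<subseteq> E"
  shows "(\<lambda>n. finite_prob (exh n) {} X T) \<longlonglongrightarrow> measure \<mu> {\<xi>\<in>Pow E. X \<subseteq> \<xi> \<and> T \<inter> \<xi> = {}} \<and>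
    {\<xi>\<in>Pow E. X \<subseteq> \<xi> \<and> T \<inter> \<xi> = {}} \<in> sets \<mu>"
  using assms
proof (induction T arbitrary: X rule: finite_induct)
  case empty
  have "(\<lambda>n. complex_of_real (finite_prob (exh n) {} X {})) \<longlonglongrightarrow> complex_of_real (measure \<mu> {\<xi>\<in>Pow E. X \<subseteq> \<xi>})"
    using finite_prob_tendsto[of X "\<lambda>_. {}"] empty correlation by simp
  then show ?case
    using measurable_inclusion_event[OF countable_E] empty sets_\<mu> by (simp add: tendsto_of_real_iff)
next
  case (insert t T)
  let ?S = "\<lambda>X T. {\<xi>\<in>Pow E. X \<subseteq> \<xi> \<and> T \<inter> \<xi> = {}}"
  have 1: "(\<lambda>n. finite_prob (exh n) {} X T) \<longlonglongrightarrow> measure \<mu> (?S X T)" "?S X T \<in> sets \<mu>"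
    and 2: "(\<lambda>n. finite_prob (exh n) {} (insert t X) T) \<longlonglongrightarrow> measure \<mu> (?S (insert t X) T)"
      "?S (insert t X) T \<in> sets \<mu>"
    using insert.IH[of X] insert.IH[of "insert t X"] insert.prems by auto
  have eq: "?S X (insert t T) = ?S X T - ?S (insert t X) T" by auto
  have "measure \<mu> (?S X (insert t T)) = measure \<mu> (?S X T) - measure \<mu> (?S (insert t X) T)"
    unfolding eq using 1 2 by (intro P.finite_measure_Diff) auto
  moreover have "?S X (insert t T) \<in> sets \<mu>" unfolding eq using 1 2 by (intro sets.Diff)
  ultimately show ?case
    using tendsto_diff[OF 1(1) 2(1)] by (simp add: finite_prob_insert finite_exh)
qed

lemma finite_prob_tendsto_cyl:
  assumes "finite \<Delta>" "\<Delta> \<subseteq> E" "\<eta> \<subseteq> \<Delta>"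
  shows "(\<lambda>n. finite_prob (exh n) {} \<eta> (\<Delta> - \<eta>)) \<longlonglongrightarrow> cyl \<Delta> \<eta>"
proof -
  have "{\<xi>\<in>Pow E. \<xi> \<inter> \<Delta> = \<eta>} = {\<xi>\<in>Pow E. \<eta> \<subseteq> \<xi> \<and> (\<Delta> - \<eta>) \<inter> \<xi> = {}}" using assms by auto
  then show ?thesis
    unfolding cyl_def using finite_prob_tendsto_measure[of "\<Delta> - \<eta>" \<eta>] assms finite_subset[of \<eta> \<Delta>] by auto
qed

text \<open>In a volume \<open>exh n\<close> that contains \<Delta> the quotient of the two
  probabilities is a \<open>ratio\<close> with free sites \<open>S = exh n - \<Delta>\<close>;
  bounds uniform in \<open>S\<close> pass to the limit.\<close>

lemma cyl_insert_bounds: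
  assumes \<Delta>: "finite \<Delta>" "\<Delta> \<subseteq> E" "\<eta> \<subseteq> \<Delta>" "x \<in> \<Delta>" "x \<notin> \<eta>"
    and bnd: "\<And>S. finite S \<Longrightarrow> S \<subseteq> E - \<Delta> \<Longrightarrow> l \<le> ratio S x (\<eta> \<union> S) \<and> ratio S x (\<eta> \<union> S) \<le> u"
  shows "l * cyl \<Delta> \<eta> \<le> cyl \<Delta> (insert x \<eta>)" "cyl \<Delta> (insert x \<eta>) \<le> u * cyl \<Delta> \<eta>"
proof -
  let ?p = "\<lambda>n. finite_prob (exh n) {} \<eta> (\<Delta> - \<eta>)"
    and ?q = "\<lambda>n. finite_prob (exh n) {} (insert x \<eta>) (\<Delta> - insert x \<eta>)"
  have p: "?p \<longlonglongrightarrow> cyl \<Delta> \<eta>" and q: "?q \<longlonglongrightarrow> cyl \<Delta> (insert x \<eta>)"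
    using finite_prob_tendsto_cyl[of \<Delta>] \<Delta> by auto
  have ev: "\<forall>\<^sub>F n in sequentially. l * ?p n \<le> ?q n \<and> ?q n \<le> u * ?p n"
    using eventually_exh[OF \<Delta>(1,2)]
  proof eventually_elim
    case (elim n)
    let ?S = "exh n - \<Delta>"
    have "?q n = ratio ?S x (\<eta> \<union> ?S) * ?p n"
      using finite_exh exh_subset elim \<Delta> by (intro finite_prob_step)
    moreover have "l \<le> ratio ?S x (\<eta> \<union> ?S) \<and> ratio ?S x (\<eta> \<union> ?S) \<le> u"
      using finite_exh exh_subset by (intro bnd) auto
    moreover have "0 \<le> ?p n" using finite_exh exh_subset by (intro finite_prob_nonneg)
    ultimately show ?case by (simp add: mult_right_mono)
  qed
  show "l * cyl \<Delta> \<eta> \<le> cyl \<Delta> (insert x \<eta>)"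
    by (rule tendsto_le[OF sequentially_bot q tendsto_mult[OF tendsto_const p]])
       (use ev in \<open>auto elim: eventually_mono\<close>)
  show "cyl \<Delta> (insert x \<eta>) \<le> u * cyl \<Delta> \<eta>"
    by (rule tendsto_le[OF sequentially_bot tendsto_mult[OF tendsto_const p] q])
       (use ev in \<open>auto elim: eventually_mono\<close>)
qed

text \<open>The two-sided estimate of the overview: \<open>ratio_lower\<close> with the vector
  \<open>q\<close> loses only the Bessel tail off \<Delta>, and \<open>ratio_upper\<close> discards
  the free sites.\<close>

lemma cyl_insert_bounds_limit:
  assumes \<Delta>: "finite \<Delta>" "\<Delta> \<subseteq> E" "x \<in> \<Delta>" and \<xi>: "\<xi> \<subseteq> E" "x \<notin> \<xi>"
    and q: "q \<in> H" "\<And>y. y \<in> \<xi> \<Longrightarrow> ip (unit_fun y) q = 0" "ip (unit_fun x) q = of_real a" "nsq q \<le> a"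
    and tail: "\<And>S. finite S \<Longrightarrow> S \<subseteq> E - \<Delta> \<Longrightarrow> (\<Sum>z\<in>S. (cmod (ip (unit_fun z) q))\<^sup>2) \<le> e"
  shows "(a - e) * cyl \<Delta> (\<xi> \<inter> \<Delta>) \<le> cyl \<Delta> (insert x (\<xi> \<inter> \<Delta>))"
    "cyl \<Delta> (insert x (\<xi> \<inter> \<Delta>)) \<le> alpha x (\<xi> \<inter> \<Delta>) * cyl \<Delta> (\<xi> \<inter> \<Delta>)"
proof -
  have bnd: "a - e \<le> ratio S x (\<xi> \<inter> \<Delta> \<union> S) \<and> ratio S x (\<xi> \<inter> \<Delta> \<union> S) \<le> alpha x (\<xi> \<inter> \<Delta>)"
    if S: "finite S" "S \<subseteq> E - \<Delta>" for S
  proof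
    have fin: "finite (\<xi> \<inter> \<Delta> \<union> S)" "insert x (\<xi> \<inter> \<Delta> \<union> S) \<subseteq> E" "x \<notin> \<xi> \<inter> \<Delta> \<union> S" "x \<notin> S"
      using S \<Delta> \<xi> by auto
    have "a - (\<Sum>z\<in>S. (cmod (ip (unit_fun z) q))\<^sup>2) \<le> ratio S x (\<xi> \<inter> \<Delta> \<union> S)"
      by (rule ratio_lower[OF fin _ q(1) _ q(3,4)]) (use q(2) in auto)
    then show "a - e \<le> ratio S x (\<xi> \<inter> \<Delta> \<union> S)" using tail[OF S] by linarith
    show "ratio S x (\<xi> \<inter> \<Delta> \<union> S) \<le> alpha x (\<xi> \<inter> \<Delta>)"
      using S \<Delta> by (intro ratio_upper[OF fin(1-3)]) auto
  qed
  show "(a - e) * cyl \<Delta> (\<xi> \<inter> \<Delta>) \<le> cyl \<Delta> (insert x (\<xi> \<inter> \<Delta>))"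
    "cyl \<Delta> (insert x (\<xi> \<inter> \<Delta>)) \<le> alpha x (\<xi> \<inter> \<Delta>) * cyl \<Delta> (\<xi> \<inter> \<Delta>)"
    using \<Delta> \<xi> by (intro cyl_insert_bounds[OF \<Delta>(1,2) _ _ _ bnd]; auto)+
qed

lemma cyl_nonneg: "0 \<le> cyl \<Delta> \<eta>"
  by (simp add: cyl_def)

text \<open>The worst case, all other sites occupied, still leaves the positive lower bound
  \<open>?a\<close> on the ratio, so neither probability can vanish alone.\<close>

lemma cyl_insert_zero_iff:
  assumes \<Delta>: "finite \<Delta>" "\<Delta> \<subseteq> E" "\<eta> \<subseteq> \<Delta>" "x \<in> \<Delta>" "x \<notin> \<eta>"
  shows "cyl \<Delta> (insert x \<eta>) = 0 \<longleftrightarrow> cyl \<Delta> \<eta> = 0"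
proof -
  let ?a = "alpha_inf x (E - {x})"
  have x: "E - {x} \<subseteq> E" "x \<in> E" "x \<notin> E - {x}" using \<Delta> by auto
  obtain q where "0 < ?a" by (rule limit_vector[OF x])
  have bnd: "?a \<le> ratio S x (\<eta> \<union> S) \<and> ratio S x (\<eta> \<union> S) \<le> alpha x \<eta>"
    if S: "finite S" "S \<subseteq> E - \<Delta>" for S
  proof
    have fin: "finite (\<eta> \<union> S)" "insert x (\<eta> \<union> S) \<subseteq> E" "x \<notin> \<eta> \<union> S"
      using S \<Delta> finite_subset[of \<eta> \<Delta>] by auto
    have "?a \<le> alpha x (\<eta> \<union> S)" using fin by (intro alpha_inf_le[OF x]) auto
    also have "\<dots> \<le> ratio S x (\<eta> \<union> S)" by (rule alpha_le_ratio[OF fin])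
    finally show "?a \<le> ratio S x (\<eta> \<union> S)" .
    show "ratio S x (\<eta> \<union> S) \<le> alpha x \<eta>"
      using S \<Delta> by (intro ratio_upper[OF fin]) auto
  qed
  note b = cyl_insert_bounds[OF \<Delta> bnd]
  show ?thesis
  proof
    assume "cyl \<Delta> (insert x \<eta>) = 0"
    then have "?a * cyl \<Delta> \<eta> \<le> 0" using b(1) by simp
    then show "cyl \<Delta> \<eta> = 0"
      using \<open>0 < ?a\<close> cyl_nonneg[of \<Delta> \<eta>] by (simp add: mult_le_0_iff)
  next
    assume "cyl \<Delta> \<eta> = 0"
    then show "cyl \<Delta> (insert x \<eta>) = 0" using b(2) cyl_nonneg[of \<Delta> "insert x \<eta>"] by simp
  qed
qed

lemma sum_cyl:
  assumes "finite \<Delta>" "\<Delta> \<subseteq> E"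
  shows "(\<Sum>\<eta>\<in>Pow \<Delta>. cyl \<Delta> \<eta>) = 1"
  using integral_local_fun(2)[OF countable_E config assms, of "\<lambda>_. 1"] P.prob_space by (simp add: cyl_def)

text \<open>Adding sites one by one shows that all cylinders over \<Delta> vanish together or not at
  all; they sum to 1.\<close>

lemma cyl_pos:
  assumes "finite \<Delta>" "\<Delta> \<subseteq> E" "\<eta> \<subseteq> \<Delta>"
  shows "0 < cyl \<Delta> \<eta>"
proof -
  have iff: "cyl \<Delta> \<eta> = 0 \<longleftrightarrow> cyl \<Delta> {} = 0" if "\<eta> \<subseteq> \<Delta>" for \<eta>
    using finite_subset[OF that assms(1)] that
  proof (induction \<eta> rule: finite_induct)
    case (insert x \<eta>)
    then show ?case using cyl_insert_zero_iff[OF assms(1,2), of \<eta> x] by auto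
  qed simp
  have "cyl \<Delta> {} \<noteq> 0"
  proof
    assume "cyl \<Delta> {} = 0"
    then have "cyl \<Delta> \<eta> = 0" if "\<eta> \<in> Pow \<Delta>" for \<eta> using iff[of \<eta>] that by blast
    then have "(\<Sum>\<eta>\<in>Pow \<Delta>. cyl \<Delta> \<eta>) = 0" by (intro sum.neutral) blast
    then show False using sum_cyl[OF assms(1,2)] by simp
  qed
  then have "cyl \<Delta> \<eta> \<noteq> 0" using iff[OF assms(3)] by blast
  then show ?thesis using cyl_nonneg[of \<Delta> \<eta>] by linarith
qed

text \<open>Once the window contains \<open>x\<close> and the finite set from
  \<open>bessel_tail\<close>, the quotient lies between \<open>?a - e\<close> and a sequence tending
  to \<open>?a\<close>. This holds for every \<xi>, not merely almost every one.\<close>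

lemma cyl_ratio_tendsto:
  assumes \<xi>: "\<xi> \<subseteq> E" "x \<in> E" "x \<notin> \<xi>"
  shows "(\<lambda>n. cyl (exh n) (insert x (\<xi> \<inter> exh n)) / cyl (exh n) (\<xi> \<inter> exh n)) \<longlonglongrightarrow> alpha_inf x \<xi>"
proof -
  let ?a = "alpha_inf x \<xi>"
  let ?r = "\<lambda>n. cyl (exh n) (insert x (\<xi> \<inter> exh n)) / cyl (exh n) (\<xi> \<inter> exh n)"
  obtain q where q: "q \<in> H" "\<And>y. y \<in> \<xi> \<Longrightarrow> ip (unit_fun y) q = 0"
    "ip (unit_fun x) q = of_real ?a" "nsq q \<le> ?a"
    by (rule limit_vector[OF \<xi>]) (rule that)
  have lim: "(\<lambda>n. alpha x (\<xi> \<inter> exh n)) \<longlonglongrightarrow> ?a"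
    using tendsto_alpha[OF \<xi>] filterlim_exh by (rule filterlim_compose)
  have pos: "0 < cyl (exh n) (\<xi> \<inter> exh n)" for n
    by (rule cyl_pos[OF finite_exh exh_subset]) simp
  have ev: "\<forall>\<^sub>F n in sequentially. ?a - e \<le> ?r n \<and> ?r n \<le> alpha x (\<xi> \<inter> exh n)" if e: "0 < e" for e
  proof -
    obtain F where F: "finite F" "F \<subseteq> E"
      "\<And>S. finite S \<Longrightarrow> S \<subseteq> E - F \<Longrightarrow> (\<Sum>z\<in>S. (cmod (ip (unit_fun z) q))\<^sup>2) \<le> e"
      using bessel_tail[OF q(1) e] by blast
    have "\<forall>\<^sub>F n in sequentially. insert x F \<subseteq> exh n" using F \<xi> by (intro eventually_exh) auto
    then show ?thesis
    proof eventually_elim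
      case (elim n)
      then have x: "x \<in> exh n" by auto
      have tail: "(\<Sum>z\<in>S. (cmod (ip (unit_fun z) q))\<^sup>2) \<le> e" if "finite S" "S \<subseteq> E - exh n" for S
        using that elim by (intro F(3)) auto
      note b = cyl_insert_bounds_limit[OF finite_exh exh_subset x \<xi>(1,3) q tail]
      show ?case using b pos[of n] by (simp add: field_simps)
    qed
  qed
  show ?thesis
  proof (rule order_tendstoI)
    fix l assume "l < ?a"
    then have "0 < (?a - l) / 2" by simp
    from ev[OF this] show "\<forall>\<^sub>F n in sequentially. l < ?r n"
      by eventually_elim (use \<open>l < ?a\<close> in \<open>simp add: field_simps\<close>)
  next
    fix u assume "?a < u"
    then have "\<forall>\<^sub>F n in sequentially. alpha x (\<xi> \<inter> exh n) < u" by (rule order_tendstoD(2)[OF lim])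
    with ev[of 1] show "\<forall>\<^sub>F n in sequentially. ?r n < u"
      by (simp add: eventually_conj_iff) (auto elim: eventually_elim2)
  qed
qed

end

section \<open>Common limits of Boltzmann factors and of conditional probabilities\<close>

context functional_hilbert begin

text \<open>Both quotients are built site by site, and inserting \<open>x\<close> multiplies each
  limit by the same \<open>alpha_inf x (\<zeta> \<union> \<xi>)\<close>. One joint induction, with
  \<mu> quantified inside the existential, yields one \<open>a\<close> for both.\<close>

lemma weight_ratio_tendsto:
  assumes "finite \<zeta>" "\<zeta> \<subseteq> E" "\<xi> \<subseteq> E" "\<zeta> \<inter> \<xi> = {}"
  shows "\<exists>a>0. ((\<lambda>\<Delta>. weight (\<zeta> \<union> (\<xi> \<inter> \<Delta>)) / weight (\<xi> \<inter> \<Delta>)) \<longlongrightarrow> a) (finite_subsets_at_top E) \<and>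
    (\<forall>\<mu>. determinantal_config E H ip K \<mu> \<longrightarrow>
      (\<lambda>n. determinantal_config.cyl E \<mu> (exh n) (\<zeta> \<union> (\<xi> \<inter> exh n)) /
        determinantal_config.cyl E \<mu> (exh n) (\<xi> \<inter> exh n)) \<longlonglongrightarrow> a)"
  using assms
proof (induction \<zeta> rule: finite_induct)
  case empty
  have "\<forall>\<^sub>F \<Delta> in finite_subsets_at_top E. weight (\<xi> \<inter> \<Delta>) / weight (\<xi> \<inter> \<Delta>) = 1"
    unfolding eventually_finite_subsets_at_top
  proof (intro exI[of _ "{}"] conjI allI impI)
    fix \<Delta> assume "finite \<Delta> \<and> {} \<subseteq> \<Delta> \<and> \<Delta> \<subseteq> E"
    then have "0 < weight (\<xi> \<inter> \<Delta>)" by (intro weight_pos) auto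
    then show "weight (\<xi> \<inter> \<Delta>) / weight (\<xi> \<inter> \<Delta>) = 1" by simp
  qed auto
  then have 1: "((\<lambda>\<Delta>. weight (\<xi> \<inter> \<Delta>) / weight (\<xi> \<inter> \<Delta>)) \<longlongrightarrow> 1) (finite_subsets_at_top E)"
    by (rule tendsto_eventually)
  have 2: "(\<lambda>n. determinantal_config.cyl E \<mu> (exh n) (\<xi> \<inter> exh n) /
        determinantal_config.cyl E \<mu> (exh n) (\<xi> \<inter> exh n)) \<longlonglongrightarrow> 1"
    if "determinantal_config E H ip K \<mu>" for \<mu>
  proof -
    interpret determinantal_config E H ip K \<mu> by (rule that)
    have "0 < cyl (exh n) (\<xi> \<inter> exh n)" for n by (rule cyl_pos[OF finite_exh exh_subset]) simp
    then have "cyl (exh n) (\<xi> \<inter> exh n) / cyl (exh n) (\<xi> \<inter> exh n) = 1" for n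
      by (metis divide_self_if less_irrefl)
    then show ?thesis by simp
  qed
  show ?case using 1 2 by (intro exI[of _ 1]) simp
next
  case (insert x \<zeta>)
  then obtain a where a: "a > 0"
    "((\<lambda>\<Delta>. weight (\<zeta> \<union> (\<xi> \<inter> \<Delta>)) / weight (\<xi> \<inter> \<Delta>)) \<longlongrightarrow> a) (finite_subsets_at_top E)"
    "\<forall>\<mu>. determinantal_config E H ip K \<mu> \<longrightarrow>
      (\<lambda>n. determinantal_config.cyl E \<mu> (exh n) (\<zeta> \<union> (\<xi> \<inter> exh n)) /
        determinantal_config.cyl E \<mu> (exh n) (\<xi> \<inter> exh n)) \<longlonglongrightarrow> a"
    by auto
  have Y: "\<zeta> \<union> \<xi> \<subseteq> E" "x \<in> E" "x \<notin> \<zeta> \<union> \<xi>" using insert by auto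
  let ?b = "alpha_inf x (\<zeta> \<union> \<xi>)"
  obtain q where b: "0 < ?b" by (rule limit_vector[OF Y])
  have \<zeta>E: "\<zeta> \<subseteq> E" "finite \<zeta>" using insert by auto
  have "\<forall>\<^sub>F \<Delta> in finite_subsets_at_top E.
      alpha x ((\<zeta> \<union> \<xi>) \<inter> \<Delta>) * (weight (\<zeta> \<union> (\<xi> \<inter> \<Delta>)) / weight (\<xi> \<inter> \<Delta>)) =
      weight (insert x \<zeta> \<union> (\<xi> \<inter> \<Delta>)) / weight (\<xi> \<inter> \<Delta>)"
    unfolding eventually_finite_subsets_at_top
  \<comment> \<open>Once \<Delta> contains \<zeta>, cutting \<open>\<zeta> \<union> \<xi>\<close>
    down to \<Delta> affects only \<xi>.\<close>
  proof (intro exI[of _ \<zeta>] conjI allI impI \<zeta>E)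
    fix \<Delta> assume \<Delta>: "finite \<Delta> \<and> \<zeta> \<subseteq> \<Delta> \<and> \<Delta> \<subseteq> E"
    then have "(\<zeta> \<union> \<xi>) \<inter> \<Delta> = \<zeta> \<union> (\<xi> \<inter> \<Delta>)" by auto
    moreover have "weight (insert x (\<zeta> \<union> (\<xi> \<inter> \<Delta>))) = alpha x (\<zeta> \<union> (\<xi> \<inter> \<Delta>)) * weight (\<zeta> \<union> (\<xi> \<inter> \<Delta>))"
      using \<Delta> \<zeta>E by (intro weight_insert) auto
    ultimately show "alpha x ((\<zeta> \<union> \<xi>) \<inter> \<Delta>) * (weight (\<zeta> \<union> (\<xi> \<inter> \<Delta>)) / weight (\<xi> \<inter> \<Delta>)) =
      weight (insert x \<zeta> \<union> (\<xi> \<inter> \<Delta>)) / weight (\<xi> \<inter> \<Delta>)" by simp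
  qed
  then have 1: "((\<lambda>\<Delta>. weight (insert x \<zeta> \<union> (\<xi> \<inter> \<Delta>)) / weight (\<xi> \<inter> \<Delta>)) \<longlongrightarrow> ?b * a) (finite_subsets_at_top E)"
    by (rule Lim_transform_eventually[OF tendsto_mult[OF tendsto_alpha[OF Y] a(2)]])
  have 2: "(\<lambda>n. determinantal_config.cyl E \<mu> (exh n) (insert x \<zeta> \<union> (\<xi> \<inter> exh n)) /
        determinantal_config.cyl E \<mu> (exh n) (\<xi> \<inter> exh n)) \<longlonglongrightarrow> ?b * a"
    if \<mu>: "determinantal_config E H ip K \<mu>" for \<mu>
  proof -
    interpret determinantal_config E H ip K \<mu> by (rule \<mu>)
    have "\<forall>\<^sub>F n in sequentially.
       cyl (exh n) (insert x ((\<zeta> \<union> \<xi>) \<inter> exh n)) / cyl (exh n) ((\<zeta> \<union> \<xi>) \<inter> exh n) *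
         (cyl (exh n) (\<zeta> \<union> (\<xi> \<inter> exh n)) / cyl (exh n) (\<xi> \<inter> exh n)) =
       cyl (exh n) (insert x \<zeta> \<union> (\<xi> \<inter> exh n)) / cyl (exh n) (\<xi> \<inter> exh n)"
      using eventually_exh[OF \<zeta>E(2,1)]
    proof eventually_elim
      case (elim n)
      then have eq: "(\<zeta> \<union> \<xi>) \<inter> exh n = \<zeta> \<union> (\<xi> \<inter> exh n)" by auto
      have "0 < cyl (exh n) (\<zeta> \<union> (\<xi> \<inter> exh n))"
        using elim by (intro cyl_pos[OF finite_exh exh_subset]) auto
      then show ?case unfolding eq by simp
    qed
    moreover have "(\<lambda>n. cyl (exh n) (\<zeta> \<union> (\<xi> \<inter> exh n)) / cyl (exh n) (\<xi> \<inter> exh n)) \<longlonglongrightarrow> a"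
      using a(3) \<mu> by blast
    ultimately show ?thesis
      by (rule Lim_transform_eventually[OF tendsto_mult[OF cyl_ratio_tendsto[OF Y]], rotated])
  qed
  show ?case using a(1) b 1 2 by (intro exI[of _ "?b * a"]) simp
qed

end

section \<open>The DLR equations and uniqueness\<close>

context functional_hilbert begin

text \<open>\<open>V \<zeta>\<close> cancels against the mutual energy and leaves minus the
  logarithm of a quotient of weights with positive limit. So the Hamiltonian is a true limit, and
  its Boltzmann factors are the numbers \<open>a \<zeta>\<close> that also govern the cylinder
  probabilities of \<mu>.\<close>

lemma gibbs_weight_limits:
  assumes V: "\<And>X. finite X \<Longrightarrow> X \<subseteq> E \<Longrightarrow> V X = - ln (weight X)"
    and \<Lambda>: "finite \<Lambda>" "\<Lambda> \<subseteq> E" and \<xi>: "\<xi> \<subseteq> E"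
  shows "\<zeta> \<subseteq> \<Lambda> \<Longrightarrow> 0 < gibbs_weight E V \<Lambda> \<zeta> \<xi>"
    and "(\<Sum>\<zeta>\<in>Pow \<Lambda>. gibbs_weight E V \<Lambda> \<zeta> \<xi>) = 1"
    and "\<zeta> \<subseteq> \<Lambda> \<Longrightarrow> (\<lambda>n. weight (\<zeta> \<union> (\<xi> \<inter> (exh n - \<Lambda>))) /
      (\<Sum>\<zeta>'\<in>Pow \<Lambda>. weight (\<zeta>' \<union> (\<xi> \<inter> (exh n - \<Lambda>))))) \<longlonglongrightarrow> gibbs_weight E V \<Lambda> \<zeta> \<xi>"
    and "\<zeta> \<subseteq> \<Lambda> \<Longrightarrow> determinantal_config E H ip K \<mu> \<Longrightarrow>
      (\<lambda>n. determinantal_config.cyl E \<mu> (exh n) (\<zeta> \<union> (\<xi> \<inter> (exh n - \<Lambda>))) /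
      (\<Sum>\<zeta>'\<in>Pow \<Lambda>. determinantal_config.cyl E \<mu> (exh n) (\<zeta>' \<union> (\<xi> \<inter> (exh n - \<Lambda>)))))
      \<longlonglongrightarrow> gibbs_weight E V \<Lambda> \<zeta> \<xi>"
proof -
  let ?P = "\<lambda>\<zeta> a. a > 0 \<and>
    ((\<lambda>\<Delta>. weight (\<zeta> \<union> (\<xi> \<inter> (\<Delta> - \<Lambda>))) / weight (\<xi> \<inter> (\<Delta> - \<Lambda>))) \<longlongrightarrow> a) (finite_subsets_at_top E) \<and>
    (\<forall>\<mu>. determinantal_config E H ip K \<mu> \<longrightarrow>
      (\<lambda>n. determinantal_config.cyl E \<mu> (exh n) (\<zeta> \<union> (\<xi> \<inter> (exh n - \<Lambda>))) /
        determinantal_config.cyl E \<mu> (exh n) (\<xi> \<inter> (exh n - \<Lambda>))) \<longlonglongrightarrow> a)"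
  \<comment> \<open>\<open>weight_ratio_tendsto\<close> requires a boundary condition disjoint from
    \<zeta>; it is applied to \<open>\<xi> - \<Lambda>\<close>.\<close>
  have eq: "(\<xi> - \<Lambda>) \<inter> \<Delta> = \<xi> \<inter> (\<Delta> - \<Lambda>)" for \<Delta> by auto
  have "\<exists>a. ?P \<zeta> a" if "\<zeta> \<in> Pow \<Lambda>" for \<zeta>
  proof -
    have "finite \<zeta>" "\<zeta> \<subseteq> E" "\<xi> - \<Lambda> \<subseteq> E" "\<zeta> \<inter> (\<xi> - \<Lambda>) = {}"
      using that \<Lambda> \<xi> finite_subset[of \<zeta> \<Lambda>] by auto
    from weight_ratio_tendsto[OF this] show ?thesis unfolding eq .
  qed
  then have "\<exists>a. \<forall>\<zeta>\<in>Pow \<Lambda>. ?P \<zeta> (a \<zeta>)" by (intro bchoice ballI)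
  then obtain a where a: "\<And>\<zeta>. \<zeta> \<in> Pow \<Lambda> \<Longrightarrow> ?P \<zeta> (a \<zeta>)" by blast
  have fP: "finite (Pow \<Lambda>)" using \<Lambda> by simp
  have ham: "exp (- hamiltonian E V \<Lambda> \<zeta> \<xi>) = a \<zeta>" if \<zeta>: "\<zeta> \<in> Pow \<Lambda>" for \<zeta>
  proof -
    note a\<zeta> = a[OF \<zeta>]
    have "((\<lambda>\<Delta>. - ln (weight (\<zeta> \<union> (\<xi> \<inter> (\<Delta> - \<Lambda>))) / weight (\<xi> \<inter> (\<Delta> - \<Lambda>)))) \<longlongrightarrow> - ln (a \<zeta>)) (finite_subsets_at_top E)"
      using a\<zeta> by (intro tendsto_intros) auto
    moreover have "\<forall>\<^sub>F \<Delta> in finite_subsets_at_top E.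
        - ln (weight (\<zeta> \<union> (\<xi> \<inter> (\<Delta> - \<Lambda>))) / weight (\<xi> \<inter> (\<Delta> - \<Lambda>))) =
        V \<zeta> + mutual_energy V \<zeta> (\<xi> \<inter> (\<Delta> - \<Lambda>))"
      unfolding eventually_finite_subsets_at_top
    proof (intro exI[of _ "{}"] conjI allI impI)
      fix \<Delta> assume \<Delta>: "finite \<Delta> \<and> {} \<subseteq> \<Delta> \<and> \<Delta> \<subseteq> E"
      have f: "finite (\<xi> \<inter> (\<Delta> - \<Lambda>))" "\<xi> \<inter> (\<Delta> - \<Lambda>) \<subseteq> E" "finite (\<zeta> \<union> (\<xi> \<inter> (\<Delta> - \<Lambda>)))" "\<zeta> \<union> (\<xi> \<inter> (\<Delta> - \<Lambda>)) \<subseteq> E"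
        using \<Delta> \<zeta> \<Lambda> finite_subset[of \<zeta> \<Lambda>] by auto
      show "- ln (weight (\<zeta> \<union> (\<xi> \<inter> (\<Delta> - \<Lambda>))) / weight (\<xi> \<inter> (\<Delta> - \<Lambda>))) =
        V \<zeta> + mutual_energy V \<zeta> (\<xi> \<inter> (\<Delta> - \<Lambda>))"
        using weight_pos[OF f(1,2)] weight_pos[OF f(3,4)]
        by (simp add: mutual_energy_def V[OF f(1,2)] V[OF f(3,4)] ln_div)
    qed auto
    ultimately have "((\<lambda>\<Delta>. V \<zeta> + mutual_energy V \<zeta> (\<xi> \<inter> (\<Delta> - \<Lambda>))) \<longlongrightarrow> - ln (a \<zeta>)) (finite_subsets_at_top E)"
      by (rule Lim_transform_eventually)
    then have "hamiltonian E V \<Lambda> \<zeta> \<xi> = - ln (a \<zeta>)"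
      unfolding hamiltonian_def by (intro tendsto_Lim) auto
    then show ?thesis using a\<zeta> by simp
  qed
  define Z where "Z = (\<Sum>\<zeta>\<in>Pow \<Lambda>. a \<zeta>)"
  have "0 < Z" unfolding Z_def using a fP by (intro sum_pos) auto
  have gw: "gibbs_weight E V \<Lambda> \<zeta> \<xi> = a \<zeta> / Z" if "\<zeta> \<in> Pow \<Lambda>" for \<zeta>
  proof -
    have "partition_function E V \<Lambda> \<xi> = Z"
      unfolding partition_function_def Z_def by (intro sum.cong refl ham)
    then show ?thesis using ham[OF that] by (simp add: gibbs_weight_def)
  qed
  show "\<zeta> \<subseteq> \<Lambda> \<Longrightarrow> 0 < gibbs_weight E V \<Lambda> \<zeta> \<xi>" using gw a \<open>0 < Z\<close> by simp
  show "(\<Sum>\<zeta>\<in>Pow \<Lambda>. gibbs_weight E V \<Lambda> \<zeta> \<xi>) = 1"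
  proof -
    have "(\<Sum>\<zeta>\<in>Pow \<Lambda>. gibbs_weight E V \<Lambda> \<zeta> \<xi>) = (\<Sum>\<zeta>\<in>Pow \<Lambda>. a \<zeta> / Z)"
      by (intro sum.cong refl gw)
    then show ?thesis using \<open>0 < Z\<close> by (simp add: sum_divide_distrib[symmetric] Z_def[symmetric])
  qed
  \<comment> \<open>The reference value \<open>v n\<close>, that of the configuration empty in
    \<Lambda>, cancels between numerator and normalising sum. This serves weights and cylinder
    probabilities alike.\<close>
  have quot: "(\<lambda>n. w n \<zeta> / (\<Sum>\<zeta>'\<in>Pow \<Lambda>. w n \<zeta>')) \<longlonglongrightarrow> gibbs_weight E V \<Lambda> \<zeta> \<xi>"
    if \<zeta>: "\<zeta> \<subseteq> \<Lambda>" and w: "\<And>\<zeta>. \<zeta> \<in> Pow \<Lambda> \<Longrightarrow> (\<lambda>n. w n \<zeta> / v n) \<longlonglongrightarrow> a \<zeta>" and v: "\<And>n. v n \<noteq> 0"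
    for \<zeta> and w :: "nat \<Rightarrow> 'a set \<Rightarrow> real" and v
  proof -
    have "(\<lambda>n. (w n \<zeta> / v n) / (\<Sum>\<zeta>'\<in>Pow \<Lambda>. w n \<zeta>' / v n)) \<longlonglongrightarrow> a \<zeta> / Z"
      unfolding Z_def using \<zeta> w \<open>0 < Z\<close> by (intro tendsto_divide tendsto_sum) (auto simp: Z_def)
    moreover have "(w n \<zeta> / v n) / (\<Sum>\<zeta>'\<in>Pow \<Lambda>. w n \<zeta>' / v n) = w n \<zeta> / (\<Sum>\<zeta>'\<in>Pow \<Lambda>. w n \<zeta>')" for n
      using v[of n] by (simp add: sum_divide_distrib[symmetric])
    moreover have "gibbs_weight E V \<Lambda> \<zeta> \<xi> = a \<zeta> / Z" using \<zeta> by (intro gw) simp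
    ultimately show ?thesis by (simp only:)
  qed
  show "(\<lambda>n. weight (\<zeta> \<union> (\<xi> \<inter> (exh n - \<Lambda>))) /
      (\<Sum>\<zeta>'\<in>Pow \<Lambda>. weight (\<zeta>' \<union> (\<xi> \<inter> (exh n - \<Lambda>))))) \<longlonglongrightarrow> gibbs_weight E V \<Lambda> \<zeta> \<xi>" if "\<zeta> \<subseteq> \<Lambda>"
  proof (rule quot[OF that, of _ "\<lambda>n. weight (\<xi> \<inter> (exh n - \<Lambda>))"])
    show "(\<lambda>n. weight (\<zeta> \<union> (\<xi> \<inter> (exh n - \<Lambda>))) / weight (\<xi> \<inter> (exh n - \<Lambda>))) \<longlonglongrightarrow> a \<zeta>" if "\<zeta> \<in> Pow \<Lambda>" for \<zeta>
      using a[OF that] filterlim_compose[OF _ filterlim_exh] by blast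
    have "0 < weight (\<xi> \<inter> (exh n - \<Lambda>))" for n using \<xi> finite_exh by (intro weight_pos) auto
    then show "weight (\<xi> \<inter> (exh n - \<Lambda>)) \<noteq> 0" for n by (metis less_irrefl)
  qed
  show "(\<lambda>n. determinantal_config.cyl E \<mu> (exh n) (\<zeta> \<union> (\<xi> \<inter> (exh n - \<Lambda>))) /
      (\<Sum>\<zeta>'\<in>Pow \<Lambda>. determinantal_config.cyl E \<mu> (exh n) (\<zeta>' \<union> (\<xi> \<inter> (exh n - \<Lambda>)))))
      \<longlonglongrightarrow> gibbs_weight E V \<Lambda> \<zeta> \<xi>" if "\<zeta> \<subseteq> \<Lambda>" and \<mu>: "determinantal_config E H ip K \<mu>"
  proof -
    interpret determinantal_config E H ip K \<mu> by (rule \<mu>)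
    show ?thesis
    proof (rule quot[OF that(1), of _ "\<lambda>n. cyl (exh n) (\<xi> \<inter> (exh n - \<Lambda>))"])
      show "(\<lambda>n. cyl (exh n) (\<zeta> \<union> (\<xi> \<inter> (exh n - \<Lambda>))) / cyl (exh n) (\<xi> \<inter> (exh n - \<Lambda>))) \<longlonglongrightarrow> a \<zeta>"
        if "\<zeta> \<in> Pow \<Lambda>" for \<zeta>
        using a[OF that] \<mu> by blast
      have "0 < cyl (exh n) (\<xi> \<inter> (exh n - \<Lambda>))" for n by (rule cyl_pos[OF finite_exh exh_subset]) auto
      then show "cyl (exh n) (\<xi> \<inter> (exh n - \<Lambda>)) \<noteq> 0" for n by (metis less_irrefl)
    qed
  qed
qed

text \<open>The Gibbs weight is a pointwise limit of functions of finitely many sites.\<close>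

lemma gibbs_weight_measurable:
  assumes V: "\<And>X. finite X \<Longrightarrow> X \<subseteq> E \<Longrightarrow> V X = - ln (weight X)"
    and \<Lambda>: "finite \<Lambda>" "\<Lambda> \<subseteq> E" and \<zeta>: "\<zeta> \<subseteq> \<Lambda>" and \<nu>: "config_measure E \<nu>"
  shows "gibbs_weight E V \<Lambda> \<zeta> \<in> borel_measurable \<nu>"
proof (rule borel_measurable_LIMSEQ_real)
  let ?f = "\<lambda>n \<sigma>. weight (\<zeta> \<union> \<sigma>) / (\<Sum>\<zeta>'\<in>Pow \<Lambda>. weight (\<zeta>' \<union> \<sigma>))"
  show "(\<lambda>n. ?f n (\<xi> \<inter> (exh n - \<Lambda>))) \<longlonglongrightarrow> gibbs_weight E V \<Lambda> \<zeta> \<xi>" if "\<xi> \<in> space \<nu>" for \<xi>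
    using gibbs_weight_limits(3)[OF V \<Lambda> _ \<zeta>, of \<xi>] that space_config_measure[OF \<nu>] by simp
  show "(\<lambda>\<xi>. ?f n (\<xi> \<inter> (exh n - \<Lambda>))) \<in> borel_measurable \<nu>" for n
    using exh_subset finite_exh
    by (intro borel_measurable_integrable integral_local_fun(1)[OF countable_E \<nu>, of "exh n - \<Lambda>" "?f n"]) auto
qed

text \<open>The DLR equations in the volumes \<open>exh n\<close> express the correlation as the
  integral of \<open>?k n\<close>. These kernels tend to the same number for every configuration, so
  dominated convergence identifies it.\<close>

lemma gibbs_measure_correlation:
  assumes V: "\<And>X. finite X \<Longrightarrow> X \<subseteq> E \<Longrightarrow> V X = - ln (weight X)"
    and \<nu>: "gibbs_measure E V \<nu>" and X: "finite X" "X \<subseteq> E"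
  shows "complex_of_real (measure \<nu> {\<xi>\<in>Pow E. X \<subseteq> \<xi>}) = det_on X K"
proof -
  let ?G = "{\<xi>\<in>Pow E. X \<subseteq> \<xi>}"
  let ?k = "\<lambda>n. specification_kernel E V (exh n) ?G"
  have cm: "config_measure E \<nu>" using \<nu> by (simp add: gibbs_measure_def)
  interpret prob_space \<nu> using cm by (simp add: config_measure_def)
  note sp = space_config_measure[OF cm]
  have G: "?G \<in> sets (config_space E)" by (rule measurable_inclusion_event[OF countable_E X])
  have dlr: "integrable \<nu> (?k n)" "measure \<nu> ?G = (\<integral>\<xi>. ?k n \<xi> \<partial>\<nu>)" for n
    using \<nu> G finite_exh exh_subset unfolding gibbs_measure_def by blast+
  have bound: "norm (?k n \<xi>) \<le> 1" if "\<xi> \<subseteq> E" for n \<xi>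
  proof -
    note gl = gibbs_weight_limits[OF V finite_exh[of n] exh_subset[of n] that]
    have nonneg: "0 \<le> gibbs_weight E V (exh n) \<zeta> \<xi>" if "\<zeta> \<in> Pow (exh n)" for \<zeta>
      using gl(1)[of \<zeta>] that by simp
    have "0 \<le> ?k n \<xi>" unfolding specification_kernel_def
      by (intro sum_nonneg mult_nonneg_nonneg nonneg) auto
    moreover have "?k n \<xi> \<le> (\<Sum>\<zeta>\<in>Pow (exh n). gibbs_weight E V (exh n) \<zeta> \<xi>)"
      unfolding specification_kernel_def by (intro sum_mono mult_left_le nonneg) (auto simp: indicator_def)
    ultimately show ?thesis using gl(2) by simp
  qed
  have lim: "(\<lambda>n. ?k n \<xi>) \<longlonglongrightarrow> Re (det_on X K)" if \<xi>: "\<xi> \<subseteq> E" for \<xi>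
  proof -
    let ?p = "\<lambda>n m. finite_prob (exh n) (\<xi> \<inter> (exh m - exh n)) X {}"
    have inner: "?p n \<longlonglongrightarrow> ?k n \<xi>" if Xn: "X \<subseteq> exh n" for n
    proof -
      let ?Q = "{\<zeta>\<in>Pow (exh n). X \<subseteq> \<zeta> \<and> {} \<inter> \<zeta> = {}}"
      let ?w = "\<lambda>m \<zeta>. weight (\<zeta> \<union> (\<xi> \<inter> (exh m - exh n)))"
      have "(\<lambda>m. \<Sum>\<zeta>\<in>?Q. ?w m \<zeta> / (\<Sum>\<zeta>'\<in>Pow (exh n). ?w m \<zeta>')) \<longlonglongrightarrow> (\<Sum>\<zeta>\<in>?Q. gibbs_weight E V (exh n) \<zeta> \<xi>)"
        by (intro tendsto_sum gibbs_weight_limits(3)[OF V finite_exh exh_subset \<xi>]) auto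
      moreover have "(\<Sum>\<zeta>\<in>?Q. ?w m \<zeta> / (\<Sum>\<zeta>'\<in>Pow (exh n). ?w m \<zeta>')) =
          finite_prob (exh n) (\<xi> \<inter> (exh m - exh n)) X {}" for m
        by (simp add: finite_prob_def sum_divide_distrib)
      moreover have "?k n \<xi> = (\<Sum>\<zeta>\<in>?Q. gibbs_weight E V (exh n) \<zeta> \<xi>)"
      proof -
        have "?k n \<xi> = (\<Sum>\<zeta>\<in>Pow (exh n). if X \<subseteq> \<zeta> then gibbs_weight E V (exh n) \<zeta> \<xi> else 0)"
          unfolding specification_kernel_def
          using Xn \<xi> exh_subset[of n] by (intro sum.cong refl) (auto simp: indicator_def)
        also have "\<dots> = (\<Sum>\<zeta>\<in>?Q. gibbs_weight E V (exh n) \<zeta> \<xi>)"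
        proof -
          have "?Q = {\<zeta>\<in>Pow (exh n). X \<subseteq> \<zeta>}" by auto
          moreover have "finite (Pow (exh n))" using finite_exh by simp
          ultimately show ?thesis by (simp only: sum.inter_filter)
        qed
        finally show ?thesis .
      qed
      ultimately show ?thesis by simp
    qed
    \<comment> \<open>\<open>?k n\<close> sees the whole of \<xi> outside \<open>exh n\<close>,
      whereas \<open>finite_prob_tendsto\<close> takes finite boundary conditions. Truncating \<xi>
      to a large \<open>exh (m n)\<close> costs less than
      \<open>inverse (real (Suc n))\<close>.\<close>
    have "\<exists>m. X \<subseteq> exh n \<longrightarrow> \<bar>?p n m - ?k n \<xi>\<bar> < inverse (real (Suc n))" for n
    proof (cases "X \<subseteq> exh n")
      case True
      have "\<forall>\<^sub>F m in sequentially. dist (?p n m) (?k n \<xi>) < inverse (real (Suc n))"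
        by (rule tendstoD[OF inner[OF True]]) simp
      then obtain m where "dist (?p n m) (?k n \<xi>) < inverse (real (Suc n))"
        by (auto simp: eventually_sequentially)
      then show ?thesis by (auto simp: dist_real_def)
    qed simp
    then obtain m where m: "\<And>n. X \<subseteq> exh n \<Longrightarrow> \<bar>?p n (m n) - ?k n \<xi>\<bar> < inverse (real (Suc n))"
      by metis
    have "(\<lambda>n. complex_of_real (?p n (m n))) \<longlonglongrightarrow> det_on X K"
      using \<xi> finite_exh by (intro finite_prob_tendsto[OF X]) auto
    then have "(\<lambda>n. Re (complex_of_real (?p n (m n)))) \<longlonglongrightarrow> Re (det_on X K)" by (rule tendsto_Re)
    then have p: "(\<lambda>n. ?p n (m n)) \<longlonglongrightarrow> Re (det_on X K)" by simp
    have "(\<lambda>n. ?k n \<xi> - ?p n (m n)) \<longlonglongrightarrow> 0"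
    proof (rule Lim_null_comparison[OF _ LIMSEQ_inverse_real_of_nat])
      show "\<forall>\<^sub>F n in sequentially. norm (?k n \<xi> - ?p n (m n)) \<le> inverse (real (Suc n))"
        using eventually_exh[OF X] by eventually_elim (use m in \<open>auto simp: abs_minus_commute intro!: less_imp_le\<close>)
    qed
    from tendsto_add[OF this p] show ?thesis by simp
  qed
  have "(\<lambda>n. \<integral>\<xi>. ?k n \<xi> \<partial>\<nu>) \<longlonglongrightarrow> (\<integral>\<xi>. Re (det_on X K) \<partial>\<nu>)"
  proof (rule integral_dominated_convergence[where w = "\<lambda>_. 1"])
    show "AE \<xi> in \<nu>. (\<lambda>n. ?k n \<xi>) \<longlonglongrightarrow> Re (det_on X K)" using lim sp by (intro AE_I2) auto
    show "AE \<xi> in \<nu>. norm (?k n \<xi>) \<le> 1" for n using bound sp by (intro AE_I2) auto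
    show "?k n \<in> borel_measurable \<nu>" for n using dlr(1) by (rule borel_measurable_integrable)
  qed auto
  then have "measure \<nu> ?G = Re (det_on X K)"
    using dlr(2) by (simp add: prob_space LIMSEQ_const_iff)
  \<comment> \<open>The locale says nothing about symmetry of \<open>K\<close>; the determinant is
    real as a limit of real probabilities.\<close>
  moreover have "det_on X K \<in> \<real>"
  proof -
    have "(\<lambda>n. complex_of_real (finite_prob (exh n) {} X {})) \<longlonglongrightarrow> det_on X K"
      using finite_prob_tendsto[OF X, of "\<lambda>_. {}"] by simp
    then show ?thesis by (rule Lim_in_closed_set[OF closed_complex_Reals, rotated 2]) auto
  qed
  ultimately show ?thesis by (simp add: complex_is_Real_iff complex_eq_iff)
qed

end

section \<open>The DLR equations for the determinantal process\<close>

context determinantal_config begin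

lemma measure_local:
  assumes "finite D" "D \<subseteq> E"
  shows "measure \<mu> {\<xi>\<in>Pow E. Q (\<xi> \<inter> D)} = (\<Sum>\<tau>\<in>Pow D. if Q \<tau> then cyl D \<tau> else 0)"
proof -
  let ?F = "\<lambda>\<tau>. if Q \<tau> then 1 else 0 :: real"
  have "(\<integral>\<xi>. ?F (\<xi> \<inter> D) \<partial>\<mu>) = (\<integral>\<xi>. indicator {\<xi>\<in>Pow E. Q (\<xi> \<inter> D)} \<xi> \<partial>\<mu>)"
    using space_config_measure[OF config] by (intro Bochner_Integration.integral_cong) (auto simp: indicator_def)
  also have "\<dots> = measure \<mu> ({\<xi>\<in>Pow E. Q (\<xi> \<inter> D)} \<inter> space \<mu>)" by simp
  also have "{\<xi>\<in>Pow E. Q (\<xi> \<inter> D)} \<inter> space \<mu> = {\<xi>\<in>Pow E. Q (\<xi> \<inter> D)}"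
    using space_config_measure[OF config] by auto
  finally have "measure \<mu> {\<xi>\<in>Pow E. Q (\<xi> \<inter> D)} = (\<integral>\<xi>. ?F (\<xi> \<inter> D) \<partial>\<mu>)" ..
  also have "\<dots> = (\<Sum>\<tau>\<in>Pow D. ?F \<tau> * cyl D \<tau>)"
    unfolding cyl_def by (rule integral_local_fun(2)[OF countable_E config assms])
  also have "\<dots> = (\<Sum>\<tau>\<in>Pow D. if Q \<tau> then cyl D \<tau> else 0)" by (intro sum.cong) auto
  finally show ?thesis .
qed

lemma cyl_marginal:
  assumes "finite D" "D \<subseteq> E" "\<Lambda> \<subseteq> D" "\<sigma> \<subseteq> D - \<Lambda>"
  shows "cyl (D - \<Lambda>) \<sigma> = (\<Sum>\<zeta>\<in>Pow \<Lambda>. cyl D (\<zeta> \<union> \<sigma>))"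
proof -
  have fin: "finite \<Lambda>" "finite (D - \<Lambda>)" "\<Lambda> \<inter> (D - \<Lambda>) = {}" "\<Lambda> \<union> (D - \<Lambda>) = D"
    using assms finite_subset by auto
  have "\<xi> \<inter> D \<inter> (D - \<Lambda>) = \<xi> \<inter> (D - \<Lambda>)" for \<xi> by auto
  then have "cyl (D - \<Lambda>) \<sigma> = (\<Sum>\<tau>\<in>Pow D. if \<tau> \<inter> (D - \<Lambda>) = \<sigma> then cyl D \<tau> else 0)"
    using measure_local[OF assms(1,2), of "\<lambda>\<tau>. \<tau> \<inter> (D - \<Lambda>) = \<sigma>"] by (simp add: cyl_def)
  also have "\<dots> = (\<Sum>\<zeta>\<in>Pow \<Lambda>. \<Sum>\<sigma>'\<in>Pow (D - \<Lambda>).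
      if (\<zeta> \<union> \<sigma>') \<inter> (D - \<Lambda>) = \<sigma> then cyl D (\<zeta> \<union> \<sigma>') else 0)"
    by (subst sum_Pow_disjoint_union[OF fin(1-3)]) (simp only: fin(4))
  also have "\<dots> = (\<Sum>\<zeta>\<in>Pow \<Lambda>. \<Sum>\<sigma>'\<in>Pow (D - \<Lambda>). if \<sigma>' = \<sigma> then cyl D (\<zeta> \<union> \<sigma>') else 0)"
  proof (intro sum.cong refl)
    fix \<zeta> \<sigma>' assume "\<zeta> \<in> Pow \<Lambda>" "\<sigma>' \<in> Pow (D - \<Lambda>)"
    then have "(\<zeta> \<union> \<sigma>') \<inter> (D - \<Lambda>) = \<sigma>'" by auto
    then show "(if (\<zeta> \<union> \<sigma>') \<inter> (D - \<Lambda>) = \<sigma> then cyl D (\<zeta> \<union> \<sigma>') else 0) =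
      (if \<sigma>' = \<sigma> then cyl D (\<zeta> \<union> \<sigma>') else 0)" by simp
  qed
  also have "\<dots> = (\<Sum>\<zeta>\<in>Pow \<Lambda>. cyl D (\<zeta> \<union> \<sigma>))"
    using fin assms(4) by simp
  finally show ?thesis .
qed

text \<open>Conditioning on the finite window \<open>D n - \<Lambda>\<close> gives the identity
  exactly for each \<open>n\<close>. The conditional probabilities are bounded by 1 and tend to the
  specification kernel everywhere, so the identity passes to the limit.\<close>

lemma dlr_inclusion_event:
  assumes V: "\<And>X. finite X \<Longrightarrow> X \<subseteq> E \<Longrightarrow> V X = - ln (weight X)"
    and \<Lambda>: "finite \<Lambda>" "\<Lambda> \<subseteq> E" and X: "finite X" "X \<subseteq> E"
  shows "measure \<mu> {\<xi>\<in>Pow E. X \<subseteq> \<xi>} = (\<integral>\<xi>. specification_kernel E V \<Lambda> {\<xi>\<in>Pow E. X \<subseteq> \<xi>} \<xi> \<partial>\<mu>)"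
proof -
  let ?G = "{\<xi>\<in>Pow E. X \<subseteq> \<xi>}"
  obtain N where N: "X \<union> \<Lambda> \<subseteq> exh N" using exh_covers[of "X \<union> \<Lambda>"] X \<Lambda> by auto
  define D where "D n = exh (n + N)" for n
  have D: "finite (D n)" "D n \<subseteq> E" "X \<subseteq> D n" "\<Lambda> \<subseteq> D n" for n
    using N exh_mono[of N "n + N"] finite_exh exh_subset unfolding D_def by auto
  have T: "finite (D n - \<Lambda>)" "D n - \<Lambda> \<subseteq> E" for n using D by auto
  \<comment> \<open>\<open>F n \<zeta> \<sigma>\<close> is the conditional probability of \<zeta> in
    \<Lambda> given \<sigma> in \<open>D n - \<Lambda>\<close>, and \<open>g n\<close> the resulting
    conditional probability of \<open>?G\<close>.\<close>
  define F where "F n \<zeta> \<sigma> = cyl (D n) (\<zeta> \<union> \<sigma>) / (\<Sum>\<zeta>'\<in>Pow \<Lambda>. cyl (D n) (\<zeta>' \<union> \<sigma>))" for n \<zeta> \<sigma>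
  define g where "g n \<sigma> = (\<Sum>\<zeta>\<in>Pow \<Lambda>. F n \<zeta> \<sigma> * (if X \<subseteq> \<zeta> \<union> \<sigma> then 1 else 0))" for n \<sigma>
  note sp = space_config_measure[OF config]
  have pos: "0 < (\<Sum>\<zeta>'\<in>Pow \<Lambda>. cyl (D n) (\<zeta>' \<union> \<sigma>))" if "\<sigma> \<subseteq> D n - \<Lambda>" for n \<sigma>
    using \<Lambda> that D[of n] by (intro sum_pos cyl_pos) auto
  have Fnonneg: "0 \<le> F n \<zeta> \<sigma>" for n \<zeta> \<sigma>
    unfolding F_def by (intro divide_nonneg_nonneg sum_nonneg cyl_nonneg)
  have gbound: "norm (g n \<sigma>) \<le> 1" if "\<sigma> \<subseteq> D n - \<Lambda>" for n \<sigma>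
  proof -
    have "g n \<sigma> \<le> (\<Sum>\<zeta>\<in>Pow \<Lambda>. F n \<zeta> \<sigma>)"
      unfolding g_def by (intro sum_mono mult_left_le Fnonneg) auto
    also have "\<dots> = 1"
      unfolding F_def sum_divide_distrib[symmetric] using pos[OF that] by simp
    finally show ?thesis
      unfolding g_def using Fnonneg by (simp add: sum_nonneg)
  qed
  have lim: "(\<lambda>n. g n (\<xi> \<inter> (D n - \<Lambda>))) \<longlonglongrightarrow> specification_kernel E V \<Lambda> ?G \<xi>" if \<xi>: "\<xi> \<subseteq> E" for \<xi>
  proof -
    have "(\<lambda>n. F n \<zeta> (\<xi> \<inter> (D n - \<Lambda>))) \<longlonglongrightarrow> gibbs_weight E V \<Lambda> \<zeta> \<xi>" if "\<zeta> \<in> Pow \<Lambda>" for \<zeta>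
      unfolding F_def D_def
      using gibbs_weight_limits(4)[OF V \<Lambda> \<xi> _ determinantal_config_axioms, of \<zeta>] that
      by (intro LIMSEQ_ignore_initial_segment) auto
    then have lim: "(\<lambda>n. \<Sum>\<zeta>\<in>Pow \<Lambda>. F n \<zeta> (\<xi> \<inter> (D n - \<Lambda>)) * indicator ?G (\<zeta> \<union> (\<xi> - \<Lambda>)))
        \<longlonglongrightarrow> specification_kernel E V \<Lambda> ?G \<xi>"
      unfolding specification_kernel_def by (intro tendsto_sum tendsto_mult tendsto_const)
    have ind: "(if X \<subseteq> \<zeta> \<union> (\<xi> \<inter> (D n - \<Lambda>)) then 1 else 0) = (indicator ?G (\<zeta> \<union> (\<xi> - \<Lambda>)) :: real)"
      if "\<zeta> \<in> Pow \<Lambda>" for \<zeta> n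
      using that D[of n] \<Lambda> \<xi> by (auto simp: indicator_def)
    have "g n (\<xi> \<inter> (D n - \<Lambda>)) =
        (\<Sum>\<zeta>\<in>Pow \<Lambda>. F n \<zeta> (\<xi> \<inter> (D n - \<Lambda>)) * indicator ?G (\<zeta> \<union> (\<xi> - \<Lambda>)))" for n
      unfolding g_def by (intro sum.cong refl arg_cong2[where f = "(*)"] ind)
    with lim show ?thesis by simp
  qed
  have int: "(\<integral>\<xi>. g n (\<xi> \<inter> (D n - \<Lambda>)) \<partial>\<mu>) = measure \<mu> ?G" for n
  proof -
    have "(\<integral>\<xi>. g n (\<xi> \<inter> (D n - \<Lambda>)) \<partial>\<mu>) = (\<Sum>\<sigma>\<in>Pow (D n - \<Lambda>). g n \<sigma> * cyl (D n - \<Lambda>) \<sigma>)"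
      unfolding cyl_def by (rule integral_local_fun(2)[OF countable_E config T])
    also have "\<dots> = (\<Sum>\<sigma>\<in>Pow (D n - \<Lambda>). \<Sum>\<zeta>\<in>Pow \<Lambda>. if X \<subseteq> \<zeta> \<union> \<sigma> then cyl (D n) (\<zeta> \<union> \<sigma>) else 0)"
    proof (intro sum.cong refl)
      fix \<sigma> assume "\<sigma> \<in> Pow (D n - \<Lambda>)"
      then have \<sigma>: "\<sigma> \<subseteq> D n - \<Lambda>" by simp
      have "F n \<zeta> \<sigma> * (\<Sum>\<zeta>'\<in>Pow \<Lambda>. cyl (D n) (\<zeta>' \<union> \<sigma>)) = cyl (D n) (\<zeta> \<union> \<sigma>)" for \<zeta>
        unfolding F_def using pos[OF \<sigma>] by simp
      then have *: "F n \<zeta> \<sigma> * cyl (D n - \<Lambda>) \<sigma> = cyl (D n) (\<zeta> \<union> \<sigma>)" for \<zeta>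
        unfolding cyl_marginal[OF D(1,2,4) \<sigma>] .
      have "g n \<sigma> * cyl (D n - \<Lambda>) \<sigma> =
          (\<Sum>\<zeta>\<in>Pow \<Lambda>. (F n \<zeta> \<sigma> * cyl (D n - \<Lambda>) \<sigma>) * (if X \<subseteq> \<zeta> \<union> \<sigma> then 1 else 0))"
        unfolding g_def sum_distrib_right by (intro sum.cong) auto
      then show "g n \<sigma> * cyl (D n - \<Lambda>) \<sigma> = (\<Sum>\<zeta>\<in>Pow \<Lambda>. if X \<subseteq> \<zeta> \<union> \<sigma> then cyl (D n) (\<zeta> \<union> \<sigma>) else 0)"
        unfolding * by (simp add: if_distrib cong: if_cong)
    qed
    also have "\<dots> = (\<Sum>\<zeta>\<in>Pow \<Lambda>. \<Sum>\<sigma>\<in>Pow (D n - \<Lambda>). if X \<subseteq> \<zeta> \<union> \<sigma> then cyl (D n) (\<zeta> \<union> \<sigma>) else 0)"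
      by (rule sum.swap)
    also have "\<dots> = (\<Sum>\<tau>\<in>Pow (\<Lambda> \<union> (D n - \<Lambda>)). if X \<subseteq> \<tau> then cyl (D n) \<tau> else 0)"
      using \<Lambda> T by (intro sum_Pow_disjoint_union) auto
    also have "\<Lambda> \<union> (D n - \<Lambda>) = D n" using D(4) by auto
    also have "(\<Sum>\<tau>\<in>Pow (D n). if X \<subseteq> \<tau> then cyl (D n) \<tau> else 0) = measure \<mu> {\<xi>\<in>Pow E. X \<subseteq> \<xi> \<inter> D n}"
      by (rule measure_local[OF D(1,2), symmetric])
    also have "{\<xi>\<in>Pow E. X \<subseteq> \<xi> \<inter> D n} = ?G" using D(3) by auto
    finally show ?thesis .
  qed
  have "(\<lambda>n. \<integral>\<xi>. g n (\<xi> \<inter> (D n - \<Lambda>)) \<partial>\<mu>) \<longlonglongrightarrow> (\<integral>\<xi>. specification_kernel E V \<Lambda> ?G \<xi> \<partial>\<mu>)"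
  proof (rule integral_dominated_convergence[where w = "\<lambda>_. 1"])
    show m: "(\<lambda>\<xi>. g n (\<xi> \<inter> (D n - \<Lambda>))) \<in> borel_measurable \<mu>" for n
      by (intro borel_measurable_integrable integral_local_fun(1)[OF countable_E config T])
    show "specification_kernel E V \<Lambda> ?G \<in> borel_measurable \<mu>"
      by (rule borel_measurable_LIMSEQ_real[OF _ m]) (use lim sp in auto)
    show "AE \<xi> in \<mu>. (\<lambda>n. g n (\<xi> \<inter> (D n - \<Lambda>))) \<longlonglongrightarrow> specification_kernel E V \<Lambda> ?G \<xi>"
      using lim sp by (intro AE_I2) auto
    show "AE \<xi> in \<mu>. norm (g n (\<xi> \<inter> (D n - \<Lambda>))) \<le> 1" for n
      by (intro AE_I2 gbound) auto
  qed auto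
  then show ?thesis unfolding int by (simp add: LIMSEQ_const_iff)
qed

text \<open>A Gibbs measure has the correlation functions of \<mu>, and these determine a measure on
  configurations.\<close>

lemma gibbs_measure_unique:
  assumes V: "\<And>X. finite X \<Longrightarrow> X \<subseteq> E \<Longrightarrow> V X = - ln (weight X)"
  shows "gibbs_measure E V \<mu>" and "gibbs_measure E V \<nu> \<Longrightarrow> \<nu> = \<mu>"
proof -
  show "gibbs_measure E V \<mu>"
    unfolding gibbs_measure_def
  proof (intro conjI allI impI ballI config)
    fix \<Lambda> G assume "finite \<Lambda> \<and> \<Lambda> \<subseteq> E" and G: "G \<in> sets (config_space E)"
    then have \<Lambda>: "finite \<Lambda>" "\<Lambda> \<subseteq> E" by auto
    have "integrable \<mu> (specification_kernel E V \<Lambda> G) \<and>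
        measure \<mu> G = (\<integral>\<xi>. specification_kernel E V \<Lambda> G \<xi> \<partial>\<mu>)"
    proof (rule dlr_from_inclusion_events[OF countable_E config \<Lambda> _ _ _ _ G])
      show "gibbs_weight E V \<Lambda> \<zeta> \<in> borel_measurable \<mu>" if "\<zeta> \<subseteq> \<Lambda>" for \<zeta>
        by (rule gibbs_weight_measurable[OF V \<Lambda> that config])
      show "0 \<le> gibbs_weight E V \<Lambda> \<zeta> \<xi>" if "\<zeta> \<subseteq> \<Lambda>" "\<xi> \<subseteq> E" for \<zeta> \<xi>
        using gibbs_weight_limits(1)[OF V \<Lambda> that(2,1)] by simp
      show "(\<Sum>\<zeta>\<in>Pow \<Lambda>. gibbs_weight E V \<Lambda> \<zeta> \<xi>) = 1" if "\<xi> \<subseteq> E" for \<xi>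
        by (rule gibbs_weight_limits(2)[OF V \<Lambda> that])
      show "measure \<mu> {\<xi>\<in>Pow E. X \<subseteq> \<xi>} = (\<integral>\<xi>. specification_kernel E V \<Lambda> {\<xi>\<in>Pow E. X \<subseteq> \<xi>} \<xi> \<partial>\<mu>)"
        if "finite X" "X \<subseteq> E" for X
        by (rule dlr_inclusion_event[OF V \<Lambda> that])
    qed
    then show "integrable \<mu> (specification_kernel E V \<Lambda> G)"
      "measure \<mu> G = (\<integral>\<xi>. specification_kernel E V \<Lambda> G \<xi> \<partial>\<mu>)" by auto
  qed
  assume \<nu>: "gibbs_measure E V \<nu>"
  show "\<nu> = \<mu>"
  proof (rule config_measure_eqI[OF countable_E _ config])
    show "config_measure E \<nu>" using \<nu> by (simp add: gibbs_measure_def)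
    show "measure \<nu> {\<xi>\<in>Pow E. X \<subseteq> \<xi>} = measure \<mu> {\<xi>\<in>Pow E. X \<subseteq> \<xi>}" if "finite X" "X \<subseteq> E" for X
      using gibbs_measure_correlation[OF V \<nu> that] correlation[OF that] by (metis of_real_eq_iff)
  qed
qed

end

section \<open>Square-summable functions and the functional completion\<close>

lemma l2_finite_support:
  assumes "finite F" "F \<subseteq> E" "\<And>x. x \<notin> F \<Longrightarrow> f x = 0"
  shows "f \<in> l2 E"
proof -
  have "(\<lambda>x. (cmod (f x))\<^sup>2) summable_on E \<longleftrightarrow> (\<lambda>x. (cmod (f x))\<^sup>2) summable_on F"
    using assms by (intro summable_on_cong_neutral) auto
  then show ?thesis using assms by (auto simp: l2_def functions_on_def)
qed

lemma unit_fun_l2: "x \<in> E \<Longrightarrow> unit_fun x \<in> l2 E"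
  by (rule l2_finite_support[of "{x}"]) (auto simp: unit_fun_def)

lemma l2_inner_finite_support:
  assumes "finite F" "F \<subseteq> E" "\<And>x. x \<notin> F \<Longrightarrow> f x = 0"
  shows "l2_inner E f g = (\<Sum>x\<in>F. cnj (f x) * g x)"
proof -
  have "l2_inner E f g = infsum (\<lambda>x. cnj (f x) * g x) F"
    unfolding l2_inner_def using assms by (intro infsum_cong_neutral) auto
  then show ?thesis using assms by simp
qed

lemma l2_inner_unit_fun: "x \<in> E \<Longrightarrow> l2_inner E (unit_fun x) g = g x"
  by (subst l2_inner_finite_support[of "{x}"]) (auto simp: unit_fun_def)

lemma l2_outside: "f \<in> l2 E \<Longrightarrow> x \<notin> E \<Longrightarrow> f x = 0"
  by (simp add: l2_def functions_on_def)

lemma l2_bounded_sums: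
  assumes "f \<in> functions_on E" "\<And>F. finite F \<Longrightarrow> F \<subseteq> E \<Longrightarrow> (\<Sum>x\<in>F. (cmod (f x))\<^sup>2) \<le> B"
  shows "f \<in> l2 E"
proof -
  have "(\<lambda>x. (cmod (f x))\<^sup>2) summable_on E"
    by (rule nonneg_bdd_above_summable_on) (use assms in \<open>auto intro!: bdd_aboveI2[of _ _ B]\<close>)
  then show ?thesis using assms by (simp add: l2_def)
qed

lemma l2_inner_self: "l2_inner E f f = of_real (\<Sum>\<^sub>\<infinity>x\<in>E. (cmod (f x))\<^sup>2)"
proof -
  have "cnj z * z = of_real ((cmod z)\<^sup>2)" for z
    by (simp only: complex_norm_square mult.commute)
  moreover have "(\<Sum>\<^sub>\<infinity>x\<in>E. complex_of_real ((cmod (f x))\<^sup>2)) = of_real (\<Sum>\<^sub>\<infinity>x\<in>E. (cmod (f x))\<^sup>2)"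
  \<comment> \<open>This form of the rule covers \<open>f\<close> whose squares are not summable:
    both sums are then 0.\<close>
  proof (rule infsum_bounded_linear_strong[OF _ bounded_linear_of_real])
    let ?g = "\<lambda>x. (cmod (f x))\<^sup>2"
    show "(\<lambda>x. complex_of_real (?g x)) summable_on E \<longleftrightarrow> ?g summable_on E"
      using summable_on_Re[of "\<lambda>x. complex_of_real (?g x)" E] summable_on_of_real[of ?g E]
      by (metis (no_types, lifting) Re_complex_of_real summable_on_cong)
  qed
  ultimately show ?thesis unfolding l2_inner_def by simp
qed

lemma l2_norm_square: "(l2_norm E f)\<^sup>2 = (\<Sum>\<^sub>\<infinity>x\<in>E. (cmod (f x))\<^sup>2)"
  unfolding l2_norm_def l2_inner_self by (simp add: infsum_nonneg)

lemma sum_le_l2_norm: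
  assumes "f \<in> l2 E" "finite F" "F \<subseteq> E"
  shows "(\<Sum>x\<in>F. (cmod (f x))\<^sup>2) \<le> (l2_norm E f)\<^sup>2"
  unfolding l2_norm_square using assms by (intro finite_sum_le_infsum) (auto simp: l2_def)

lemma l2_scale: "f \<in> l2 E \<Longrightarrow> (\<lambda>x. c * f x) \<in> l2 E"
  unfolding l2_def functions_on_def
  by (auto simp: norm_mult power_mult_distrib intro!: summable_on_cmult_right)

lemma l2_add:
  assumes "f \<in> l2 E" "g \<in> l2 E"
  shows "(\<lambda>x. f x + g x) \<in> l2 E"
proof (rule l2_bounded_sums)
  show "(\<lambda>x. f x + g x) \<in> functions_on E" using assms by (simp add: l2_def functions_on_def)
  fix F assume F: "finite F" "F \<subseteq> E"
  have "(cmod (a + b))\<^sup>2 \<le> 2 * (cmod a)\<^sup>2 + 2 * (cmod b)\<^sup>2" for a b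
  proof -
    have "(cmod (a + b))\<^sup>2 \<le> (cmod a + cmod b)\<^sup>2"
      by (intro power_mono norm_triangle_ineq) simp
    also have "\<dots> \<le> 2 * (cmod a)\<^sup>2 + 2 * (cmod b)\<^sup>2"
      using zero_le_power2[of "cmod a - cmod b"] by (simp add: power2_sum power2_diff)
    finally show ?thesis .
  qed
  then have "(\<Sum>x\<in>F. (cmod (f x + g x))\<^sup>2) \<le> (\<Sum>x\<in>F. 2 * (cmod (f x))\<^sup>2 + 2 * (cmod (g x))\<^sup>2)"
    by (intro sum_mono)
  also have "\<dots> \<le> 2 * (l2_norm E f)\<^sup>2 + 2 * (l2_norm E g)\<^sup>2"
    using sum_le_l2_norm[OF assms(1) F] sum_le_l2_norm[OF assms(2) F]
    by (simp add: sum.distrib sum_distrib_left[symmetric])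
  finally show "(\<Sum>x\<in>F. (cmod (f x + g x))\<^sup>2) \<le> 2 * (l2_norm E f)\<^sup>2 + 2 * (l2_norm E g)\<^sup>2" .
qed

text \<open>Boundedness of \<open>A\<close> yields the Bessel inequality. That inequality in turn
  forces every solution of the resolvent equation in \<open>H\<close> into \<open>l2 E\<close>,
  where it can be compared with the true inverse of \<open>I + A\<close>.\<close>

lemma functional_hilbert_of_hypothesis_H:
  assumes E: "countable E" and hyp: "hypothesis_H E A"
  obtains H ip where "functional_hilbert E H ip (kernel_fun E (dpp_operator E A))"
    "\<And>x y. x \<in> E \<Longrightarrow> y \<in> E \<Longrightarrow> ip (unit_fun x) (unit_fun y) = kernel_fun E A x y"
proof -
  obtain H ip where H: "l2 E \<subseteq> H" "H \<subseteq> functions_on E" "inner_product_on H ip"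
    "\<forall>f\<in>l2 E. \<forall>g\<in>l2 E. ip f g = l2_inner E f (A g)"
    "Metric_space.mcomplete H (ip_dist H ip)"
    "\<forall>y\<in>E. continuous_map (Metric_space.mtopology H (ip_dist H ip)) euclidean (\<lambda>f. f y)"
    using hyp unfolding hypothesis_H_def functionally_completed_def by blast
  have bA: "bounded_operator E A" using hyp by (simp add: hypothesis_H_def)
  have A_l2: "A f \<in> l2 E" if "f \<in> l2 E" for f using bA that by (simp add: bounded_operator_def)
  have A_add: "A (\<lambda>x. f x + g x) = (\<lambda>x. A f x + A g x)" if "f \<in> l2 E" "g \<in> l2 E" for f g
    using bA that by (simp add: bounded_operator_def)
  have A_scale: "A (\<lambda>x. c * f x) = (\<lambda>x. c * A f x)" if "f \<in> l2 E" for f c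
    using bA that by (simp add: bounded_operator_def)
  obtain C0 where C0: "\<forall>f\<in>l2 E. l2_norm E (A f) \<le> C0 * l2_norm E f"
    using bA unfolding bounded_operator_def by blast
  interpret function_hilbert_space E H ip
    by unfold_locales (use H(3,5,6) subsetD[OF H(1) unit_fun_l2] in auto)
  have ip_unit: "ip (unit_fun z) u = A u z" if "u \<in> l2 E" "z \<in> E" for u z
    using H(4) that unit_fun_l2[OF that(2)] l2_inner_unit_fun[OF that(2)] by metis
  \<comment> \<open>\<open>C0\<close> could be negative when \<open>E\<close> is empty; the case
    \<open>s = 0\<close> of the Bessel bound needs a nonnegative constant.\<close>
  define C where "C = max C0 0"
  have l2n: "0 \<le> l2_norm E f" for f
    unfolding l2_norm_def l2_inner_self by (simp add: infsum_nonneg)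
  have C: "l2_norm E (A f) \<le> C * l2_norm E f" if "f \<in> l2 E" for f
  proof -
    have "l2_norm E (A f) \<le> C0 * l2_norm E f" using C0 that by blast
    also have "\<dots> \<le> C * l2_norm E f" unfolding C_def by (intro mult_right_mono l2n) simp
    finally show ?thesis .
  qed
  \<comment> \<open>\<open>u\<close> is paired with the combination \<open>?v\<close> of unit
    functions whose coefficients are its own pairings \<open>c\<close>. The pairing equals
    \<open>s\<close> while \<open>nsq ?v\<close> is at most \<open>C * s\<close>, so Cauchy-Schwarz
    gives the bound after cancelling \<open>s\<close>.\<close>
  have bessel: "(\<Sum>x\<in>F. (cmod (ip (unit_fun x) u))\<^sup>2) \<le> C * Re (ip u u)"
    if u: "u \<in> H" and F: "finite F" "F \<subseteq> E" for u F
  proof -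
    define c where "c x = ip (unit_fun x) u" for x
    define s where "s = (\<Sum>x\<in>F. (cmod (c x))\<^sup>2)"
    let ?v = "comb F c"
    have vl2: "?v \<in> l2 E" by (rule l2_finite_support[OF F]) (simp add: comb_def)
    have s0: "0 \<le> s" unfolding s_def by (intro sum_nonneg) simp
    have sq: "cnj z * z = of_real ((cmod z)\<^sup>2)" for z
      by (simp only: complex_norm_square mult.commute)
    have "ip ?v u = (\<Sum>x\<in>F. cnj (c x) * c x)"
      unfolding ip_comb_left[OF F u] c_def ..
    then have "ip ?v u = of_real s" unfolding sq s_def by simp
    then have 1: "s\<^sup>2 \<le> nsq ?v * nsq u"
      using Cauchy_Schwarz[OF comb_mem[OF F] u, of c] s0 by simp
    have "l2_inner E ?v ?v = (\<Sum>x\<in>F. cnj (c x) * c x)"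
      by (subst l2_inner_finite_support[OF F]) (auto simp: comb_def)
    then have norm_v: "l2_norm E ?v = sqrt s"
      unfolding l2_norm_def sq s_def by simp
    have "nsq ?v = Re (l2_inner E ?v (A ?v))" using H(4) vl2 by (simp add: nsq_def)
    also have "l2_inner E ?v (A ?v) = (\<Sum>x\<in>F. cnj (c x) * A ?v x)"
      by (subst l2_inner_finite_support[OF F]) (auto simp: comb_def)
    also have "Re \<dots> \<le> cmod \<dots>" by (rule complex_Re_le_cmod)
    also have "\<dots> \<le> (\<Sum>x\<in>F. cmod (c x) * cmod (A ?v x))"
      by (rule order_trans[OF norm_sum]) (simp add: norm_mult)
    also have "\<dots> \<le> sqrt ((\<Sum>x\<in>F. (cmod (c x))\<^sup>2) * (\<Sum>x\<in>F. (cmod (A ?v x))\<^sup>2))"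
      by (intro real_le_rsqrt Cauchy_Schwarz_ineq_sum)
    also have "\<dots> \<le> sqrt (s * (l2_norm E (A ?v))\<^sup>2)"
      unfolding s_def[symmetric]
      by (intro real_sqrt_le_mono mult_left_mono s0 sum_le_l2_norm A_l2 vl2 F)
    also have "\<dots> = sqrt s * l2_norm E (A ?v)" using l2n by (simp add: real_sqrt_mult)
    also have "\<dots> \<le> sqrt s * (C * l2_norm E ?v)"
      by (intro mult_left_mono C vl2) (use s0 in simp)
    also have "\<dots> = C * s" unfolding norm_v using s0 by simp
    finally have 2: "nsq ?v \<le> C * s" .
    have "s\<^sup>2 \<le> (C * s) * nsq u"
      using 1 mult_right_mono[OF 2 nsq_nonneg[OF u]] by (rule order_trans)
    then have "s \<le> C * nsq u"
      using s0 nsq_nonneg[OF u] by (cases "s = 0") (auto simp: power2_eq_square C_def mult_ac)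
    then show ?thesis by (simp add: s_def c_def nsq_def)
  qed
  \<comment> \<open>If \<open>A d = - d\<close>, then \<open>nsq d\<close> equals minus the squared
    \<open>l2\<close> norm of \<open>d\<close>, so it is 0. Injectivity lets \<open>inv_into\<close>
    return the solution \<open>u\<close> found below.\<close>
  have inj: "inj_on (\<lambda>g x. g x + A g x) (l2 E)"
  proof (rule inj_onI)
    fix f g assume f: "f \<in> l2 E" and g: "g \<in> l2 E" and eq: "(\<lambda>x. f x + A f x) = (\<lambda>x. g x + A g x)"
    define d where "d = (\<lambda>x. f x + (-1) * g x)"
    note mg = l2_scale[OF g, of "-1"]
    have d: "d \<in> l2 E" unfolding d_def by (rule l2_add[OF f mg])
    have "A d = (\<lambda>x. A f x + (-1) * A g x)"
      unfolding d_def A_add[OF f mg] A_scale[OF g] ..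
    then have "A d x = - d x" for x
    proof -
      have "f x + A f x = g x + A g x" using fun_cong[OF eq, of x] .
      then have "A f x + (-1) * A g x = - (f x + (-1) * g x)" by algebra
      then show ?thesis unfolding \<open>A d = (\<lambda>x. A f x + (-1) * A g x)\<close> by (simp only: d_def)
    qed
    then have "ip d d = - l2_inner E d d"
      using H(4) d by (simp add: l2_inner_def infsum_uminus)
    then have "nsq d = - (\<Sum>\<^sub>\<infinity>x\<in>E. (cmod (d x))\<^sup>2)"
      by (simp add: nsq_def l2_inner_self)
    moreover have "0 \<le> (\<Sum>\<^sub>\<infinity>x\<in>E. (cmod (d x))\<^sup>2)" by (intro infsum_nonneg) simp
    moreover have dH: "d \<in> H" using d H(1) by blast
    ultimately have "nsq d = 0" using nsq_nonneg[OF dH] by linarith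
    then have "d x = 0" for x using nsq_pos[OF dH, of x] by auto
    then show "f = g" by (auto simp: d_def fun_eq_iff)
  qed
  have resolvent: "u y = unit_fun x y - kernel_fun E (dpp_operator E A) y x"
    if u: "u \<in> H" and x: "x \<in> E" and y: "y \<in> E"
      and eq: "\<And>z. z \<in> E \<Longrightarrow> u z + ip (unit_fun z) u = unit_fun x z" for u x y
  proof -
    \<comment> \<open>\<open>g\<close> plays the role of \<open>A u\<close> before \<open>u\<close>
      is known to lie in \<open>l2 E\<close>. It is square-summable by the Bessel inequality, and
      the equation writes \<open>u\<close> as \<open>unit_fun x - g\<close>.\<close>
    define g where "g z = (if z \<in> E then ip (unit_fun z) u else 0)" for z
    have "g \<in> l2 E"
    proof (rule l2_bounded_sums)
      show "g \<in> functions_on E" by (simp add: functions_on_def g_def)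
      fix F assume F: "finite F" "F \<subseteq> E"
      have "(\<Sum>x\<in>F. (cmod (g x))\<^sup>2) = (\<Sum>x\<in>F. (cmod (ip (unit_fun x) u))\<^sup>2)"
        using F by (intro sum.cong) (auto simp: g_def)
      then show "(\<Sum>x\<in>F. (cmod (g x))\<^sup>2) \<le> C * Re (ip u u)" using bessel[OF u F] by simp
    qed
    moreover have "u = (\<lambda>z. unit_fun x z + (-1) * g z)"
    proof
      fix z
      show "u z = unit_fun x z + (-1) * g z"
      proof (cases "z \<in> E")
        case True
        then show ?thesis using eq[OF True] by (simp add: g_def algebra_simps)
      next
        case False
        then have "u z = 0" using u H(2) by (auto simp: functions_on_def)
        then show ?thesis using False x by (auto simp: g_def unit_fun_def)
      qed
    qed
    ultimately have ul2: "u \<in> l2 E" using l2_add[OF unit_fun_l2[OF x] l2_scale] by metis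
    have "(\<lambda>z. u z + A u z) = unit_fun x"
    proof
      fix z
      show "u z + A u z = unit_fun x z"
      proof (cases "z \<in> E")
        case True
        then show ?thesis using eq ip_unit[OF ul2] by simp
      next
        case False
        then show ?thesis using l2_outside[OF ul2] l2_outside[OF A_l2[OF ul2]] x by (auto simp: unit_fun_def)
      qed
    qed
    then have "inv_into (l2 E) (\<lambda>g x. g x + A g x) (unit_fun x) = u"
      using inv_into_f_f[OF inj ul2] by simp
    then have "kernel_fun E (dpp_operator E A) y x = A u y"
      using y by (simp add: kernel_fun_def dpp_operator_def l2_inner_unit_fun)
    then show ?thesis using eq[OF y] ip_unit[OF ul2 y] by (simp add: algebra_simps)
  qed
  show ?thesis
  proof (rule that)
    show "functional_hilbert E H ip (kernel_fun E (dpp_operator E A))"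
      by unfold_locales (use E bessel resolvent in blast)+
    show "ip (unit_fun x) (unit_fun y) = kernel_fun E A x y" if "x \<in> E" "y \<in> E" for x y
      using H(4) unit_fun_l2[OF that(1)] unit_fun_l2[OF that(2)] by (simp add: kernel_fun_def)
  qed
qed

theorem theorem2p5:
  fixes E :: "'a set" and A :: "'a operator" and \<mu> :: "'a set measure"
  assumes "countable E"
    and "hypothesis_H E A"
    and "determinantal_process E (dpp_operator E A) \<mu>"
  shows "gibbs_measure E (det_potential E A) \<mu> \<and>
         (\<forall>\<nu>. gibbs_measure E (det_potential E A) \<nu> \<longrightarrow> \<nu> = \<mu>)"
proof -
  obtain H ip where fh: "functional_hilbert E H ip (kernel_fun E (dpp_operator E A))"
    and kern: "\<And>x y. x \<in> E \<Longrightarrow> y \<in> E \<Longrightarrow> ip (unit_fun x) (unit_fun y) = kernel_fun E A x y"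
    by (rule functional_hilbert_of_hypothesis_H[OF assms(1,2)]) (rule that)
  interpret functional_hilbert E H ip "kernel_fun E (dpp_operator E A)" by (rule fh)
  interpret determinantal_config E H ip "kernel_fun E (dpp_operator E A)" \<mu>
    by unfold_locales (use assms(3) in \<open>auto simp: determinantal_process_def\<close>)
  \<comment> \<open>The potential is defined by the matrix of \<open>A\<close>, the weights by the
    Gram matrix of \<open>ip\<close>; the two agree at sites of \<open>E\<close>.\<close>
  have V: "det_potential E A X = - ln (weight X)" if "finite X" "X \<subseteq> E" for X
  proof -
    have "det_on X (kernel_fun E A) = det_on X kern"
      using that by (intro det_on_cong) (simp add: kern_def kern subset_iff)
    then show ?thesis by (simp add: det_potential_def weight_def)
  qed
  show ?thesis using gibbs_measure_unique[OF V] by blast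
qed

end
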